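(* Let $K$ be a field of characteristic $0$, $S$ a finite set of local primes of $K$, $\tau=(e,f)$ a pair of positive integers, and $F\supseteq K$ a $\mathrm{P}S^\tau\mathrm{CC}$ field. Then for each $\mathfrak p\in S$, the set $\mathcal S_{\mathfrak p}^\tau(F)$ satisfies the strong approximation property (SAP).
   Context: A prime of a field $L$ is either an equivalence class of Krull valuations or an ordering; $\mathcal O_{\mathfrak P}$ denotes the valuation ring resp. the positive cone $\{x:x\ge_{\mathfrak P}0\}$. $\mathfrak P$ lies above a prime $\mathfrak p$ of a subfield $L_0$ if $\mathcal O_{\mathfrak P}\cap L_0=\mathcal O_{\mathfrak p}$. A $p$-valuation is a valuation on a characteristic-$0$ field with residue characteristic $p>0$ and $\dim_{\mathbb F_p}\mathcal O_v/p\mathcal O_v<\infty$; its value group is discrete (normalized so $\mathbb Z$ is convex), residue field finite, type $(p,e,f)$ with $e=v(p)$, $f$ the residue degree. Classical primes: classes of $p$-valuations and orderings (type $(\infty,1,1)$). Local primes: classical with value group $\cong\mathbb Z$, or archimedean orderings. Relative type of $\mathfrak P$ over $\mathfrak p$: $(e_{\mathfrak P}/e_{\mathfrak p},f_{\mathfrak P}/f_{\mathfrak p})$, ordered by $(e,f)\le(e',f')$ iff $e\le e'$, $f\mid f'$. $\mathcal S_{\mathfrak p}^\tau(F)$: classical primes of $F$ above $\mathfrak p$ with relative type $\le\tau$. Classical closures are $p$-adic closures (algebraic, $p$-adically closed of same $p$-rank) resp. real closures; $\mathrm{CC}_S^\tau(F)$ is the set of classical closures of $F$ at primes in $\bigcup_{\mathfrak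 p\in S}\mathcal S_{\mathfrak p}^\tau(F)$. $F$ is $\mathrm{P}S^\tau\mathrm{CC}$ if every smooth (geometrically integral) $F$-variety with an $F'$-rational point for all $F'\in\mathrm{CC}_S^\tau(F)$ has an $F$-rational point. The Zariski topology on the set of all primes of $F$ has subbasis the sets $H(a)=\{\mathfrak P:a\in\mathcal O_{\mathfrak P}\}$, $a\in F$. A set $\mathcal S$ of primes satisfies SAP if $\mathcal S$ with the subspace topology is profinite (totally disconnected compact Hausdorff) and the family $\{H(a)\cap\mathcal S: a\in F\}$ is closed under finite intersections. *)

theory Defs
  imports
    "HOL-Analysis.Analysis"
    "HOL-Algebra.Algebraic_Closure_Type"
    "HOL-Library.Poly_Mapping"
    "HOL-Computational_Algebra.Fraction_Field"
begin

section \<open>Primes of a field\<close>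

definition is_subfield :: "'a::field set \<Rightarrow> bool" where
  "is_subfield L \<longleftrightarrow> 0 \<in> L \<and> 1 \<in> L \<and>
     (\<forall>x\<in>L. \<forall>y\<in>L. x + y \<in> L \<and> x * y \<in> L) \<and> (\<forall>x\<in>L. - x \<in> L \<and> inverse x \<in> L)"

definition is_subring :: "'a::field set \<Rightarrow> bool" where
  "is_subring R \<longleftrightarrow> 0 \<in> R \<and> 1 \<in> R \<and>
     (\<forall>x\<in>R. \<forall>y\<in>R. x + y \<in> R \<and> x * y \<in> R) \<and> (\<forall>x\<in>R. - x \<in> R)"

text \<open>
  A prime \<open>P\<close> of a field \<open>L\<close> is represented by the set \<open>O_P\<close>. Equivalence classes of Krull
  valuations of \<open>L\<close> correspond to valuation rings of \<open>L\<close> (the trivial one included), and orderings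
  to their cones of nonnegative elements. The two kinds cannot be confused, as a valuation ring
  contains \<open>-1\<close> and a positive cone does not.
\<close>

definition valuation_ring_on :: "'a::field set \<Rightarrow> 'a set \<Rightarrow> bool" where
  "valuation_ring_on L V \<longleftrightarrow> V \<subseteq> L \<and> is_subring V \<and> (\<forall>x\<in>L. x \<in> V \<or> inverse x \<in> V)"

definition ordering_on :: "'a::field set \<Rightarrow> 'a set \<Rightarrow> bool" where
  "ordering_on L P \<longleftrightarrow> P \<subseteq> L \<and> (\<forall>x\<in>P. \<forall>y\<in>P. x + y \<in> P \<and> x * y \<in> P) \<and>
     (\<forall>x\<in>L. x \<in> P \<or> - x \<in> P) \<and> (\<forall>x. x \<in> P \<and> - x \<in> P \<longrightarrow> x = 0)"

definition prime_on :: "'a::field set \<Rightarrow> 'a set \<Rightarrow> bool" where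
  "prime_on L P \<longleftrightarrow> valuation_ring_on L P \<or> ordering_on L P"

text \<open>The nonunits of a subring of a field.\<close>

definition max_ideal :: "'a::field set \<Rightarrow> 'a set" where
  "max_ideal R = {x \<in> R. x = 0 \<or> inverse x \<notin> R}"

text \<open>
  For an ideal \<open>I\<close> of \<open>R\<close> containing the prime number \<open>p\<close>, the integer combinations modulo \<open>I\<close> are
  the \<open>F_p\<close>-linear combinations in \<open>R/I\<close>. Hence \<open>fp_finite_dim R I\<close> says that \<open>R/I\<close> has finite
  dimension over \<open>F_p\<close>, and \<open>fp_dim R I\<close> is that dimension, the least size of a spanning set.
\<close>

definition spans_mod :: "'a::field set \<Rightarrow> 'a set \<Rightarrow> 'a set \<Rightarrow> bool" where
  "spans_mod R I B \<longleftrightarrow> finite B \<and> B \<subseteq> R \<and>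
     (\<forall>x\<in>R. \<exists>c :: 'a \<Rightarrow> int. x - (\<Sum>b\<in>B. of_int (c b) * b) \<in> I)"

definition fp_finite_dim :: "'a::field set \<Rightarrow> 'a set \<Rightarrow> bool" where
  "fp_finite_dim R I \<longleftrightarrow> (\<exists>B. spans_mod R I B)"

definition fp_dim :: "'a::field set \<Rightarrow> 'a set \<Rightarrow> nat" where
  "fp_dim R I = (LEAST d. \<exists>B. spans_mod R I B \<and> card B = d)"

text \<open>The ideal \<open>pV\<close>.\<close>

definition multiples :: "nat \<Rightarrow> 'a::field set \<Rightarrow> 'a set" where
  "multiples p V = (\<lambda>x. of_nat p * x) ` V"

text \<open>
  The requirement of characteristic 0 is not repeated here: it is met by every field this is
  applied to.
\<close>

definition p_valuation :: "'a::field set \<Rightarrow> 'a set \<Rightarrow> bool" where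
  "p_valuation L V \<longleftrightarrow> valuation_ring_on L V \<and>
     (\<exists>p::nat. Factorial_Ring.prime p \<and> of_nat p \<in> max_ideal V \<and> fp_finite_dim V (multiples p V))"

definition residue_char :: "'a::field set \<Rightarrow> nat" where
  "residue_char V = (THE p. Factorial_Ring.prime p \<and> of_nat p \<in> max_ideal V)"

definition p_rank :: "'a::field set \<Rightarrow> nat" where
  "p_rank V = fp_dim V (multiples (residue_char V) V)"

text \<open>An element of least positive value, i.e. of value 1 in the normalized value group.\<close>

definition uniformizer :: "'a::field set \<Rightarrow> 'a \<Rightarrow> bool" where
  "uniformizer V t \<longleftrightarrow> t \<in> max_ideal V \<and> (\<forall>x\<in>max_ideal V. \<exists>y\<in>V. x = t * y)"

definition ram_index :: "'a::field set \<Rightarrow> 'a set \<Rightarrow> nat" where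
  "ram_index L P = (if ordering_on L P then 1 else
     (THE e. \<exists>t. uniformizer P t \<and> of_nat (residue_char P) / t ^ e \<in> P - max_ideal P))"

definition res_degree :: "'a::field set \<Rightarrow> 'a set \<Rightarrow> nat" where
  "res_degree L P = (if ordering_on L P then 1 else fp_dim P (max_ideal P))"

definition classical_prime :: "'a::field set \<Rightarrow> 'a set \<Rightarrow> bool" where
  "classical_prime L P \<longleftrightarrow> p_valuation L P \<or> ordering_on L P"

text \<open>
  The value group is isomorphic to the integers: some surjective homomorphism from the
  multiplicative group of \<open>L\<close> to the integers is a valuation with valuation ring \<open>V\<close>.
\<close>

definition value_group_int :: "'a::field set \<Rightarrow> 'a set \<Rightarrow> bool" where
  "value_group_int L V \<longleftrightarrow> (\<exists>v :: 'a \<Rightarrow> int.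
     (\<forall>x\<in>L - {0}. \<forall>y\<in>L - {0}. v (x * y) = v x + v y) \<and>
     v ` (L - {0}) = UNIV \<and> (\<forall>x\<in>L - {0}. x \<in> V \<longleftrightarrow> v x \<ge> 0))"

definition archimedean_ordering_on :: "'a::field set \<Rightarrow> 'a set \<Rightarrow> bool" where
  "archimedean_ordering_on L P \<longleftrightarrow>
     ordering_on L P \<and> (\<forall>x\<in>L. \<exists>n::nat. of_nat n - x \<in> P)"

definition local_prime :: "'a::field set \<Rightarrow> 'a set \<Rightarrow> bool" where
  "local_prime L P \<longleftrightarrow>
     (p_valuation L P \<and> value_group_int L P) \<or> archimedean_ordering_on L P"

text \<open>
  The divisions are exact when \<open>P\<close> is a classical prime of \<open>F\<close> above a classical prime \<open>q\<close> of a
  subfield \<open>K\<close>. The pairs \<open>(e, f)\<close> are ordered by \<open>\<le>\<close> in the first and by divisibility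
  in the second component.
\<close>

definition relative_type :: "'a::field set \<Rightarrow> 'a set \<Rightarrow> 'a set \<Rightarrow> 'a set \<Rightarrow> nat \<times> nat" where
  "relative_type K q F P =
     (ram_index F P div ram_index K q, res_degree F P div res_degree K q)"

definition type_le :: "nat \<times> nat \<Rightarrow> nat \<times> nat \<Rightarrow> bool" where
  "type_le \<sigma> \<tau> \<longleftrightarrow> fst \<sigma> \<le> fst \<tau> \<and> snd \<sigma> dvd snd \<tau>"

text \<open>From here on the field \<open>F\<close> is the whole type \<open>'f\<close>.\<close>

definition primes_above :: "'f::field set \<Rightarrow> 'f set \<Rightarrow> nat \<times> nat \<Rightarrow> 'f set set" where
  "primes_above K q \<tau> =
     {P. classical_prime UNIV P \<and> P \<inter> K = q \<and> type_le (relative_type K q UNIV P) \<tau>}"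


section \<open>Classical closures\<close>

text \<open>
  All algebraic extensions of \<open>F\<close> are taken inside the fixed algebraic closure \<open>'f alg_closure\<close>,
  into which \<open>F\<close> is embedded by \<^const>\<open>to_ac\<close>; the algebraic extensions of an intermediate field
  \<open>R\<close> are, up to isomorphism over \<open>R\<close>, the subfields containing \<open>R\<close>.
\<close>

definition formally_real :: "'a::field set \<Rightarrow> bool" where
  "formally_real R \<longleftrightarrow> (\<forall>xs. set xs \<subseteq> R \<longrightarrow> (\<Sum>x\<leftarrow>xs. x ^ 2) \<noteq> - 1)"

definition real_closed :: "'f::field alg_closure set \<Rightarrow> bool" where
  "real_closed R \<longleftrightarrow> is_subfield R \<and> range to_ac \<subseteq> R \<and> formally_real R \<and>
     (\<forall>R'. is_subfield R' \<and> R \<subseteq> R' \<and> formally_real R' \<longrightarrow> R' = R)"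

definition p_adically_closed :: "'f::field alg_closure set \<Rightarrow> 'f alg_closure set \<Rightarrow> bool" where
  "p_adically_closed R Q \<longleftrightarrow> is_subfield R \<and> range to_ac \<subseteq> R \<and> p_valuation R Q \<and>
     (\<forall>R' Q'. is_subfield R' \<and> R \<subseteq> R' \<and> p_valuation R' Q' \<and> Q' \<inter> R = Q \<and> p_rank Q' = p_rank Q
        \<longrightarrow> R' = R)"

definition real_closure :: "'f::field set \<Rightarrow> 'f alg_closure set \<Rightarrow> bool" where
  "real_closure P R \<longleftrightarrow> ordering_on UNIV P \<and> real_closed R \<and>
     (\<exists>Q. ordering_on R Q \<and> Q \<inter> range to_ac = to_ac ` P)"

definition p_adic_closure :: "'f::field set \<Rightarrow> 'f alg_closure set \<Rightarrow> bool" where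
  "p_adic_closure P R \<longleftrightarrow> p_valuation UNIV P \<and>
     (\<exists>Q. p_adically_closed R Q \<and> Q \<inter> range to_ac = to_ac ` P \<and> p_rank Q = p_rank P)"

definition classical_closures ::
    "'f::field set \<Rightarrow> 'f set set \<Rightarrow> nat \<times> nat \<Rightarrow> 'f alg_closure set set" where
  "classical_closures K S \<tau> =
     {R. \<exists>P\<in>(\<Union>q\<in>S. primes_above K q \<tau>). p_adic_closure P R \<or> real_closure P R}"


section \<open>Varieties\<close>

text \<open>Polynomials in the variables \<open>X_0, X_1, \<dots>\<close>, and those only involving variables from \<open>J\<close>.\<close>

type_synonym 'a mpol = "(nat \<Rightarrow>\<^sub>0 nat) \<Rightarrow>\<^sub>0 'a"

definition polys :: "nat set \<Rightarrow> 'a::zero mpol set" where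
  "polys J = {p. \<forall>m\<in>Poly_Mapping.keys p. Poly_Mapping.keys m \<subseteq> J}"

text \<open>
  The value at \<open>x\<close> of a polynomial, and of its partial derivative with respect to \<open>X_i\<close>, after
  applying \<open>h\<close> to the coefficients.
\<close>

definition ev :: "('a::zero \<Rightarrow> 'b::comm_ring_1) \<Rightarrow> 'a mpol \<Rightarrow> (nat \<Rightarrow> 'b) \<Rightarrow> 'b" where
  "ev h p x = (\<Sum>m\<in>Poly_Mapping.keys p. h (Poly_Mapping.lookup p m) *
      (\<Prod>j\<in>Poly_Mapping.keys m. x j ^ Poly_Mapping.lookup m j))"

definition ev_deriv ::
    "nat \<Rightarrow> ('a::zero \<Rightarrow> 'b::comm_ring_1) \<Rightarrow> 'a mpol \<Rightarrow> (nat \<Rightarrow> 'b) \<Rightarrow> 'b" where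
  "ev_deriv i h p x = (\<Sum>m\<in>Poly_Mapping.keys p. h (Poly_Mapping.lookup p m) *
      of_nat (Poly_Mapping.lookup m i) *
      (\<Prod>j\<in>Poly_Mapping.keys m. x j ^ (Poly_Mapping.lookup m j - (if j = i then 1 else 0))))"

text \<open>
  A universal domain over \<open>F\<close>: the algebraic closure of the rational function field over \<open>F\<close> in
  countably many variables. Every finitely generated field extension of \<open>F\<close> embeds into it.
\<close>

type_synonym 'f univ_dom = "'f mpol fract alg_closure"

definition emb :: "'f::field \<Rightarrow> 'f univ_dom" where
  "emb c = to_ac (Fract (Poly_Mapping.single 0 c) 1)"

text \<open>
  Geometrically integral varieties over \<open>F\<close> are in particular integral separated \<open>F\<close>-schemes of
  finite type. These are given here in the form of Chevalley schemes (EGA I, 8.3): by a finite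
  affine open cover, whose members are the spectra of finitely generated \<open>F\<close>-subalgebras of one
  common function field, such that any two of the arising local rings that are dominated by a common
  local ring coincide. A chart \<open>(n, x)\<close> stands for the algebra \<open>F[x_0, \<dots>, x_{n-1}]\<close>, that is
  \<open>F[X_0, \<dots>, X_{n-1}]\<close> modulo \<open>chart_ideal n x\<close>. Since residue fields of its primes embed into the
  universal domain over \<open>F\<close>, every scheme point of the chart is the kernel of evaluation at a point
  \<open>y\<close> with coordinates in the universal domain.
  Of \<open>x\<close> and \<open>y\<close> only the coordinates with index below \<open>n\<close> matter.
\<close>

type_synonym 'f chart = "nat \<times> (nat \<Rightarrow> 'f univ_dom)"

definition chart_ideal :: "nat \<Rightarrow> (nat \<Rightarrow> 'f::field univ_dom) \<Rightarrow> 'f mpol set" where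
  "chart_ideal n x = {p \<in> polys {..<n}. ev emb p x = 0}"

definition function_field :: "nat \<Rightarrow> (nat \<Rightarrow> 'f::field univ_dom) \<Rightarrow> 'f univ_dom set" where
  "function_field n x =
     {ev emb p x / ev emb q x | p q. p \<in> polys {..<n} \<and> q \<in> polys {..<n} \<and> ev emb q x \<noteq> 0}"

definition chart_points ::
    "nat \<Rightarrow> (nat \<Rightarrow> 'f::field univ_dom) \<Rightarrow> (nat \<Rightarrow> 'f univ_dom) set" where
  "chart_points n x = {y. \<forall>p\<in>chart_ideal n x. ev emb p y = 0}"

definition local_ring_at ::
    "nat \<Rightarrow> (nat \<Rightarrow> 'f::field univ_dom) \<Rightarrow> (nat \<Rightarrow> 'f univ_dom) \<Rightarrow> 'f univ_dom set" where
  "local_ring_at n x y =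
     {ev emb p x / ev emb q x | p q. p \<in> polys {..<n} \<and> q \<in> polys {..<n} \<and> ev emb q y \<noteq> 0}"

definition is_local_subring :: "'a::field set \<Rightarrow> bool" where
  "is_local_subring R \<longleftrightarrow> is_subring R \<and> (\<forall>x\<in>max_ideal R. \<forall>y\<in>max_ideal R. x + y \<in> max_ideal R)"

definition dominates :: "'a::field set \<Rightarrow> 'a set \<Rightarrow> bool" where
  "dominates R M \<longleftrightarrow> M \<subseteq> R \<and> max_ideal R \<inter> M = max_ideal M"

definition allied :: "'a::field set \<Rightarrow> 'a set \<Rightarrow> bool" where
  "allied M N \<longleftrightarrow> (\<exists>R. is_local_subring R \<and> dominates R M \<and> dominates R N)"

definition integral_variety :: "'f::field chart set \<Rightarrow> bool" where
  "integral_variety V \<longleftrightarrow> finite V \<and> V \<noteq> {} \<and>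
     (\<forall>(n, x)\<in>V. \<forall>(n', x')\<in>V. function_field n x = function_field n' x' \<and>
        (\<forall>y\<in>chart_points n x. \<forall>y'\<in>chart_points n' x'.
           allied (local_ring_at n x y) (local_ring_at n' x' y') \<longrightarrow>
           local_ring_at n x y = local_ring_at n' x' y'))"

text \<open>
  The ideal generated by \<open>chart_ideal n x\<close> in the polynomial ring in \<open>X_0, \<dots>, X_{n-1}\<close> over the
  algebraic closure of \<open>F\<close>; the quotient is the coordinate ring of the base change of the chart.
\<close>

definition geometric_ideal :: "nat \<Rightarrow> (nat \<Rightarrow> 'f::field univ_dom) \<Rightarrow> 'f alg_closure mpol set" where
  "geometric_ideal n x = {\<Sum>k<r. g k * Poly_Mapping.map to_ac (p k) | (r::nat) g p.
     (\<forall>k<r. g k \<in> polys {..<n} \<and> p k \<in> chart_ideal n x)}"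

text \<open>
  The base changes of any two charts meet (they have a nonempty open subscheme of the variety in
  common), so the base change of the variety is integral iff the base change of each chart is.
\<close>

definition geometrically_integral :: "'f::field chart set \<Rightarrow> bool" where
  "geometrically_integral V \<longleftrightarrow> (\<forall>(n, x)\<in>V. 1 \<notin> geometric_ideal n x \<and>
     (\<forall>a\<in>polys {..<n}. \<forall>b\<in>polys {..<n}. a * b \<in> geometric_ideal n x \<longrightarrow>
        a \<in> geometric_ideal n x \<or> b \<in> geometric_ideal n x))"

text \<open>
  The dimension of a chart is the transcendence degree of its function field: the size of a
  transcendence basis chosen among the generators \<open>x_0, \<dots>, x_{n-1}\<close>.
\<close>

definition alg_independent :: "nat set \<Rightarrow> (nat \<Rightarrow> 'f::field univ_dom) \<Rightarrow> bool" where
  "alg_independent J x \<longleftrightarrow> (\<forall>p\<in>polys J. ev emb p x = 0 \<longrightarrow> p = 0)"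

definition chart_dim :: "nat \<Rightarrow> (nat \<Rightarrow> 'f::field univ_dom) \<Rightarrow> nat" where
  "chart_dim n x = Max {card J | J. J \<subseteq> {..<n} \<and> alg_independent J x}"

text \<open>
  The kernel of the Jacobian matrix at \<open>y\<close>, i.e. the dual of the fibre at \<open>y\<close> of the module of
  differentials. The variety is smooth iff this fibre has dimension \<open>chart_dim n x\<close>
  everywhere (Hartshorne III.10; flatness over a field is automatic).
\<close>

definition tangent_space ::
    "nat \<Rightarrow> (nat \<Rightarrow> 'f::field univ_dom) \<Rightarrow> (nat \<Rightarrow> 'f univ_dom) \<Rightarrow> (nat \<Rightarrow>\<^sub>0 'f univ_dom) set" where
  "tangent_space n x y = {v. Poly_Mapping.keys v \<subseteq> {..<n} \<and>
     (\<forall>p\<in>chart_ideal n x. (\<Sum>i<n. ev_deriv i emb p y * Poly_Mapping.lookup v i) = 0)}"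

definition scale_vec :: "'a::field \<Rightarrow> (nat \<Rightarrow>\<^sub>0 'a) \<Rightarrow> (nat \<Rightarrow>\<^sub>0 'a)" where
  "scale_vec c v = Poly_Mapping.map ((*) c) v"

lemma lookup_scale_vec: "Poly_Mapping.lookup (scale_vec c v) i = c * Poly_Mapping.lookup v i"
  by (simp add: scale_vec_def Poly_Mapping.map.rep_eq when_def)

lemma vector_space_scale_vec: "vector_space (scale_vec :: 'a::field \<Rightarrow> _)"
  by unfold_locales
    (auto intro!: poly_mapping_eqI simp: lookup_scale_vec lookup_add algebra_simps)

definition smooth_variety :: "'f::field chart set \<Rightarrow> bool" where
  "smooth_variety V \<longleftrightarrow> (\<forall>(n, x)\<in>V. \<forall>y\<in>chart_points n x.
     vector_space.dim scale_vec (tangent_space n x y) = chart_dim n x)"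

definition has_rational_point :: "'f::field alg_closure set \<Rightarrow> 'f chart set \<Rightarrow> bool" where
  "has_rational_point R V \<longleftrightarrow> (\<exists>(n, x)\<in>V. \<exists>y :: nat \<Rightarrow> 'f alg_closure.
     (\<forall>i<n. y i \<in> R) \<and> (\<forall>p\<in>chart_ideal n x. ev to_ac p y = 0))"


section \<open>\<open>PS\<^sup>\<tau>CC\<close> fields and strong approximation\<close>

text \<open>\<open>range to_ac\<close> is the copy of \<open>F\<close> in its algebraic closure.\<close>

definition PSCC :: "'f::field set \<Rightarrow> 'f set set \<Rightarrow> nat \<times> nat \<Rightarrow> bool" where
  "PSCC K S \<tau> \<longleftrightarrow> (\<forall>V :: 'f chart set.
     integral_variety V \<and> geometrically_integral V \<and> smooth_variety V \<and>
     (\<forall>R\<in>classical_closures K S \<tau>. has_rational_point R V) \<longrightarrow>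
     has_rational_point (range to_ac) V)"

definition H :: "'f::field \<Rightarrow> 'f set set" where
  "H a = {P. prime_on UNIV P \<and> a \<in> P}"

definition zariski :: "'f::field set topology" where
  "zariski = topology_generated_by (range H)"

definition profinite_space :: "'a topology \<Rightarrow> bool" where
  "profinite_space T \<longleftrightarrow> compact_space T \<and> Hausdorff_space T \<and>
     (\<forall>C. connectedin T C \<longrightarrow> (\<exists>a. C \<subseteq> {a}))"

definition SAP :: "'f::field set set \<Rightarrow> bool" where
  "SAP A \<longleftrightarrow> profinite_space (subtopology zariski A) \<and>
     (\<forall>a b. \<exists>c. (H a \<inter> A) \<inter> (H b \<inter> A) = H c \<inter> A)"

end

theory Submission
  imports Defs
begin

text \<open>
  Over a \<open>p\<close>-adic prime \<open>q\<close> with uniformizer \<open>c\<close>, the set of primes \<open>P\<close> in question is defined by the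
  conditions that \<open>x\<^sup>e / c\<close> is integral for \<open>x\<close> in the maximal ideal, and \<open>x\<^sup>n - x\<close> is in the maximal ideal for
  \<open>x\<close> integral, where \<open>n\<close> is the \<open>f\<close>-th power of the cardinality of the residue field of \<open>q\<close>. Hence it
  is closed in the constructible topology. The first condition makes each \<open>H(a)\<close> clopen, and the second
  makes \<open>a\<^sup>n - a b\<^sup>n\<^sup>-\<^sup>1 + b\<^sup>n\<close> integral iff \<open>a\<close> and \<open>b\<close> are.

  Over an ordering, only the intersection of \<open>H(a)\<close> and \<open>H(b)\<close> is not immediate. Positivity of both \<open>a\<close> and \<open>b\<close>
  is detected by an element that is represented by the forms \<open>\<langle>a, b\<rangle>\<close> and \<open>\<langle>a b, -1, -N\<rangle>\<close>, where
  \<open>N > 0\<close> is an integer with \<open>-N\<close> a square at the \<open>p\<close>-adic primes. Such elements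
  are provided by the rational points of a hyperelliptic curve \<open>w\<^sup>2 = D(t)\<close>. It has points over all real
  closures by the choice of \<open>D\<close>, and over all \<open>p\<close>-adic closures near infinity, since the leading coefficient of
  \<open>D\<close> is \<open>-1/N\<close>. Removing the points with \<open>w = 0\<close> makes the curve smooth without a condition on the
  discriminant of \<open>D\<close>, and it is geometrically integral as \<open>D\<close> is an even sextic with nonzero constant
  coefficient.
\<close>

section \<open>Valuation rings\<close>

text \<open>At an ordering the first form is positive definite if \<open>a, b > 0\<close> and
  negative definite if \<open>a, b < 0\<close>; if \<open>a b < 0\<close>, the second form is
  negative definite. So an element represented by both is positive exactly when \<open>a\<close> and
  \<open>b\<close> are, and one such element serves all orderings at once. The obstacle is that the
  curve which yields it must have points over the p-adic closures too. The coefficient of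
  \<open>t^6\<close> has to be negative at orderings, to keep the second form definite, and a square
  at p-adic primes, to give points near infinity. The price is that \<open>D(t)\<close> is negative
  for large \<open>t\<close> at orderings. Real points must therefore come from bounded
  \<open>t\<close>, and to find them \<open>a\<close> and \<open>b\<close> are first replaced by
  elements of the same sign and large absolute value. The p-adic closures are only given as maximal
  extensions of their p-rank, so square roots in them are obtained not by completeness but by
  constructing a quadratic extension that keeps the p-rank.\<close>

locale val_ring =
  fixes L V :: "'a::field set"
  assumes subfield: "is_subfield L" and valuation_ring: "valuation_ring_on L V"
begin

lemma zero_V [simp, intro]: "0 \<in> V" and one_V [simp, intro]: "1 \<in> V"
  and add_V [intro]: "x \<in> V \<Longrightarrow> y \<in> V \<Longrightarrow> x + y \<in> V"
  and mult_V [intro]: "x \<in> V \<Longrightarrow> y \<in> V \<Longrightarrow> x * y \<in> V"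
  and uminus_V [intro]: "x \<in> V \<Longrightarrow> - x \<in> V"
  and V_subset: "V \<subseteq> L"
  using valuation_ring by (auto simp: valuation_ring_on_def is_subring_def)

lemma inverse_L: "x \<in> L \<Longrightarrow> inverse x \<in> L" and mult_L: "x \<in> L \<Longrightarrow> y \<in> L \<Longrightarrow> x * y \<in> L"
  using subfield by (auto simp: is_subfield_def)

lemma divide_L: "x \<in> L \<Longrightarrow> y \<in> L \<Longrightarrow> x / y \<in> L"
  by (simp add: divide_inverse inverse_L mult_L)

lemma diff_V [intro]: "x \<in> V \<Longrightarrow> y \<in> V \<Longrightarrow> x - y \<in> V"
  using add_V[of x "- y"] by auto

lemma power_V [intro]: "x \<in> V \<Longrightarrow> x ^ n \<in> V"
  by (induction n) auto

lemma of_nat_V [simp, intro]: "of_nat n \<in> V"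
  by (induction n) auto

lemma of_int_V [simp, intro]: "of_int n \<in> V"
  by (cases n rule: int_diff_cases) auto

lemma sum_V: "(\<And>i. i \<in> A \<Longrightarrow> g i \<in> V) \<Longrightarrow> sum g A \<in> V"
  by (induction A rule: infinite_finite_induct) auto

lemma prod_V: "(\<And>i. i \<in> A \<Longrightarrow> g i \<in> V) \<Longrightarrow> prod g A \<in> V"
  by (induction A rule: infinite_finite_induct) auto

lemma max_ideal_V: "x \<in> max_ideal V \<Longrightarrow> x \<in> V"
  by (simp add: max_ideal_def)

lemma zero_max [simp, intro]: "0 \<in> max_ideal V"
  by (simp add: max_ideal_def)

lemma one_max [simp]: "1 \<notin> max_ideal V"
  by (simp add: max_ideal_def)

lemma unit_iff: "x \<in> V - max_ideal V \<longleftrightarrow> x \<in> V \<and> x \<noteq> 0 \<and> inverse x \<in> V"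
  by (auto simp: max_ideal_def)

lemma V_or_inverse_max: "x \<in> L \<Longrightarrow> x \<in> V \<or> inverse x \<in> max_ideal V"
  using valuation_ring by (auto simp: valuation_ring_on_def max_ideal_def)

lemma mult_max [intro]: "x \<in> max_ideal V \<Longrightarrow> y \<in> V \<Longrightarrow> x * y \<in> max_ideal V"
proof -
  assume x: "x \<in> max_ideal V" and y: "y \<in> V"
  show ?thesis
  proof (rule ccontr)
    assume n: "x * y \<notin> max_ideal V"
    then have "x * y \<noteq> 0" "inverse (x * y) \<in> V" using x y by (auto simp: max_ideal_def)
    then have "y * inverse (x * y) \<in> V" "x \<noteq> 0" using y by auto
    then show False using x \<open>x * y \<noteq> 0\<close> by (auto simp: max_ideal_def field_simps)
  qed
qed

lemma mult_max2 [intro]: "y \<in> V \<Longrightarrow> x \<in> max_ideal V \<Longrightarrow> y * x \<in> max_ideal V"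
  using mult_max[of x y] by (simp add: mult.commute)

lemma V_divide_cases:
  assumes "x \<in> L" "y \<in> L"
  shows "x / y \<in> V \<or> y / x \<in> max_ideal V"
  using V_or_inverse_max[OF divide_L[OF assms]] by simp

lemma add_max [intro]:
  assumes x: "x \<in> max_ideal V" and y: "y \<in> max_ideal V"
  shows "x + y \<in> max_ideal V"
proof (cases "x = 0 \<or> y = 0")
  case False
  have "x \<in> L" "y \<in> L" using x y max_ideal_V V_subset by auto
  then consider "x / y \<in> V" | "y / x \<in> V" using V_divide_cases max_ideal_V by blast
  then show ?thesis
  proof cases
    case 1
    then have "y * (x / y + 1) \<in> max_ideal V" using y by auto
    then show ?thesis using False by (simp add: field_simps)
  next
    case 2
    then have "x * (y / x + 1) \<in> max_ideal V" using x by auto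
    then show ?thesis using False by (simp add: field_simps)
  qed
qed (use x y in auto)

lemma uminus_max [intro]: "x \<in> max_ideal V \<Longrightarrow> - x \<in> max_ideal V"
  using mult_max[of x "-1"] by auto

lemma diff_max [intro]: "x \<in> max_ideal V \<Longrightarrow> y \<in> max_ideal V \<Longrightarrow> x - y \<in> max_ideal V"
  using add_max[of x "- y"] by auto

lemma max_commute: "x - y \<in> max_ideal V \<longleftrightarrow> y - x \<in> max_ideal V"
  using uminus_max[of "x - y"] uminus_max[of "y - x"] by auto

lemma max_trans: "x - y \<in> max_ideal V \<Longrightarrow> y - z \<in> max_ideal V \<Longrightarrow> x - z \<in> max_ideal V"
  using add_max[of "x - y" "y - z"] by auto

lemma max_prime: "x * y \<in> max_ideal V \<Longrightarrow> x \<in> V \<Longrightarrow> y \<in> V \<Longrightarrow> x \<in> max_ideal V \<or> y \<in> max_ideal V"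
  by (auto simp: max_ideal_def)

lemma mult_cong_max:
  assumes "x - x' \<in> max_ideal V" "y - y' \<in> max_ideal V" "x' \<in> V" "y \<in> V"
  shows "x * y - x' * y' \<in> max_ideal V"
proof -
  have "(x - x') * y + x' * (y - y') \<in> max_ideal V" using assms by auto
  then show ?thesis by (simp add: algebra_simps)
qed

lemma power_cong_max:
  assumes "x - y \<in> max_ideal V" "x \<in> V" "y \<in> V"
  shows "x ^ n - y ^ n \<in> max_ideal V"
proof (induction n)
  case (Suc n)
  then show ?case using mult_cong_max[of x y "x ^ n" "y ^ n"] assms by auto
qed auto

lemma prod_cong_max:
  assumes "\<And>i. i \<in> A \<Longrightarrow> g i - h i \<in> max_ideal V" "\<And>i. i \<in> A \<Longrightarrow> g i \<in> V" "\<And>i. i \<in> A \<Longrightarrow> h i \<in> V"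
  shows "prod g A - prod h A \<in> max_ideal V"
  using assms
proof (induction A rule: infinite_finite_induct)
  case (insert a A)
  then show ?case using mult_cong_max[of "g a" "h a" "prod g A" "prod h A"] prod_V[of A g] by auto
qed auto

lemma not_ordering: "\<not> ordering_on L V"
  using one_V uminus_V[OF one_V] by (auto simp: ordering_on_def)

section \<open>Residue characteristic and roots modulo the maximal ideal\<close>

lemma residue_char_unique:
  assumes "Factorial_Ring.prime p" "of_nat p \<in> max_ideal V" "Factorial_Ring.prime p'" "of_nat p' \<in> max_ideal V"
  shows "p = (p'::nat)"
proof (rule ccontr)
  assume "p \<noteq> p'"
  then have "coprime (int p) (int p')" using assms by (simp add: primes_coprime)
  then obtain a b where "a * int p + b * int p' = 1"
    using bezout_int[of "int p" "int p'"] by auto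
  then have "of_int a * of_nat p + of_int b * of_nat p' = (1::'a)"
    by (metis of_int_add of_int_mult of_int_of_nat_eq of_int_1)
  moreover have "of_int a * of_nat p + of_int b * of_nat p' \<in> max_ideal V" using assms by blast
  ultimately show False by simp
qed

lemma residue_char_eqI:
  "Factorial_Ring.prime p \<Longrightarrow> of_nat p \<in> max_ideal V \<Longrightarrow> residue_char V = p"
  unfolding residue_char_def by (rule the_equality) (auto intro: residue_char_unique)

text \<open>Each root splits off a linear factor with coefficients in \<open>V\<close>.\<close>

lemma card_roots_max_le:
  assumes "finite T" "T \<subseteq> V" "\<And>x y. x \<in> T \<Longrightarrow> y \<in> T \<Longrightarrow> x - y \<in> max_ideal V \<Longrightarrow> x = y"
    and "\<And>i. Polynomial.coeff p i \<in> V" "Polynomial.lead_coeff p = 1" "\<And>x. x \<in> T \<Longrightarrow> poly p x \<in> max_ideal V"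
  shows "card T \<le> Polynomial.degree p"
  using assms
proof (induction "Polynomial.degree p" arbitrary: p T)
  case 0
  then have "p = 1" by (metis degree_0_id of_nat_1 one_pCons)
  then have "T = {}" using 0 by fastforce
  then show ?case by simp
next
  case (Suc n)
  show ?case
  proof (cases "T = {}")
    case False
    then obtain r where r: "r \<in> T" by blast
    define s where "s = synthetic_div p r"
    have eq: "p + Polynomial.smult r s = pCons (poly p r) s"
      unfolding s_def by (rule synthetic_div_correct)
    have deg: "Polynomial.degree s = n" using Suc(2) by (simp add: s_def degree_synthetic_div)
    have rec: "Polynomial.coeff p (Suc i) + r * Polynomial.coeff s (Suc i) = Polynomial.coeff s i" for i
      using arg_cong[OF eq, of "\<lambda>p. Polynomial.coeff p (Suc i)"] by simp
    have coeffs: "Polynomial.coeff s i \<in> V" for i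
    \<comment> \<open>Downward induction on \<open>i\<close>: \<open>rec\<close> expresses each
      coefficient by the next one, and those above the degree \<open>n\<close> vanish.\<close>
    proof (induction "n - i" arbitrary: i rule: less_induct)
      case less
      show ?case
      proof (cases "i \<le> n")
        case True
        have "Polynomial.coeff s (Suc i) \<in> V"
          using less[of "Suc i"] True by (cases "i = n") (auto simp: coeff_eq_0 deg)
        then show ?thesis using rec[of i] Suc.prems(4)[of "Suc i"] r Suc.prems(2) by (metis add_V mult_V subsetD)
      qed (simp add: coeff_eq_0 deg)
    qed
    have lead: "Polynomial.lead_coeff s = 1"
      using rec[of n] Suc.prems(5) Suc(2) by (simp add: deg coeff_eq_0)
    \<comment> \<open>\<open>r\<close> is a root only modulo the maximal ideal, but (x - r) s(x) =
      p(x) - p(r) holds exactly, and \<open>x - r\<close> is a unit.\<close>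
    have root: "poly s x \<in> max_ideal V" if x: "x \<in> T - {r}" for x
    proof -
      have "poly p x + r * poly s x = poly p r + x * poly s x"
        using arg_cong[OF eq, of "\<lambda>p. poly p x"] by simp
      then have "(x - r) * poly s x = poly p x - poly p r" by (simp add: algebra_simps)
      then have "(x - r) * poly s x \<in> max_ideal V" using Suc.prems(6) x r by (metis DiffD1 diff_max)
      moreover have "poly s x \<in> V"
        unfolding poly_altdef using x Suc.prems(2) coeffs by (intro sum_V) auto
      moreover have "x - r \<notin> max_ideal V" "x - r \<in> V" using x r Suc.prems(2,3) by auto
      ultimately show ?thesis using max_prime by blast
    qed
    have "card (T - {r}) \<le> Polynomial.degree s"
      by (rule Suc(1)) (use Suc.prems deg coeffs lead root in auto)
    then show ?thesis using deg Suc(2) r Suc.prems(1) by (simp add: card_Diff_singleton)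
  qed simp
qed

end

section \<open>Finite residue fields\<close>

definition residue_system :: "'a::field set \<Rightarrow> 'a set \<Rightarrow> bool" where
  "residue_system V T \<longleftrightarrow> finite T \<and> T \<subseteq> V \<and>
     (\<forall>x\<in>T. \<forall>y\<in>T. x - y \<in> max_ideal V \<longrightarrow> x = y) \<and> (\<forall>x\<in>V. \<exists>y\<in>T. x - y \<in> max_ideal V)"

context val_ring
begin

text \<open>Representatives take the place of the residue field as a quotient ring. A pairwise
  incongruent set of greatest size meets every class, since otherwise it could be enlarged.\<close>

lemma residue_system_exists:
  assumes bound: "\<And>T. finite T \<Longrightarrow> T \<subseteq> V \<Longrightarrow> \<forall>x\<in>T. \<forall>y\<in>T. x - y \<in> max_ideal V \<longrightarrow> x = y \<Longrightarrow> card T \<le> N"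
  obtains T where "residue_system V T"
proof -
  define Q where "Q T \<longleftrightarrow> finite T \<and> T \<subseteq> V \<and> (\<forall>x\<in>T. \<forall>y\<in>T. x - y \<in> max_ideal V \<longrightarrow> x = y)" for T
  have "Q {}" by (simp add: Q_def)
  moreover have "\<forall>T. Q T \<longrightarrow> card T \<le> N" using bound by (auto simp: Q_def)
  ultimately obtain T where T: "Q T" "\<And>T'. Q T' \<Longrightarrow> card T' \<le> card T"
    using ex_has_greatest_nat[of Q "{}" card "Suc N"] by (metis le_imp_less_Suc)
  have "\<exists>y\<in>T. x - y \<in> max_ideal V" if x: "x \<in> V" for x
  proof (rule ccontr)
    assume n: "\<not> ?thesis"
    then have "x \<notin> T" by auto
    moreover have "Q (insert x T)" using T(1) x n max_commute by (auto simp: Q_def)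
    then have "card (insert x T) \<le> card T" using T(2) by blast
    ultimately show False using T(1) by (simp add: Q_def)
  qed
  then show ?thesis using that[of T] T(1) by (simp add: residue_system_def Q_def)
qed

text \<open>Multiplication by a unit permutes the nonzero residue classes.\<close>

lemma power_card_residue_system:
  assumes T: "residue_system V T" and x: "x \<in> V"
  shows "x ^ card T - x \<in> max_ideal V"
proof (cases "x \<in> max_ideal V")
  case True
  have "card T > 0" using T by (auto simp: residue_system_def card_gt_0_iff)
  then have "x ^ card T \<in> max_ideal V"
    using True x by (cases "card T") auto
  then show ?thesis using True by auto
next
  case False
  define T' where "T' = {t \<in> T. t \<notin> max_ideal V}"
  define g where "g t = (SOME s. s \<in> T \<and> x * t - s \<in> max_ideal V)" for t
  have T'V: "T' \<subseteq> V" and T'T: "T' \<subseteq> T" and fin: "finite T'"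
    using T by (auto simp: T'_def residue_system_def)
  have g: "g t \<in> T \<and> x * t - g t \<in> max_ideal V" if "t \<in> T'" for t
    unfolding g_def by (rule someI_ex) (use that T mult_V[OF x, of t] T'V in \<open>auto simp: residue_system_def subset_iff Bex_def\<close>)
  have gT': "g t \<in> T'" if "t \<in> T'" for t
  proof -
    have "x * t \<notin> max_ideal V" using False that max_prime[of x t] x T'V by (auto simp: T'_def)
    then show ?thesis using g[OF that] add_max[of "x * t - g t" "g t"] by (auto simp: T'_def)
  qed
  have inj: "inj_on g T'"
  proof
    fix s t assume st: "s \<in> T'" "t \<in> T'" "g s = g t"
    have "x * s - x * t \<in> max_ideal V"
      using g[OF st(1)] g[OF st(2)] st(3) max_trans max_commute by metis
    then have "x * (s - t) \<in> max_ideal V" by (simp add: algebra_simps)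
    then have "s - t \<in> max_ideal V" using False max_prime[of x "s - t"] x st T'V by blast
    then show "s = t" using st T'T T unfolding residue_system_def by (meson subsetD)
  qed
  have img: "g ` T' = T'" using inj gT' fin by (intro card_subset_eq) (auto simp: card_image)
  have "(\<Prod>t\<in>T'. x * t) - (\<Prod>t\<in>T'. g t) \<in> max_ideal V"
    using g gT' T'V x by (intro prod_cong_max) auto
  also have "(\<Prod>t\<in>T'. g t) = \<Prod>T'" using prod.reindex[OF inj, of "\<lambda>t. t"] img by simp
  also have "(\<Prod>t\<in>T'. x * t) - \<Prod>T' = (x ^ card T' - 1) * \<Prod>T'"
    by (simp add: prod.distrib algebra_simps)
  finally have "(x ^ card T' - 1) * \<Prod>T' \<in> max_ideal V" .
  moreover have nm: "\<Prod>S \<notin> max_ideal V \<and> \<Prod>S \<in> V" if "S \<subseteq> T'" for S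
    using finite_subset[OF that fin] that
  proof (induction S rule: finite_induct)
    case (insert s S)
    then show ?case using max_prime[of s "\<Prod>S"] T'V by (auto simp: T'_def)
  qed auto
  ultimately have *: "x ^ card T' - 1 \<in> max_ideal V"
    using max_prime[of "x ^ card T' - 1" "\<Prod>T'"] x by auto
  \<comment> \<open>Exactly one representative lies in the zero class, so the exponent
    \<open>card T'\<close> valid for units is \<open>card T - 1\<close>.\<close>
  obtain z where z: "z \<in> T" "z \<in> max_ideal V"
  proof -
    obtain z where "z \<in> T" "0 - z \<in> max_ideal V" using T zero_V unfolding residue_system_def by blast
    then show ?thesis using that uminus_max[of "0 - z"] by auto
  qed
  have "T = insert z T'" using z T by (auto simp: T'_def residue_system_def)
  moreover have "z \<notin> T'" using z by (auto simp: T'_def)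
  ultimately have "card T = Suc (card T')" using fin by simp
  then have "x ^ card T - x = x * (x ^ card T' - 1)" by (simp add: algebra_simps)
  then show ?thesis using * x by auto
qed

text \<open>The subtractive Euclidean algorithm on the iterates of x -> x^p: raising x^(p^b) = x to
  the power p^(a-b) gives x^(p^a) = x^(p^(a-b)) modulo the maximal ideal, so x is also fixed by the
  iterate a - b.\<close>

lemma power_power_gcd:
  assumes "x ^ (p ^ a) - x \<in> max_ideal V" "x ^ (p ^ b) - x \<in> max_ideal V" "x \<in> V"
  shows "x ^ (p ^ gcd a b) - x \<in> max_ideal V"
  using assms
proof (induction "a + b" arbitrary: a b rule: less_induct)
  case less
  have step: "x ^ (p ^ gcd a b) - x \<in> max_ideal V"
    if ab: "b \<le> a" "b > 0" "x ^ (p ^ a) - x \<in> max_ideal V" "x ^ (p ^ b) - x \<in> max_ideal V"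
      and IH: "\<And>c. c < a \<Longrightarrow> x ^ (p ^ c) - x \<in> max_ideal V \<Longrightarrow> x ^ (p ^ gcd c b) - x \<in> max_ideal V" for a b
  proof -
    have "(x ^ (p ^ b)) ^ (p ^ (a - b)) - x ^ (p ^ (a - b)) \<in> max_ideal V"
      using ab(4) less.prems(3) by (intro power_cong_max) auto
    moreover have "(x ^ (p ^ b)) ^ (p ^ (a - b)) = x ^ (p ^ a)"
      using ab(1) by (simp flip: power_mult power_add)
    ultimately have "x ^ (p ^ (a - b)) - x \<in> max_ideal V"
      using ab(3) max_commute max_trans by metis
    then have "x ^ (p ^ gcd (a - b) b) - x \<in> max_ideal V" using IH ab by simp
    then show ?thesis using ab(1) by (simp add: gcd_diff1_nat)
  qed
  consider "a = 0" | "b = 0" | "a > 0" "b > 0" "b \<le> a" | "a > 0" "b > 0" "a \<le> b" by linarith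
  then show ?case
  proof cases
    case 3
    show ?thesis by (rule step) (use 3 less in auto)
  next
    case 4
    have "x ^ (p ^ gcd b a) - x \<in> max_ideal V" by (rule step) (use 4 less in \<open>auto simp: gcd.commute\<close>)
    then show ?thesis by (simp add: gcd.commute)
  qed (use less in auto)
qed

lemma power_power_mult:
  assumes "x ^ (p ^ a) - x \<in> max_ideal V" "x \<in> V"
  shows "x ^ (p ^ (a * k)) - x \<in> max_ideal V"
proof (induction k)
  case (Suc k)
  have "(x ^ (p ^ (a * k))) ^ (p ^ a) - x ^ (p ^ a) \<in> max_ideal V"
    using Suc assms(2) by (intro power_cong_max) auto
  moreover have "(x ^ (p ^ (a * k))) ^ (p ^ a) = x ^ (p ^ (a * Suc k))"
    by (simp add: power_add mult.commute flip: power_mult)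
  ultimately show ?case using assms max_trans by metis
qed auto

text \<open>All elements of \<open>T\<close> are roots of X^(p^g) - X modulo the maximal ideal,
  where g = gcd a b. Counting roots gives p^a <= p^g, hence g = a. As \<open>T\<close> may miss
  residue classes, this covers subfields of the residue field as well as the whole.\<close>

lemma degree_dvd_of_powers:
  assumes p: "p > (1::nat)" and T: "finite T" "T \<subseteq> V" "\<forall>x\<in>T. \<forall>y\<in>T. x - y \<in> max_ideal V \<longrightarrow> x = y"
    and card: "card T = p ^ a" and a: "a > 0"
    and pow: "\<And>x. x \<in> T \<Longrightarrow> x ^ (p ^ a) - x \<in> max_ideal V" "\<And>x. x \<in> T \<Longrightarrow> x ^ (p ^ b) - x \<in> max_ideal V"
  shows "a dvd b"
proof -
  define g where "g = gcd a b"
  have g: "g > 0" using a by (simp add: g_def)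
  have gt: "p ^ g > 1" using one_less_power[OF p g] .
  define P where "P = (Polynomial.monom 1 (p ^ g) - Polynomial.monom 1 1 :: 'a poly)"
  have deg: "Polynomial.degree P = p ^ g" and lead: "Polynomial.lead_coeff P = 1"
  proof -
    have "Polynomial.coeff P (p ^ g) = 1" using gt by (simp add: P_def)
    moreover have "Polynomial.degree P \<le> p ^ g"
      unfolding P_def by (rule degree_diff_le) (use gt in \<open>auto simp: degree_monom_eq\<close>)
    ultimately show "Polynomial.degree P = p ^ g" by (simp add: le_antisym le_degree)
    with \<open>Polynomial.coeff P (p ^ g) = 1\<close> show "Polynomial.lead_coeff P = 1" by simp
  qed
  have "card T \<le> Polynomial.degree P"
  proof (rule card_roots_max_le)
    show "Polynomial.coeff P i \<in> V" for i by (simp add: P_def coeff_diff)  blast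
    show "poly P x \<in> max_ideal V" if "x \<in> T" for x
      using power_power_gcd[OF pow(1)[OF that] pow(2)[OF that]] that T(2) by (auto simp: P_def poly_monom g_def)
  qed (use T lead in auto)
  then have "a \<le> g" using card deg p by (simp add: power_increasing_iff)
  then have "g = a" using a by (simp add: g_def dvd_imp_le le_antisym)
  then show ?thesis by (metis g_def gcd_dvd2)
qed

end

section \<open>Uniformizers, ramification index and residue degree\<close>

lemma (in val_ring) power_max: "x \<in> max_ideal V \<Longrightarrow> n > 0 \<Longrightarrow> x ^ n \<in> max_ideal V"
  using mult_max[of x "x ^ (n - 1)"] power_V[OF max_ideal_V] by (cases n) auto

lemma (in val_ring) multiples_subset_max:
  "of_nat p \<in> max_ideal V \<Longrightarrow> multiples p V \<subseteq> max_ideal V"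
  by (auto simp: multiples_def)

lemma (in val_ring) multiples_add: "x \<in> multiples p V \<Longrightarrow> y \<in> multiples p V \<Longrightarrow> x + y \<in> multiples p V"
  unfolding multiples_def by (auto simp flip: distrib_left)

lemma (in val_ring) multiples_mult: "x \<in> multiples p V \<Longrightarrow> y \<in> V \<Longrightarrow> x * y \<in> multiples p V"
  unfolding multiples_def by (auto simp: mult.assoc)

lemma (in val_ring) multiples_sum: "(\<And>i. i \<in> A \<Longrightarrow> g i \<in> multiples p V) \<Longrightarrow> sum g A \<in> multiples p V"
proof (induction A rule: infinite_finite_induct)
  case empty
  show ?case by (auto simp: multiples_def intro!: image_eqI[of _ _ 0])
next
  case (infinite A)
  show ?case using infinite(1) by (auto simp: multiples_def intro!: image_eqI[of _ _ 0])
qed (auto intro: multiples_add)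

definition combos :: "nat \<Rightarrow> 'a::field set \<Rightarrow> 'a set" where
  "combos p B = (\<lambda>c. \<Sum>b\<in>B. of_int (c b) * b) ` (B \<rightarrow>\<^sub>E {0..<int p})"

lemma finite_combos: "finite B \<Longrightarrow> finite (combos p B)"
  by (auto simp: combos_def intro!: finite_imageI finite_PiE)

lemma (in val_ring) combos_V: "B \<subseteq> V \<Longrightarrow> combos p B \<subseteq> V"
  by (auto simp: combos_def intro!: sum_V)

text \<open>Reducing every integer coefficient modulo \<open>p\<close> changes the sum by a multiple
  of \<open>p\<close>, which \<open>I\<close> absorbs. So a finite spanning set yields finitely many
  representatives.\<close>

lemma (in val_ring) combos_represent:
  assumes B: "spans_mod V I B" and I: "\<And>x y. x \<in> I \<Longrightarrow> y \<in> multiples p V \<Longrightarrow> x + y \<in> I"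
    and p: "p > 0" and x: "x \<in> V"
  shows "\<exists>y\<in>combos p B. x - y \<in> I"
proof -
  obtain c where c: "x - (\<Sum>b\<in>B. of_int (c b) * b) \<in> I" using B x by (auto simp: spans_mod_def)
  define c' where "c' = restrict (\<lambda>b. c b mod int p) B"
  have "c' \<in> B \<rightarrow>\<^sub>E {0..<int p}" using p by (auto simp: c'_def)
  then have "(\<Sum>b\<in>B. of_int (c' b) * b) \<in> combos p B" by (auto simp: combos_def)
  moreover have "x - (\<Sum>b\<in>B. of_int (c' b) * b) \<in> I"
  proof -
    have "(\<Sum>b\<in>B. of_int (c b) * b - of_int (c' b) * b) \<in> multiples p V"
    proof (rule multiples_sum)
      fix b assume b: "b \<in> B"
      have "of_int (c b) = (of_nat p * of_int (c b div int p) + of_int (c b mod int p) :: 'a)"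
        by (metis mult_div_mod_eq of_int_add of_int_mult of_int_of_nat_eq)
      then have "of_int (c b) * b - of_int (c' b) * b = of_nat p * (of_int (c b div int p) * b)"
        using b by (simp add: c'_def algebra_simps)
      moreover have "of_int (c b div int p) * b \<in> V" using B b by (auto simp: spans_mod_def)
      ultimately show "of_int (c b) * b - of_int (c' b) * b \<in> multiples p V"
        by (auto simp: multiples_def)
    qed
    from I[OF c this] show ?thesis by (simp add: sum_subtractf)
  qed
  ultimately show ?thesis by blast
qed

text \<open>Modulo \<open>p\<close> there are only finitely many classes, so two of the powers 1, x,
  x^2, ... agree. Then x^i (1 - x^(j-i)) is divisible by \<open>p\<close>, and the second factor is
  a unit. The number of representatives serves as an exponent for all \<open>x\<close>.\<close>

lemma (in val_ring) power_dvd_of_fp_finite_dim: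
  assumes p: "Factorial_Ring.prime p" "of_nat p \<in> max_ideal V" and fin: "fp_finite_dim V (multiples p V)"
  obtains E where "\<And>x. x \<in> max_ideal V \<Longrightarrow> x ^ E \<in> multiples p V"
proof -
  obtain B where B: "spans_mod V (multiples p V) B" using fin by (auto simp: fp_finite_dim_def)
  define T where "T = combos p B"
  have finT: "finite T" using B by (auto simp: T_def spans_mod_def intro: finite_combos)
  have TV: "T \<subseteq> V" using B by (auto simp: T_def spans_mod_def intro!: combos_V)
  have rep: "\<exists>y\<in>T. x - y \<in> multiples p V" if "x \<in> V" for x
    unfolding T_def by (rule combos_represent[OF B _ _ that]) (auto intro: multiples_add simp: p prime_gt_0_nat)
  have "x ^ card T \<in> multiples p V" if x: "x \<in> max_ideal V" for x
  proof -
    have "\<forall>i. \<exists>y\<in>T. x ^ i - y \<in> multiples p V" using rep max_ideal_V[OF x] by blast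
    then obtain g where g: "g i \<in> T" "x ^ i - g i \<in> multiples p V" for i by metis
    have "\<exists>i j. j \<le> card T \<and> i < j \<and> g i = g j"
    proof (rule ccontr)
      assume n: "\<not> ?thesis"
      have "inj_on g {..card T}" by (rule linorder_inj_onI) (use n in auto)
      then have "card {..card T} \<le> card T" using g finT by (intro card_inj_on_le) auto
      then show False by simp
    qed
    then obtain i j where ij: "i \<le> card T" "j \<le> card T" "i < j" "g i = g j" by auto
    have "x ^ i - x ^ j = (x ^ i - g i) + (x ^ j - g j) * (-1)" using ij(4) by simp
    also have "\<dots> \<in> multiples p V" using g by (intro multiples_add multiples_mult uminus_V) auto
    finally have dd: "x ^ i * (1 - x ^ (j - i)) \<in> multiples p V"
      using ij by (simp add: algebra_simps flip: power_add)
    have u: "1 - x ^ (j - i) \<in> V - max_ideal V"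
    proof -
      have "x ^ (j - i) \<in> max_ideal V" using x ij(3) max_ideal_V by (cases "j - i") auto
      then have "1 - x ^ (j - i) \<notin> max_ideal V" using add_max[of "1 - x ^ (j - i)" "x ^ (j - i)"] by auto
      then show ?thesis using max_ideal_V[OF x] by auto
    qed
    have "inverse (1 - x ^ (j - i)) * x ^ (card T - i) \<in> V"
      using max_ideal_V[OF x] u unfolding unit_iff by auto
    then have *: "x ^ i * (1 - x ^ (j - i)) * (inverse (1 - x ^ (j - i)) * x ^ (card T - i)) \<in> multiples p V"
      by (rule multiples_mult[OF dd])
    have cancel: "a * w * (inverse w * b) = a * b" if "w \<noteq> 0" for a b w :: 'a using that by simp
    have nz: "1 - x ^ (j - i) \<noteq> 0" using u unfolding unit_iff by blast
    from * have "x ^ i * x ^ (card T - i) \<in> multiples p V" unfolding cancel[OF nz] .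
    then show ?thesis using ij(1) by (simp flip: power_add)
  qed
  then show ?thesis by (rule that)
qed

text \<open>\<open>Q k\<close> says that the k-th power of a nonunit divides \<open>c\<close>. For k
  > E the relations x^E = c y and c = x^k z would make x a unit. Take the greatest \<open>k\<close>,
  with nonunit \<open>x\<close>. If a nonunit \<open>y\<close> is not a multiple of
  \<open>x\<close>, then x = y (x/y) is a product of two nonunits, hence divisible by w^2 for the
  one of smaller value. Then w^(2k) divides \<open>c\<close>, contradicting the choice of
  \<open>k\<close>.\<close>

lemma (in val_ring) uniformizer_exists:
  assumes c: "c \<in> max_ideal V" "c \<noteq> 0" and E: "\<And>x. x \<in> max_ideal V \<Longrightarrow> \<exists>y\<in>V. x ^ E = c * y"
  obtains t where "uniformizer V t"
proof -
  define Q where "Q k \<longleftrightarrow> (\<exists>x\<in>max_ideal V. \<exists>z\<in>V. c = x ^ k * z)" for k :: nat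
  have QE: "k \<le> E" if "Q k" for k
  proof (rule ccontr)
    assume "\<not> k \<le> E"
    from that obtain x z where x: "x \<in> max_ideal V" "z \<in> V" "c = x ^ k * z"
      unfolding Q_def by (elim bexE)
    from E[OF x(1)] obtain y where y: "y \<in> V" "x ^ E = c * y" by (elim bexE)
    have "x \<noteq> 0"
    proof
      assume "x = 0"
      moreover have "k \<noteq> 0" using \<open>\<not> k \<le> E\<close> by simp
      ultimately have "c = 0" unfolding x(3) by simp
      then show False using c(2) by simp
    qed
    have "x ^ E * x ^ (k - E) = x ^ k" using \<open>\<not> k \<le> E\<close> unfolding power_add[symmetric] by simp
    then have "x ^ E * (x ^ (k - E) * z * y) = x ^ k * z * y" by (simp only: mult.assoc[symmetric])
    also have "\<dots> = x ^ E * 1" unfolding y(2) x(3) by simp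
    finally have "x ^ E * (x ^ (k - E) * z * y) = x ^ E * 1" .
    then have "x ^ (k - E) * z * y = 1" using \<open>x \<noteq> 0\<close> unfolding mult_cancel_left by simp
    moreover have "x ^ (k - E) * z * y \<in> max_ideal V"
      by (rule mult_max[OF mult_max[OF power_max[OF x(1)] x(2)] y(1)]) (use \<open>\<not> k \<le> E\<close> in simp)
    ultimately show False by simp
  qed
  have "c = c ^ 1 * 1" by simp
  then have Q1: "Q 1" unfolding Q_def using c(1) one_V by blast
  define k where "k = Greatest Q"
  have k: "Q k" unfolding k_def by (rule GreatestI_nat[where P = Q, OF Q1 QE])
  have kmax: "l \<le> k" if "Q l" for l unfolding k_def by (rule Greatest_le_nat[where P = Q, OF that QE])
  have k1: "k \<ge> 1" by (rule kmax[OF Q1])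
  obtain x z where x: "x \<in> max_ideal V" "z \<in> V" "c = x ^ k * z"
    using k unfolding Q_def by (elim bexE)
  have "x \<noteq> 0"
  proof
    assume "x = 0"
    then have "c = 0" unfolding x(3) using k1 by simp
    then show False using c(2) by simp
  qed
  have "\<exists>w\<in>V. y = x * w" if y: "y \<in> max_ideal V" for y
  proof (cases "y / x \<in> V")
    case True
    then show ?thesis using \<open>x \<noteq> 0\<close> by (intro bexI[of _ "y / x"]) auto
  next
    case False
    have L: "y \<in> L" "x \<in> L" using max_ideal_V[OF y] max_ideal_V[OF x(1)] V_subset by auto
    then have m: "x / y \<in> max_ideal V" using False V_divide_cases[of y x] by blast
    have "y \<noteq> 0" using False by auto
    have "\<exists>w\<in>max_ideal V. \<exists>s\<in>V. x = w ^ 2 * s"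
    proof (cases "y / (x / y) \<in> V")
      case True
      then show ?thesis using m \<open>y \<noteq> 0\<close> \<open>x \<noteq> 0\<close>
        by (intro bexI[of _ "x / y"] bexI[of _ "y / (x / y)"]) (auto simp: power2_eq_square)
    next
      case F: False
      have "x / y \<in> L" by (rule divide_L[OF L(2,1)])
      then have "(x / y) / y \<in> V" using F V_divide_cases[OF L(1), of "x / y"] max_ideal_V by blast
      then show ?thesis using y \<open>y \<noteq> 0\<close> \<open>x \<noteq> 0\<close>
        by (intro bexI[of _ y] bexI[of _ "(x / y) / y"]) (auto simp: power2_eq_square)
    qed
    then obtain w s where w: "w \<in> max_ideal V" "s \<in> V" "x = w ^ 2 * s" by blast
    have "c = (w ^ 2) ^ k * s ^ k * z" unfolding x(3) unfolding w(3) power_mult_distrib ..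
    also have "(w ^ 2) ^ k = w ^ (k + 1) * w ^ (k - 1)"
    proof -
      have "2 * k = (k + 1) + (k - 1)" using k1 by arith
      then show ?thesis by (metis power_add power_mult)
    qed
    finally have "c = w ^ (k + 1) * (w ^ (k - 1) * s ^ k * z)" by (simp only: mult.assoc)
    moreover have "w ^ (k - 1) * s ^ k * z \<in> V"
      by (intro mult_V power_V w(2) x(2) max_ideal_V[OF w(1)])
    ultimately have "Q (k + 1)" unfolding Q_def using w(1) by blast
    from kmax[OF this] show ?thesis by simp
  qed
  then have "uniformizer V x" using x(1) unfolding uniformizer_def by blast
  then show ?thesis by (rule that)
qed

text \<open>Restricted to divisors of powers of \<open>t\<close>: the value group may be larger than
  the integers, and then some nonzero nonunits are divisible by every power of
  \<open>t\<close>.\<close>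

lemma (in val_ring) uniformizer_power_unit:
  assumes t: "uniformizer V t" "t \<noteq> 0" and x: "x \<in> V" "y \<in> V" "t ^ n = x * y"
  shows "\<exists>k u. u \<in> V - max_ideal V \<and> x = t ^ k * u"
  using x
proof (induction n arbitrary: x)
  case 0
  then have "x \<in> V - max_ideal V" using mult_max[of x y] by auto
  then show ?case by (intro exI[of _ 0] exI[of _ x]) auto
next
  case (Suc n)
  show ?case
  proof (cases "x \<in> max_ideal V")
    case True
    then obtain w where w: "w \<in> V" "x = t * w" using t by (auto simp: uniformizer_def)
    then have "t ^ n = w * y" using Suc.prems t by simp
    then obtain k u where "u \<in> V - max_ideal V" "w = t ^ k * u" using Suc.IH w Suc.prems by blast
    then show ?thesis using w by (intro exI[of _ "Suc k"] exI[of _ u]) auto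
  next
    case False
    then show ?thesis using Suc.prems by (intro exI[of _ 0] exI[of _ x]) auto
  qed
qed

lemma (in val_ring) unit_mult: "u \<in> V - max_ideal V \<Longrightarrow> w \<in> V - max_ideal V \<Longrightarrow> u * w \<in> V - max_ideal V"
  unfolding unit_iff by auto

lemma (in val_ring) unit_power: "u \<in> V - max_ideal V \<Longrightarrow> u ^ n \<in> V - max_ideal V"
  unfolding unit_iff by (auto simp flip: power_inverse)

lemma (in val_ring) uniformizer_power_eq:
  assumes t: "uniformizer V t" "t \<noteq> 0" and u: "u \<in> V - max_ideal V" "u' \<in> V - max_ideal V"
    and eq: "t ^ k * u = t ^ l * u'"
  shows "k = l"
proof -
  have le: False if "k < l" "u \<in> V - max_ideal V" "u' \<in> V - max_ideal V" "t ^ k * u = t ^ l * u'" for k l u u'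
  proof -
    have "t ^ k * u = t ^ k * (t ^ (l - k) * u')" using that by (simp add: mult.assoc flip: power_add)
    then have "u = t ^ (l - k) * u'" using t by simp
    also have "\<dots> \<in> max_ideal V" using that t max_ideal_V by (cases "l - k") (auto simp: uniformizer_def)
    finally show False using that by simp
  qed
  show ?thesis using le[of k l u u'] le[of l k u' u] u eq by (metis linorder_neqE_nat)
qed

text \<open>Any two uniformizers divide each other, so they differ by a unit and the definite
  description does not depend on the choice.\<close>

lemma (in val_ring) ram_index_eqI:
  assumes p: "residue_char V = p" and t: "uniformizer V t" "t \<noteq> 0"
    and e: "of_nat p = t ^ e * u" "u \<in> V - max_ideal V"
  shows "ram_index L V = e"
proof -
  have "(THE e. \<exists>t. uniformizer V t \<and> of_nat (residue_char V) / t ^ e \<in> V - max_ideal V) = e"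
  proof (rule the_equality)
    show "\<exists>t. uniformizer V t \<and> of_nat (residue_char V) / t ^ e \<in> V - max_ideal V"
      using t e p by (intro exI[of _ t]) auto
  next
    fix e' assume "\<exists>t'. uniformizer V t' \<and> of_nat (residue_char V) / t' ^ e' \<in> V - max_ideal V"
    then obtain t' where t': "uniformizer V t'" "of_nat p / t' ^ e' \<in> V - max_ideal V" using p by auto
    have p0: "of_nat p \<noteq> (0::'a)" using e t unfolding unit_iff by auto
    obtain a where a: "a \<in> V" "t' = t * a" using t t' by (auto simp: uniformizer_def)
    obtain b where b: "b \<in> V" "t = t' * b" using t t' by (auto simp: uniformizer_def)
    have "a * b = 1" using a b t by (metis mult.assoc mult_cancel_left1)
    then have au: "a \<in> V - max_ideal V" using a b mult_max[of a b] by auto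
    have "t' \<noteq> 0" using b t by auto
    then have "of_nat p = t ^ e' * (a ^ e' * (of_nat p / t' ^ e'))"
      using a by (simp add: power_mult_distrib)
    then have "t ^ e' * (a ^ e' * (of_nat p / t' ^ e')) = t ^ e * u" using e by simp
    then show "e' = e"
      using uniformizer_power_eq[OF t] unit_mult[OF unit_power[OF au] t'(2)] e(2) by blast
  qed
  then show ?thesis using not_ordering by (simp add: ram_index_def)
qed

text \<open>The combinations of a spanning set of least size are pairwise incongruent: if two
  congruent ones differ in the coefficient of \<open>b\<close>, that difference is invertible modulo
  \<open>p\<close>, which expresses \<open>b\<close> by the other generators, and \<open>b\<close>
  could be dropped.\<close>

lemma (in val_ring) residue_system_fp_dim:
  assumes p: "Factorial_Ring.prime p" "of_nat p \<in> max_ideal V" and fin: "fp_finite_dim V (max_ideal V)"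
  obtains T where "residue_system V T" "card T = p ^ fp_dim V (max_ideal V)"
proof -
  have "\<exists>d. \<exists>B. spans_mod V (max_ideal V) B \<and> card B = d" using fin by (auto simp: fp_finite_dim_def)
  from LeastI_ex[OF this] obtain B where B: "spans_mod V (max_ideal V) B"
    and card: "card B = fp_dim V (max_ideal V)" unfolding fp_dim_def by blast
  have least: "card B \<le> card B'" if "spans_mod V (max_ideal V) B'" for B'
    unfolding card fp_dim_def by (rule Least_le) (use that in blast)
  have finB: "finite B" and BV: "B \<subseteq> V" using B by (auto simp: spans_mod_def)
  have key: "c b = c' b" if c: "c \<in> B \<rightarrow>\<^sub>E {0..<int p}" "c' \<in> B \<rightarrow>\<^sub>E {0..<int p}"
    and diff: "(\<Sum>b\<in>B. of_int (c b) * b) - (\<Sum>b\<in>B. of_int (c' b) * b) \<in> max_ideal V"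
    and b: "b \<in> B" for c c' b
  proof (rule ccontr)
    assume ne: "c b \<noteq> c' b"
    define n where "n = c b - c' b"
    have "\<not> int p dvd n"
    proof
      assume "int p dvd n"
      moreover have "\<bar>n\<bar> < int p" "n \<noteq> 0" using c b ne by (auto simp: n_def PiE_iff Pi_iff abs_less_iff dest!: bspec[of B _ b])
      ultimately show False using zdvd_not_zless[of "\<bar>n\<bar>" "int p"] by auto
    qed
    then have "coprime (int p) n" using p(1) by (intro prime_imp_coprime) auto
    then obtain k a where ak: "k * int p + a * n = 1" using bezout_int[of "int p" n] by auto
    define R where "R = (\<Sum>b'\<in>B - {b}. of_int (c b' - c' b') * b')"
    have "of_int n * b + R \<in> max_ideal V"
    proof -
      have "(\<Sum>b\<in>B. of_int (c b) * b) - (\<Sum>b\<in>B. of_int (c' b) * b) = (\<Sum>b\<in>B. of_int (c b - c' b) * b)"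
        by (simp add: sum_subtractf algebra_simps)
      also have "\<dots> = of_int n * b + R" unfolding R_def n_def by (rule sum.remove[OF finB b])
      finally show ?thesis using diff by simp
    qed
    then have "of_int a * (of_int n * b + R) + of_nat p * (of_int k * b) \<in> max_ideal V"
      using p b BV by blast
    moreover have "of_int a * (of_int n * b + R) + of_nat p * (of_int k * b) = b + of_int a * R"
    proof -
      have "of_int a * of_int n + of_nat p * of_int k = (1::'a)"
        using arg_cong[OF ak, of "of_int :: _ \<Rightarrow> 'a"] by (simp add: algebra_simps)
      then have "(of_int a * of_int n + of_nat p * of_int k) * b = b" by simp
      then show ?thesis by (simp add: algebra_simps)
    qed
    ultimately have bR: "b + of_int a * R \<in> max_ideal V" by simp
    have "spans_mod V (max_ideal V) (B - {b})"
      unfolding spans_mod_def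
    proof (intro conjI ballI)
      fix x assume "x \<in> V"
      then obtain d where d: "x - (\<Sum>b\<in>B. of_int (d b) * b) \<in> max_ideal V" using B by (auto simp: spans_mod_def)
      \<comment> \<open>Substitutes \<open>- a R\<close> for \<open>b\<close> in the combination
        that represents \<open>x\<close>.\<close>
      define d' where "d' b' = d b' - d b * a * (c b' - c' b')" for b'
      have "x - (\<Sum>b\<in>B. of_int (d b) * b) + of_int (d b) * (b + of_int a * R) \<in> max_ideal V" using d bR by blast
      moreover have S: "(\<Sum>b'\<in>B - {b}. of_int (d' b') * b') =
          (\<Sum>b'\<in>B - {b}. of_int (d b') * b') - of_int (d b) * of_int a * R"
        unfolding d'_def R_def by (simp add: sum_subtractf sum.distrib sum_distrib_left algebra_simps)
      moreover have S2: "(\<Sum>b\<in>B. of_int (d b) * b) = of_int (d b) * b + (\<Sum>b'\<in>B - {b}. of_int (d b') * b')"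
        by (rule sum.remove[OF finB b])
      have "x - (\<Sum>b'\<in>B - {b}. of_int (d' b') * b') =
          x - (\<Sum>b\<in>B. of_int (d b) * b) + of_int (d b) * (b + of_int a * R)"
        unfolding S S2 by (simp only: algebra_simps)
      ultimately show "\<exists>c. x - (\<Sum>b\<in>B - {b}. of_int (c b) * b) \<in> max_ideal V" by metis
    qed (use finB BV in auto)
    then have "card B \<le> card (B - {b})" by (rule least)
    then show False using b finB by (metis card_Diff1_less leD)
  qed
  have inj: "inj_on (\<lambda>c. \<Sum>b\<in>B. of_int (c b) * b) (B \<rightarrow>\<^sub>E {0..<int p})"
    by (rule inj_onI, rule PiE_ext) (auto intro!: key)
  have "residue_system V (combos p B)"
    unfolding residue_system_def
  proof (intro conjI ballI impI)
    fix x y assume xy: "x \<in> combos p B" "y \<in> combos p B" "x - y \<in> max_ideal V"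
    then obtain c c' where cc: "c \<in> B \<rightarrow>\<^sub>E {0..<int p}" "c' \<in> B \<rightarrow>\<^sub>E {0..<int p}"
      "x = (\<Sum>b\<in>B. of_int (c b) * b)" "y = (\<Sum>b\<in>B. of_int (c' b) * b)" by (auto simp: combos_def)
    have "c b = c' b" if "b \<in> B" for b using key cc xy(3) that by blast
    then show "x = y" using cc by simp
  next
    fix x assume "x \<in> V"
    then show "\<exists>y\<in>combos p B. x - y \<in> max_ideal V"
      using multiples_subset_max[OF p(2)] p(1)
      by (intro combos_represent[OF B]) (auto simp: prime_gt_0_nat)
  qed (use finB BV combos_V finite_combos in auto)
  moreover have "card (combos p B) = p ^ card B"
    unfolding combos_def card_image[OF inj] using finB by (simp add: card_PiE)
  ultimately show ?thesis using that card by simp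
qed

text \<open>Expansion in digits: modulo t^k every element is a sum of terms a t^i with digits
  \<open>a\<close> in \<open>T\<close> and i < k, and t^k generates the same ideal as
  \<open>p\<close>.\<close>

lemma (in val_ring) fp_finite_dim_multiplesI:
  assumes T: "residue_system V T" and t: "uniformizer V t" and e: "of_nat p = t ^ k * u" "u \<in> V - max_ideal V"
  shows "fp_finite_dim V (multiples p V)"
proof -
  define B where "B = (\<lambda>(a, i). a * t ^ i) ` (T \<times> {..<k})"
  have tV: "t \<in> V" using t max_ideal_V by (auto simp: uniformizer_def)
  have finB: "finite B" using T by (auto simp: B_def residue_system_def)
  have BV: "B \<subseteq> V" using T tV by (auto simp: B_def residue_system_def)
  have approx: "\<exists>c :: 'a \<Rightarrow> int. \<exists>y\<in>V. x - (\<Sum>b\<in>B. of_int (c b) * b) = t ^ j * y" if "x \<in> V" "j \<le> k" for x j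
    using that(2)
  proof (induction j)
    case 0
    show ?case using that(1) by (intro exI[of _ "\<lambda>_. 0"] bexI[of _ x]) auto
  next
    case (Suc j)
    then obtain c :: "'a \<Rightarrow> int" and y where c: "y \<in> V" "x - (\<Sum>b\<in>B. of_int (c b) * b) = t ^ j * y" by auto
    obtain a where a: "a \<in> T" "y - a \<in> max_ideal V" using T c by (auto simp: residue_system_def)
    obtain z where z: "z \<in> V" "y - a = t * z" using a t by (auto simp: uniformizer_def)
    \<comment> \<open>The coefficient is raised by one and not set to one, because the same element
      of \<open>B\<close> may arise from several pairs of a digit and an exponent.\<close>
    define c' where "c' b = c b + (if b = a * t ^ j then 1 else 0)" for b
    have aB: "a * t ^ j \<in> B" using a Suc.prems by (auto simp: B_def)
    have "(\<Sum>b\<in>B. of_int (c' b) * b) = (\<Sum>b\<in>B. of_int (c b) * b) + (\<Sum>b\<in>B. if b = a * t ^ j then b else 0)"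
      unfolding sum.distrib[symmetric] by (rule sum.cong) (auto simp: c'_def algebra_simps)
    also have "(\<Sum>b\<in>B. if b = a * t ^ j then b else 0) = a * t ^ j" using finB aB by simp
    finally have "x - (\<Sum>b\<in>B. of_int (c' b) * b) = t ^ j * (y - a)" using c(2) by (simp add: algebra_simps)
    also have "\<dots> = t ^ Suc j * z" using z by simp
    finally show ?case using z(1) by blast
  qed
  have "\<exists>c :: 'a \<Rightarrow> int. x - (\<Sum>b\<in>B. of_int (c b) * b) \<in> multiples p V" if x: "x \<in> V" for x
  proof -
    obtain c :: "'a \<Rightarrow> int" and y where "y \<in> V" "x - (\<Sum>b\<in>B. of_int (c b) * b) = t ^ k * y" using approx[OF x, of k] by auto
    moreover from this have "t ^ k * y = of_nat p * (inverse u * y)" using e unfolding unit_iff by auto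
    moreover have "of_nat p * (inverse u * y) \<in> multiples p V"
      using e(2) \<open>y \<in> V\<close> unfolding multiples_def unit_iff by blast
    ultimately show ?thesis by metis
  qed
  then have "spans_mod V (multiples p V) B" using finB BV unfolding spans_mod_def by (intro conjI ballI)
  then show ?thesis unfolding fp_finite_dim_def by (rule exI)
qed

section \<open>p-valuations and their extensions\<close>

lemma is_subfield_UNIV: "is_subfield UNIV"
  by (simp add: is_subfield_def)

lemma max_ideal_restrict:
  assumes "is_subfield K" "P \<inter> K = q" "x \<in> K"
  shows "x \<in> max_ideal P \<longleftrightarrow> x \<in> max_ideal q"
proof -
  have "inverse x \<in> K" using assms by (simp add: is_subfield_def)
  then show ?thesis using assms by (auto simp: max_ideal_def)
qed

lemma fp_finite_dim_mono: "fp_finite_dim R I \<Longrightarrow> I \<subseteq> J \<Longrightarrow> fp_finite_dim R J"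
  unfolding fp_finite_dim_def spans_mod_def by (meson subsetD)

text \<open>Turns the definitions by \<open>THE\<close> and \<open>LEAST\<close> into explicit
  witnesses, once for both the prime of \<open>K\<close> and the primes above it.\<close>

lemma p_valuation_structure:
  fixes L V :: "'a::field_char_0 set"
  assumes "is_subfield L" "p_valuation L V"
  obtains p t e u T where "val_ring L V" "Factorial_Ring.prime p" "of_nat p \<in> max_ideal V" "residue_char V = p"
    "uniformizer V t" "t \<noteq> 0" "of_nat p = t ^ e * u" "u \<in> V - max_ideal V" "e > 0" "ram_index L V = e"
    "residue_system V T" "card T = p ^ res_degree L V" "res_degree L V > 0"
proof -
  interpret val_ring L V using assms by (simp add: val_ring_def p_valuation_def)
  obtain p where p: "Factorial_Ring.prime p" "of_nat p \<in> max_ideal V" "fp_finite_dim V (multiples p V)"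
    using assms by (auto simp: p_valuation_def)
  have p0: "of_nat p \<noteq> (0 :: 'a)" using p(1) by auto
  obtain E where E: "\<And>x. x \<in> max_ideal V \<Longrightarrow> x ^ E \<in> multiples p V"
    using power_dvd_of_fp_finite_dim[OF p] by blast
  then have E': "\<And>x. x \<in> max_ideal V \<Longrightarrow> \<exists>y\<in>V. x ^ E = of_nat p * y" unfolding multiples_def by blast
  obtain t where t: "uniformizer V t" using uniformizer_exists[OF p(2) p0 E'] by blast
  have t0: "t \<noteq> 0" using t p0 p(2) by (auto simp: uniformizer_def)
  obtain y where "y \<in> V" "t ^ E = of_nat p * y" using E' t by (auto simp: uniformizer_def)
  then obtain e u where e: "u \<in> V - max_ideal V" "of_nat p = t ^ e * u"
    using uniformizer_power_unit[OF t t0, of "of_nat p" y E] by auto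
  have e0: "e > 0" using e p(2) by (cases e) auto
  have rc: "residue_char V = p" using residue_char_eqI p by blast
  have ri: "ram_index L V = e" using ram_index_eqI[OF rc t t0 e(2) e(1)] .
  have "fp_finite_dim V (max_ideal V)" by (rule fp_finite_dim_mono[OF p(3) multiples_subset_max[OF p(2)]])
  then obtain T where T: "residue_system V T" "card T = p ^ fp_dim V (max_ideal V)"
    using residue_system_fp_dim p by blast
  have rd: "res_degree L V = fp_dim V (max_ideal V)" using not_ordering by (simp add: res_degree_def)
  have "fp_dim V (max_ideal V) \<noteq> 0"
  proof
    assume "fp_dim V (max_ideal V) = 0"
    then obtain s where s: "T = {s}" using T(2) by (auto simp: card_1_singleton_iff)
    obtain a where "a \<in> T" "0 - a \<in> max_ideal V" using T zero_V unfolding residue_system_def by blast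
    moreover obtain b where "b \<in> T" "1 - b \<in> max_ideal V" using T one_V unfolding residue_system_def by blast
    ultimately have "(1 - s) - (0 - s) \<in> max_ideal V" using s by blast
    then show False by simp
  qed
  then show ?thesis using that[OF _ p(1,2) rc t t0 e(2,1) e0 ri T(1)] T(2) rd val_ring_axioms by simp
qed

text \<open>Representatives for \<open>q\<close> stay incongruent modulo the maximal ideal of
  \<open>P\<close> and satisfy the equations of both residue fields. This makes the division of
  residue degrees in \<open>relative_type\<close> exact.\<close>

lemma residue_degrees:
  assumes Pr: "val_ring L P" and qr: "val_ring K q" and PK: "P \<inter> K = q" and p: "p > (1::nat)"
    and T: "residue_system P T" "card T = p ^ m" and U: "residue_system q U" "card U = p ^ n" "n > 0"
  shows "n dvd m"
proof -
  interpret P: val_ring L P by fact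
  interpret q: val_ring K q by fact
  have max: "x \<in> max_ideal P \<longleftrightarrow> x \<in> max_ideal q" if "x \<in> K" for x
    using max_ideal_restrict[OF q.subfield PK that] .
  have UP: "U \<subseteq> q" using U by (simp add: residue_system_def)
  have diff: "x - y \<in> K" if "x \<in> q" "y \<in> q" for x y using q.diff_V[OF that] q.V_subset by blast
  show ?thesis
  proof (rule P.degree_dvd_of_powers[OF p, of U])
    show "\<forall>x\<in>U. \<forall>y\<in>U. x - y \<in> max_ideal P \<longrightarrow> x = y"
      using U(1) UP diff max by (auto simp: residue_system_def subset_iff)
    show "x ^ p ^ n - x \<in> max_ideal P" if x: "x \<in> U" for x
    proof -
      have "x \<in> q" using x UP by blast
      then have "x ^ p ^ n - x \<in> max_ideal q" using q.power_card_residue_system[OF U(1)] U(2) by metis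
      moreover have "x ^ p ^ n - x \<in> K" using \<open>x \<in> q\<close> diff q.power_V by blast
      ultimately show ?thesis using max by blast
    qed
    show "x ^ p ^ m - x \<in> max_ideal P" if x: "x \<in> U" for x
      using P.power_card_residue_system[OF T(1), of x] T(2) x UP PK by auto
  qed (use U UP PK in \<open>auto simp: residue_system_def\<close>)
qed

text \<open>
  The conditions on the right are universally quantified and each instance involves only finitely
  many elements, so they define a closed set of primes.
\<close>

theorem primes_above_p_adic:
  fixes K :: "'f::field_char_0 set"
  assumes K: "is_subfield K" and q: "p_valuation K q" and ef: "e > 0" "f > 0"
  obtains c :: 'f and n :: nat where "c \<in> max_ideal q" "c \<noteq> 0" "n \<ge> 2"
    "primes_above K q (e, f) = {P. valuation_ring_on UNIV P \<and> P \<inter> K = q \<and>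
       (\<forall>x\<in>max_ideal P. x ^ e / c \<in> P) \<and> (\<forall>x\<in>P. x ^ n - x \<in> max_ideal P)}"
proof -
  obtain p c eq u U where vq: "val_ring K q" and p: "Factorial_Ring.prime p" "of_nat p \<in> max_ideal q" "residue_char q = p"
    and c: "uniformizer q c" "c \<noteq> 0" "of_nat p = c ^ eq * u" "u \<in> q - max_ideal q" "eq > 0" "ram_index K q = eq"
    and U: "residue_system q U" "card U = p ^ res_degree K q" "res_degree K q > 0"
    using p_valuation_structure[OF K q] .
  interpret q: val_ring K q by fact
  define fq where "fq = res_degree K q"
  define n where "n = p ^ (fq * f)"
  have p1: "p > 1" using p(1) prime_gt_1_nat by blast
  have n2: "n \<ge> 2"
  proof -
    have "fq * f > 0" using U ef by (simp add: fq_def)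
    then have "n > 1" unfolding n_def using p1 one_less_power by blast
    then show ?thesis by simp
  qed
  have cm: "c \<in> max_ideal q" using c by (simp add: uniformizer_def)
  have cK: "c \<in> K" "u \<in> K" using cm c q.max_ideal_V q.V_subset by auto
  have "P \<in> primes_above K q (e, f) \<longleftrightarrow> valuation_ring_on UNIV P \<and> P \<inter> K = q \<and>
       (\<forall>x\<in>max_ideal P. x ^ e / c \<in> P) \<and> (\<forall>x\<in>P. x ^ n - x \<in> max_ideal P)" (is "?A \<longleftrightarrow> ?B") for P
  proof (cases "valuation_ring_on UNIV P \<and> P \<inter> K = q")
    case False
    have "valuation_ring_on UNIV P" if "?A"
    proof (rule ccontr)
      assume "\<not> ?thesis"
      then have o: "ordering_on UNIV P" using that by (auto simp: primes_above_def classical_prime_def p_valuation_def)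
      have "1 \<in> q" "-1 \<in> q" by blast+
      then have "1 \<in> P" "-1 \<in> P" using that by (auto simp: primes_above_def)
      then have "(1::'f) = 0" using o by (auto simp: ordering_on_def)
      then show False by simp
    qed
    then show ?thesis using False by (auto simp: primes_above_def)
  next
    case True
    then have vP: "val_ring UNIV P" and PK: "P \<inter> K = q" by (auto simp: val_ring_def is_subfield_UNIV)
    interpret P: val_ring UNIV P by fact
    have max: "x \<in> max_ideal P \<longleftrightarrow> x \<in> max_ideal q" if "x \<in> K" for x
      using max_ideal_restrict[OF K PK that] .
    have pP: "of_nat p \<in> max_ideal P" using p max q.max_ideal_V q.V_subset by blast
    have cP: "c \<in> max_ideal P" using cm cK max by blast
    have uP: "u \<in> P - max_ideal P" using c(4) cK max PK by blast
    have p0: "of_nat p \<noteq> (0::'f)" using p1 by simp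
    have rcP: "residue_char P = p" using P.residue_char_eqI p(1) pP by blast
    \<comment> \<open>The data \<open>t\<close>, \<open>w\<close>, \<open>T\<close> are kept
      abstract because they have two origins: the structure of a given p-valuation in one direction,
      a construction from the right-hand conditions in the other.\<close>
    have step: "?A \<longleftrightarrow> ?B" if t: "uniformizer P t" "t \<noteq> 0" and et: "of_nat p = t ^ eP * w" "w \<in> P - max_ideal P"
      and T: "residue_system P T" "card T = p ^ m" and pv: "p_valuation UNIV P"
      and m: "res_degree UNIV P = m" "m > 0" for t eP w T m
    proof -
      have riP: "ram_index UNIV P = eP" by (rule P.ram_index_eqI[OF rcP t et])
      \<comment> \<open>\<open>c\<close> divides a power of the uniformizer \<open>t\<close> of
        \<open>P\<close>, so c = t^k v with a unit v. This \<open>k\<close> is the relative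
        ramification index.\<close>
      have "t ^ eP = c * (c ^ (eq - 1) * u * inverse w)"
      proof -
        have "t ^ eP * w = c * (c ^ (eq - 1) * u)"
          using et c(3,5) by (metis mult.assoc power_eq_if not_gr_zero)
        moreover have "w \<noteq> 0" using et P.unit_iff by blast
        ultimately show ?thesis by (simp add: field_simps)
      qed
      moreover have "c ^ (eq - 1) * u * inverse w \<in> P"
        using P.max_ideal_V[OF cP] uP et(2) unfolding P.unit_iff by blast
      ultimately obtain k v where k: "v \<in> P - max_ideal P" "c = t ^ k * v"
        using P.uniformizer_power_unit[OF t, of c] P.max_ideal_V[OF cP] by blast
      have "t ^ eP * w = c ^ eq * u" using et(1) c(3) by simp
      also have "\<dots> = t ^ (k * eq) * (v ^ eq * u)"
        unfolding k(2) by (simp only: power_mult_distrib power_mult mult.assoc)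
      finally have "eP = k * eq"
        using P.uniformizer_power_eq[OF t et(2) P.unit_mult[OF P.unit_power[OF k(1)] uP]] by blast
      then have kdiv: "eP div eq = k" using c by simp
      have tP: "t \<in> P" "t \<in> max_ideal P" using t P.max_ideal_V by (auto simp: uniformizer_def)
      have v0: "v \<noteq> 0" "inverse v \<in> P" using k(1) unfolding P.unit_iff by blast+
      have ram: "k \<le> e \<longleftrightarrow> (\<forall>x\<in>max_ideal P. x ^ e / c \<in> P)"
      proof
        assume ke: "k \<le> e"
        show "\<forall>x\<in>max_ideal P. x ^ e / c \<in> P"
        proof
          fix x assume "x \<in> max_ideal P"
          then obtain y where y: "y \<in> P" "x = t * y" using t by (auto simp: uniformizer_def)
          have "x ^ e = t ^ k * t ^ (e - k) * y ^ e" using ke y by (simp add: power_mult_distrib flip: power_add)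
          then have "x ^ e / c = t ^ (e - k) * y ^ e * inverse v" using t(2) k v0 by (simp add: field_simps)
          also have "\<dots> \<in> P" using tP y v0 by blast
          finally show "x ^ e / c \<in> P" .
        qed
      next
        assume *: "\<forall>x\<in>max_ideal P. x ^ e / c \<in> P"
        show "k \<le> e"
        proof (rule ccontr)
          assume "\<not> k \<le> e"
          then have "c = t ^ e * (t ^ (k - e) * v)" using k by (simp flip: power_add mult.assoc)
          then have "t ^ e / c * (t ^ (k - e) * v) = 1" using t(2) c(2) by (simp add: field_simps)
          moreover have "t ^ (k - e) * v \<in> max_ideal P"
            using tP k(1) \<open>\<not> k \<le> e\<close> by (cases "k - e") auto
          ultimately show False using * tP P.mult_max2 P.one_max by metis
        qed
      qed
      have "fq dvd m"
        unfolding fq_def by (rule residue_degrees[OF vP vq PK p1 T U])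
      then obtain d where d: "m = fq * d" by blast
      have fq0: "fq > 0" using U by (simp add: fq_def)
      have res: "m div fq dvd f \<longleftrightarrow> (\<forall>x\<in>P. x ^ n - x \<in> max_ideal P)"
      proof
        assume "m div fq dvd f"
        then obtain j where "fq * f = m * j" using d fq0 by auto
        then show "\<forall>x\<in>P. x ^ n - x \<in> max_ideal P"
          unfolding n_def using P.power_card_residue_system[OF T(1)] T(2) P.power_power_mult[of _ p m j] by metis
      next
        assume *: "\<forall>x\<in>P. x ^ n - x \<in> max_ideal P"
        have "m dvd fq * f"
          by (rule P.degree_dvd_of_powers[OF p1, of T])
            (use T m * P.power_card_residue_system[OF T(1)] in \<open>auto simp: residue_system_def n_def subset_iff\<close>)
        then show "m div fq dvd f" using d fq0 by auto
      qed
      have "?A \<longleftrightarrow> k \<le> e \<and> m div fq dvd f"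
        using pv PK by (simp add: primes_above_def classical_prime_def type_le_def relative_type_def riP m c kdiv fq_def)
      then show ?thesis using ram res True by blast
    qed
    show ?thesis
    proof
      assume A: ?A
      then have "p_valuation UNIV P" using P.not_ordering by (auto simp: primes_above_def classical_prime_def)
      then obtain p' t e' w T where *: "Factorial_Ring.prime p'" "of_nat p' \<in> max_ideal P" "residue_char P = p'"
        "uniformizer P t" "t \<noteq> 0" "of_nat p' = t ^ e' * w" "w \<in> P - max_ideal P"
        "residue_system P T" "card T = p' ^ res_degree UNIV P" "res_degree UNIV P > 0"
        using p_valuation_structure[OF is_subfield_UNIV, of P] by metis
      then have "p' = p" using rcP by simp
      then show ?B using step[OF *(4,5) _ *(7,8) _ _ refl *(10)] *(6,9) A \<open>p_valuation UNIV P\<close> by blast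
    next
      assume B: ?B
      \<comment> \<open>The power (x^e / c)^eq is integral, and c^eq is \<open>p\<close> up to a
        unit. So \<open>p\<close> divides x^(e eq), which is what the existence of a uniformizer
        requires.\<close>
      have dvd: "\<exists>y\<in>P. x ^ (e * eq) = of_nat p * y" if x: "x \<in> max_ideal P" for x
      proof -
        have "(x ^ e / c) ^ eq * inverse u \<in> P" using B x uP unfolding P.unit_iff by blast
        moreover have "of_nat p * ((x ^ e / c) ^ eq * inverse u) = x ^ (e * eq)"
        proof -
          have "u \<noteq> 0" using uP P.unit_iff by blast
          then show ?thesis using c(2) unfolding c(3) by (simp add: power_mult power_divide)
        qed
        ultimately show ?thesis by metis
      qed
      obtain t where t: "uniformizer P t" using P.uniformizer_exists[OF pP p0 dvd] .
      have t0: "t \<noteq> 0" using t p0 pP by (auto simp: uniformizer_def)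
      obtain y where "y \<in> P" "t ^ (e * eq) = of_nat p * y" using dvd t by (auto simp: uniformizer_def)
      then obtain eP w where w: "w \<in> P - max_ideal P" "of_nat p = t ^ eP * w"
        using P.uniformizer_power_unit[OF t t0, of "of_nat p" y "e * eq"] by auto
      define M where "M = (Polynomial.monom 1 n - Polynomial.monom 1 1 :: 'f poly)"
      have M: "Polynomial.coeff M n = 1" "Polynomial.degree M \<le> n"
        unfolding M_def using n2 by (auto intro!: degree_diff_le simp: degree_monom_eq)
      then have "Polynomial.degree M = n" by (simp add: le_antisym le_degree)
      then have lead: "Polynomial.lead_coeff M = 1" using M by simp
      \<comment> \<open>Residue classes are roots of X^n - X, so there are at most \<open>n\<close>
        of them and the residue field is finite.\<close>
      have "card T \<le> Polynomial.degree M" if T: "finite T" "T \<subseteq> P" "\<forall>x\<in>T. \<forall>y\<in>T. x - y \<in> max_ideal P \<longrightarrow> x = y" for T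
      proof (rule P.card_roots_max_le[OF T(1,2)])
        show "Polynomial.coeff M i \<in> P" for i by (simp add: M_def coeff_diff) blast
        show "poly M x \<in> max_ideal P" if "x \<in> T" for x using B that T(2) by (auto simp: M_def poly_monom)
      qed (use T lead in auto)
      then obtain T where T: "residue_system P T" using P.residue_system_exists by blast
      have fin: "fp_finite_dim P (multiples p P)" using P.fp_finite_dim_multiplesI[OF T t w(2,1)] .
      then have pv: "p_valuation UNIV P" using True p(1) pP by (auto simp: p_valuation_def)
      obtain p' T' where *: "residue_char P = p'"
        "residue_system P T'" "card T' = p' ^ res_degree UNIV P" "res_degree UNIV P > 0"
        using p_valuation_structure[OF is_subfield_UNIV pv] by metis
      show ?A using step[OF t t0 w(2,1) *(2) _ pv refl *(4)] *(1,3) rcP B by blast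
    qed
  qed
  then show ?thesis using that[OF cm c(2) n2] by blast
qed

section \<open>Closed sets of primes\<close>

text \<open>The constructible topology on sets of field elements, encoded by their characteristic
  functions so that Tychonoff's theorem gives compactness.\<close>

definition patch_topology :: "('f \<Rightarrow> bool) topology" where
  "patch_topology = product_topology (\<lambda>_. discrete_topology UNIV) UNIV"

text \<open>Being clopen passes through all propositional connectives, so a condition on finitely
  many memberships is clopen by its syntax; quantifying it universally leaves a closed set.\<close>

definition patch_clopen :: "(('f \<Rightarrow> bool) \<Rightarrow> bool) \<Rightarrow> bool" where
  "patch_clopen \<Phi> \<longleftrightarrow> openin patch_topology {\<xi>. \<Phi> \<xi>} \<and> closedin patch_topology {\<xi>. \<Phi> \<xi>}"

lemma topspace_patch_topology [simp]: "topspace patch_topology = UNIV"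
  by (simp add: patch_topology_def)

lemma patch_clopen_member: "patch_clopen (\<lambda>\<xi>. \<xi> a)"
proof -
  have c: "continuous_map patch_topology (discrete_topology UNIV) (\<lambda>\<xi>. \<xi> a)"
    unfolding patch_topology_def by (rule continuous_map_product_projection) simp
  show ?thesis
    using openin_continuous_map_preimage[OF c, of "{True}"] closedin_continuous_map_preimage[OF c, of "{True}"]
    by (simp add: patch_clopen_def)
qed

lemma patch_clopen_const: "patch_clopen (\<lambda>_. b)"
  using openin_topspace[of "patch_topology"] closedin_topspace[of "patch_topology"]
  by (cases b) (simp_all add: patch_clopen_def)

lemma patch_clopen_not: "patch_clopen \<Phi> \<Longrightarrow> patch_clopen (\<lambda>\<xi>. \<not> \<Phi> \<xi>)"
  using openin_diff[of "patch_topology" UNIV "{\<xi>. \<Phi> \<xi>}"] closedin_diff[of "patch_topology" UNIV "{\<xi>. \<Phi> \<xi>}"]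
    openin_topspace[of "patch_topology"] closedin_topspace[of "patch_topology"]
  by (auto simp: patch_clopen_def set_diff_eq)

lemma patch_clopen_conj: "patch_clopen \<Phi> \<Longrightarrow> patch_clopen \<Psi> \<Longrightarrow> patch_clopen (\<lambda>\<xi>. \<Phi> \<xi> \<and> \<Psi> \<xi>)"
  using openin_Int[of "patch_topology" "{\<xi>. \<Phi> \<xi>}" "{\<xi>. \<Psi> \<xi>}"]
    closedin_Int[of "patch_topology" "{\<xi>. \<Phi> \<xi>}" "{\<xi>. \<Psi> \<xi>}"]
  by (simp add: patch_clopen_def Collect_conj_eq)

lemma patch_clopen_imp: "patch_clopen \<Phi> \<Longrightarrow> patch_clopen \<Psi> \<Longrightarrow> patch_clopen (\<lambda>\<xi>. \<Phi> \<xi> \<longrightarrow> \<Psi> \<xi>)"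
  using patch_clopen_not[OF patch_clopen_conj[OF _ patch_clopen_not], of \<Phi> \<Psi>] by simp

lemma patch_clopen_disj: "patch_clopen \<Phi> \<Longrightarrow> patch_clopen \<Psi> \<Longrightarrow> patch_clopen (\<lambda>\<xi>. \<Phi> \<xi> \<or> \<Psi> \<xi>)"
  using patch_clopen_imp[OF patch_clopen_not, of \<Phi> \<Psi>] by (simp add: disj_imp)

lemma patch_clopen_iff: "patch_clopen \<Phi> \<Longrightarrow> patch_clopen \<Psi> \<Longrightarrow> patch_clopen (\<lambda>\<xi>. \<Phi> \<xi> \<longleftrightarrow> \<Psi> \<xi>)"
  unfolding iff_conv_conj_imp by (intro patch_clopen_conj patch_clopen_imp)

lemmas patch_clopen_intros = patch_clopen_member patch_clopen_const patch_clopen_not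
  patch_clopen_conj patch_clopen_imp patch_clopen_disj patch_clopen_iff

lemma closed_patch_clopen: "patch_clopen \<Phi> \<Longrightarrow> closedin patch_topology {\<xi>. \<Phi> \<xi>}"
  by (simp add: patch_clopen_def)

lemma closed_all:
  "(\<And>x. closedin patch_topology {\<xi>. \<Phi> x \<xi>}) \<Longrightarrow> closedin patch_topology {\<xi>. \<forall>x. \<Phi> x \<xi>}"
  using closedin_INT[of UNIV "patch_topology" "\<lambda>x. {\<xi>. \<Phi> x \<xi>}"]
  by (simp add: Collect_all_eq)

lemma closed_conj:
  "closedin patch_topology {\<xi>. \<Phi> \<xi>} \<Longrightarrow> closedin patch_topology {\<xi>. \<Psi> \<xi>} \<Longrightarrow>
   closedin patch_topology {\<xi>. \<Phi> \<xi> \<and> \<Psi> \<xi>}"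
  by (simp add: Collect_conj_eq closedin_Int)

text \<open>The characteristic functions of members of \<open>A\<close> form a closed, hence compact
  set, which maps continuously onto \<open>A\<close> with the Zariski topology. By
  \<open>compl\<close> the sets H(a) are clopen in \<open>A\<close>, so two distinct primes are
  separated by a partition into open sets. This gives the Hausdorff property and total
  disconnectedness together.\<close>

lemma SAP_I:
  fixes A :: "'f::field set set"
  assumes primes: "\<And>P. P \<in> A \<Longrightarrow> prime_on UNIV P"
    and closed: "closedin patch_topology {\<xi>. {x. \<xi> x} \<in> A}"
    and compl: "\<And>a. \<exists>b. \<forall>P\<in>A. a \<notin> P \<longleftrightarrow> b \<in> P"
    and inter: "\<And>a b. \<exists>c. \<forall>P\<in>A. c \<in> P \<longleftrightarrow> a \<in> P \<and> b \<in> P"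
  shows "SAP A"
proof -
  define T where "T = subtopology zariski A"
  have HA: "H a \<inter> A = {P \<in> A. a \<in> P}" for a using primes by (auto simp: H_def)
  \<comment> \<open>Since 0 lies in every prime, H(0) covers \<open>A\<close>, which shows that the
    points of \<open>T\<close> are all of \<open>A\<close>.\<close>
  have zero: "0 \<in> P" if "P \<in> A" for P
    using primes[OF that]
    by (auto simp: prime_on_def valuation_ring_on_def is_subring_def ordering_on_def dest: bspec[of UNIV _ 0])
  have openH: "openin T {P \<in> A. a \<in> P}" for a
  proof -
    have "openin zariski (H a)" unfolding zariski_def by (rule topology_generated_by_Basis) simp
    then show ?thesis unfolding T_def HA[symmetric] by (rule openin_subtopology_Int)
  qed
  have openN: "openin T {P \<in> A. a \<notin> P}" for a
  proof -
    from compl[of a] obtain b where "\<forall>P\<in>A. a \<notin> P \<longleftrightarrow> b \<in> P" ..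
    then have "{P \<in> A. a \<notin> P} = {P \<in> A. b \<in> P}" by (intro Collect_cong conj_cong refl) (rule bspec)
    then show ?thesis using openH by simp
  qed
  have topT: "topspace T = A"
  proof -
    have "A = {P \<in> A. 0 \<in> P}" using zero by blast
    then have "A \<subseteq> topspace T" using openin_subset[OF openH[of 0]] by simp
    moreover have "topspace T \<subseteq> A" unfolding T_def topspace_subtopology by (rule Int_lower2)
    ultimately show ?thesis by (rule equalityI[rotated])
  qed
  have "compact_space T"
  proof -
    define C where "C = {\<xi>. {x. \<xi> x} \<in> A}"
    define g where "g \<xi> = {x :: 'f. \<xi> x}" for \<xi>
    have img: "g ` C = A"
    proof
      show "A \<subseteq> g ` C"
      proof
        fix P assume "P \<in> A"
        then have "P = g (\<lambda>x. x \<in> P)" "(\<lambda>x. x \<in> P) \<in> C" by (auto simp: g_def C_def)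
        then show "P \<in> g ` C" by blast
      qed
    qed (auto simp: g_def C_def)
    have "compact_space (patch_topology :: ('f \<Rightarrow> bool) topology)"
      unfolding patch_topology_def by (simp add: compact_space_product_topology compact_space_discrete_topology)
    then have "compactin patch_topology C" using closed closedin_compact_space by (auto simp: C_def)
    then have "compactin (subtopology patch_topology C) C" by (simp add: compactin_subtopology)
    moreover have "continuous_map (subtopology patch_topology C) T g"
    proof -
      have "continuous_map (subtopology patch_topology C) zariski g"
        unfolding zariski_def
      proof (rule continuous_on_generated_topo)
        fix U :: "'f set set" assume "U \<in> range H"
        then obtain a where a: "U = H a" by blast
        have "g -` U \<inter> topspace (subtopology patch_topology C) = C \<inter> {\<xi>. \<xi> a}"
          using primes by (auto simp: a H_def g_def C_def)
        moreover have "openin patch_topology {\<xi> :: 'f \<Rightarrow> bool. \<xi> a}"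
          using patch_clopen_member[of a] by (simp add: patch_clopen_def)
        ultimately show "openin (subtopology patch_topology C) (g -` U \<inter> topspace (subtopology patch_topology C))"
          by (simp add: openin_subtopology_Int2)
      next
        show "g ` topspace (subtopology patch_topology C) \<subseteq> \<Union> (range H)"
          using img primes zero by (auto simp: H_def)
      qed
      then show ?thesis using img by (auto simp: T_def continuous_map_in_subtopology)
    qed
    ultimately have "compactin T (g ` C)" by (rule image_compactin)
    then show ?thesis by (simp add: img compact_space_def topT)
  qed
  moreover have sep: "\<exists>U V. openin T U \<and> openin T V \<and> P \<in> U \<and> P' \<in> V \<and> disjnt U V \<and> A \<subseteq> U \<union> V"
    if "P \<in> A" "P' \<in> A" "P \<noteq> P'" for P P'
  proof -
    from \<open>P \<noteq> P'\<close> obtain a where "a \<in> P \<and> a \<notin> P' \<or> a \<notin> P \<and> a \<in> P'" by blast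
    then show ?thesis
    proof
      assume "a \<in> P \<and> a \<notin> P'"
      then show ?thesis using that openH[of a] openN[of a]
        by (intro exI[of _ "{P \<in> A. a \<in> P}"] exI[of _ "{P \<in> A. a \<notin> P}"]) (auto simp: disjnt_def)
    next
      assume "a \<notin> P \<and> a \<in> P'"
      then show ?thesis using that openH[of a] openN[of a]
        by (intro exI[of _ "{P \<in> A. a \<notin> P}"] exI[of _ "{P \<in> A. a \<in> P}"]) (auto simp: disjnt_def)
    qed
  qed
  have "Hausdorff_space T"
    unfolding Hausdorff_space_def topT using sep by meson
  moreover have "\<exists>P. C \<subseteq> {P}" if C: "connectedin T C" for C
  proof (rule ccontr)
    assume n: "\<not> ?thesis"
    have CA: "C \<subseteq> A" using connectedin_subset_topspace[OF C] topT by simp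
    from n obtain P where P: "P \<in> C" by blast
    with n obtain P' where P': "P' \<in> C" "P \<noteq> P'" by blast
    obtain U V where U: "openin T U" "openin T V" "P \<in> U" "P' \<in> V" "disjnt U V" "A \<subseteq> U \<union> V"
      using sep[of P P'] P P' CA by blast
    show False
      by (rule connectedinD[OF C U(1,2)]) (use U P P' CA in \<open>auto simp: disjnt_def\<close>)
  qed
  moreover have "\<exists>c. (H a \<inter> A) \<inter> (H b \<inter> A) = H c \<inter> A" for a b
  proof -
    from inter[of a b] obtain c where "\<forall>P\<in>A. c \<in> P \<longleftrightarrow> a \<in> P \<and> b \<in> P" ..
    then have "(H a \<inter> A) \<inter> (H b \<inter> A) = H c \<inter> A" unfolding HA by auto
    then show ?thesis ..
  qed
  ultimately show ?thesis unfolding SAP_def profinite_space_def T_def by blast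
qed

text \<open>The form is the homogenization of \<open>X\<^sup>n - X + 1\<close>, which takes only unit values on \<open>V\<close>.\<close>

lemma (in val_ring) norm_form:
  assumes n: "n \<ge> 2" and pow: "\<forall>x\<in>V. x ^ n - x \<in> max_ideal V" and ab: "a \<in> L" "b \<in> L"
  shows "a ^ n - a * b ^ (n - 1) + b ^ n \<in> V \<longleftrightarrow> a \<in> V \<and> b \<in> V"
proof
  assume "a \<in> V \<and> b \<in> V"
  then show "a ^ n - a * b ^ (n - 1) + b ^ n \<in> V" by (intro add_V diff_V mult_V power_V) auto
next
  assume *: "a ^ n - a * b ^ (n - 1) + b ^ n \<in> V"
  have root: "y \<in> V" if "y ^ n * w \<in> V" "w \<in> V - max_ideal V" "y \<in> L" for y w
  proof (rule ccontr)
    assume "y \<notin> V"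
    then have i: "inverse y \<in> max_ideal V" "y \<noteq> 0" using V_or_inverse_max[OF that(3)] by auto
    have "inverse w \<in> V" "w \<noteq> 0" using that(2) unfolding unit_iff by blast+
    then have "y ^ n \<in> V" using mult_V[OF that(1), of "inverse w"] by (simp add: mult.assoc)
    moreover have "inverse y ^ n \<in> max_ideal V" using power_max[OF i(1)] n by simp
    ultimately have "y ^ n * inverse y ^ n \<in> max_ideal V" by (rule mult_max2)
    then show False using i(2) by (simp flip: power_mult_distrib)
  qed
  have nb: "b ^ n = b * b ^ (n - 1)" for b :: 'a using n by (cases n) auto
  show "a \<in> V \<and> b \<in> V"
  proof (cases "b = 0")
    case True
    then have "a \<in> V" using root[of a 1] * n ab unit_iff[of 1] by (auto simp: power_0_left)
    then show ?thesis using True by simp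
  next
    case b0: False
    show ?thesis
    \<comment> \<open>The n-th power of whichever of \<open>a\<close>, \<open>b\<close> has the
      smaller value is factored out. The cofactor is congruent to 1: in the first case by
      \<open>pow\<close>, in the second because x = b / a is a nonunit and n - 1 > 0.\<close>
    proof (cases "a / b \<in> V")
      case True
      define x where "x = a / b"
      have a: "a = x * b" using b0 by (simp add: x_def)
      have "a ^ n - a * b ^ (n - 1) + b ^ n = b ^ n * (x ^ n - x + 1)"
        unfolding a power_mult_distrib by (simp add: algebra_simps nb[of b])
      moreover have "x ^ n - x + 1 \<in> V - max_ideal V"
      proof -
        have m: "x ^ n - x \<in> max_ideal V" using pow True by (simp add: x_def)
        have "x ^ n - x + 1 \<notin> max_ideal V" using diff_max[OF _ m, of "x ^ n - x + 1"] by auto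
        then show ?thesis using max_ideal_V[OF m] by auto
      qed
      ultimately have "b \<in> V" using root[of b] * ab by simp
      moreover have "a / b * b \<in> V" by (rule mult_V[OF True \<open>b \<in> V\<close>])
      ultimately show ?thesis using b0 by simp
    next
      case False
      then have m: "b / a \<in> max_ideal V" using V_divide_cases[OF ab] by blast
      define x where "x = b / a"
      have a0: "a \<noteq> 0" using False by auto
      have b: "b = x * a" using a0 by (simp add: x_def)
      have "a ^ n - a * b ^ (n - 1) + b ^ n = a ^ n * (1 - x ^ (n - 1) + x ^ n)"
        unfolding b power_mult_distrib by (simp add: algebra_simps nb[of a])
      moreover have "1 - x ^ (n - 1) + x ^ n \<in> V - max_ideal V"
      proof -
        have m: "x ^ (n - 1) - x ^ n \<in> max_ideal V"
          using n m power_max[of x] by (intro diff_max) (auto simp: x_def)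
        have "1 - (x ^ (n - 1) - x ^ n) \<notin> max_ideal V"
          using add_max[OF _ m, of "1 - (x ^ (n - 1) - x ^ n)"] by auto
        moreover have "1 - (x ^ (n - 1) - x ^ n) \<in> V" using max_ideal_V[OF m] by auto
        ultimately show ?thesis by (simp add: algebra_simps)
      qed
      ultimately have "a \<in> V" using root[of a] * ab by simp
      moreover have "b / a * a \<in> V" by (rule mult_V[OF max_ideal_V[OF m] \<open>a \<in> V\<close>])
      ultimately show ?thesis using a0 by simp
    qed
  qed
qed

theorem SAP_p_adic:
  fixes K :: "'f::field_char_0 set"
  assumes K: "is_subfield K" and q: "p_valuation K q" and ef: "e > 0" "f > 0"
  shows "SAP (primes_above K q (e, f))"
proof -
  obtain c :: 'f and n where c: "c \<in> max_ideal q" "c \<noteq> 0" and n: "n \<ge> 2"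
    and A: "primes_above K q (e, f) = {P. valuation_ring_on UNIV P \<and> P \<inter> K = q \<and>
       (\<forall>x\<in>max_ideal P. x ^ e / c \<in> P) \<and> (\<forall>x\<in>P. x ^ n - x \<in> max_ideal P)}"
    using primes_above_p_adic[OF assms] .
  have cK: "c \<in> K" using c q by (auto simp: max_ideal_def p_valuation_def valuation_ring_on_def)
  have vr: "val_ring UNIV P" and cP: "c \<in> max_ideal P" if "P \<in> primes_above K q (e, f)" for P
    using that c cK max_ideal_restrict[OF K, of P q c] by (auto simp: A val_ring_def is_subfield_UNIV)
  show ?thesis
  proof (rule SAP_I)
    show "prime_on UNIV P" if "P \<in> primes_above K q (e, f)" for P
      using that by (auto simp: A prime_on_def)
  next
    have eq: "{\<xi>. {x. \<xi> x} \<in> primes_above K q (e, f)} = {\<xi>.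
      \<xi> 0 \<and> \<xi> 1 \<and> (\<forall>x. \<forall>y. \<xi> x \<and> \<xi> y \<longrightarrow> \<xi> (x + y) \<and> \<xi> (x * y)) \<and> (\<forall>x. \<xi> x \<longrightarrow> \<xi> (- x)) \<and>
      (\<forall>x. \<xi> x \<or> \<xi> (inverse x)) \<and> (\<forall>x. (\<xi> x \<and> x \<in> K) \<longleftrightarrow> x \<in> q) \<and>
      (\<forall>x. \<xi> x \<and> (x = 0 \<or> \<not> \<xi> (inverse x)) \<longrightarrow> \<xi> (x ^ e / c)) \<and>
      (\<forall>x. \<xi> x \<longrightarrow> \<xi> (x ^ n - x) \<and> (x ^ n - x = 0 \<or> \<not> \<xi> (inverse (x ^ n - x))))}"
      unfolding A by (auto simp: valuation_ring_on_def is_subring_def max_ideal_def set_eq_iff)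
    show "closedin patch_topology {\<xi>. {x. \<xi> x} \<in> primes_above K q (e, f)}"
      unfolding eq by (intro closed_conj closed_all) (rule closed_patch_clopen, intro patch_clopen_intros)+
  next
    fix a
    show "\<exists>b. \<forall>P\<in>primes_above K q (e, f). a \<notin> P \<longleftrightarrow> b \<in> P"
    proof (cases "a = 0")
      case True
      \<comment> \<open>The element 0 lies in every prime, so an element lying in none is needed,
        and the nonunit \<open>c\<close> has such an inverse.\<close>
      have "a \<notin> P \<longleftrightarrow> inverse c \<in> P" if P: "P \<in> primes_above K q (e, f)" for P
      proof -
        interpret val_ring UNIV P using vr[OF P] .
        show ?thesis using cP[OF P] c True by (auto simp: max_ideal_def)
      qed
      then show ?thesis by blast
    next
      case False
      \<comment> \<open>\<open>a\<close> is not integral iff its inverse is a nonunit. The e-th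
        power of a nonunit is divisible by \<open>c\<close>, and conversely every multiple of
        \<open>c\<close> is a nonunit.\<close>
      have "a \<notin> P \<longleftrightarrow> inverse a ^ e / c \<in> P" if P: "P \<in> primes_above K q (e, f)" for P
      proof -
        interpret val_ring UNIV P using vr[OF P] .
        show ?thesis
        proof
          assume "a \<notin> P"
          then have "inverse a \<in> max_ideal P" using V_or_inverse_max[of a] by auto
          then show "inverse a ^ e / c \<in> P" using P by (auto simp: A)
        next
          assume "inverse a ^ e / c \<in> P"
          then have "c * (inverse a ^ e / c) \<in> max_ideal P" by (rule mult_max[OF cP[OF P]])
          then have m: "inverse a ^ e \<in> max_ideal P" using c by simp
          show "a \<notin> P"
          proof
            assume "a \<in> P"
            then have "a ^ e * inverse a ^ e \<in> max_ideal P" using m by blast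
            then show False using False by (simp flip: power_mult_distrib)
          qed
        qed
      qed
      then show ?thesis by blast
    qed
  next
    fix a b
    have "a ^ n - a * b ^ (n - 1) + b ^ n \<in> P \<longleftrightarrow> a \<in> P \<and> b \<in> P" if P: "P \<in> primes_above K q (e, f)" for P
      using val_ring.norm_form[OF vr[OF P] n, of a b] P by (auto simp: A)
    then show "\<exists>c. \<forall>P\<in>primes_above K q (e, f). c \<in> P \<longleftrightarrow> a \<in> P \<and> b \<in> P" by blast
  qed
qed

section \<open>Square roots in classical closures\<close>

lemma subfield_facts:
  assumes "is_subfield R"
  shows "0 \<in> R" "1 \<in> R" "x \<in> R \<Longrightarrow> y \<in> R \<Longrightarrow> x + y \<in> R" "x \<in> R \<Longrightarrow> y \<in> R \<Longrightarrow> x * y \<in> R"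
    "x \<in> R \<Longrightarrow> - x \<in> R" "x \<in> R \<Longrightarrow> inverse x \<in> R"
    "x \<in> R \<Longrightarrow> y \<in> R \<Longrightarrow> x - y \<in> R" "x \<in> R \<Longrightarrow> y \<in> R \<Longrightarrow> x / y \<in> R"
proof -
  show *: "0 \<in> R" "1 \<in> R" "x \<in> R \<Longrightarrow> y \<in> R \<Longrightarrow> x + y \<in> R" "x \<in> R \<Longrightarrow> y \<in> R \<Longrightarrow> x * y \<in> R"
    "x \<in> R \<Longrightarrow> - x \<in> R" "x \<in> R \<Longrightarrow> inverse x \<in> R" for x y
    using assms by (auto simp: is_subfield_def)
  show "x \<in> R \<Longrightarrow> y \<in> R \<Longrightarrow> x - y \<in> R" using *(3)[of x "- y"] *(5) by simp
  show "x \<in> R \<Longrightarrow> y \<in> R \<Longrightarrow> x / y \<in> R" using *(4)[of x "inverse y"] *(6) by (simp add: divide_inverse)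
qed

text \<open>For a field \<open>R\<close> and quadratic \<open>w\<close> this is R(w). It is applied
  to a valuation ring \<open>Q\<close> as well, where it is Q[w].\<close>

definition adjoin :: "'a::field set \<Rightarrow> 'a \<Rightarrow> 'a set" where
  "adjoin R w = {a + b * w | a b. a \<in> R \<and> b \<in> R}"

lemma adjoinI: "a \<in> R \<Longrightarrow> b \<in> R \<Longrightarrow> a + b * w \<in> adjoin R w"
  by (auto simp: adjoin_def)

lemma adjoinE:
  assumes "x \<in> adjoin R w"
  obtains a b where "a \<in> R" "b \<in> R" "x = a + b * w"
  using assms by (auto simp: adjoin_def)

lemma adjoin_unique:
  assumes R: "is_subfield R" and w: "w \<notin> R" and ab: "a \<in> R" "b \<in> R" "c \<in> R" "d \<in> R"
    and eq: "a + b * w = c + d * w"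
  shows "a = c \<and> b = d"
proof -
  note R = subfield_facts[OF R]
  have "b = d"
  proof (rule ccontr)
    assume "b \<noteq> d"
    then have "w = (a - c) / (d - b)" using eq by (simp add: field_simps) 
    then show False using w ab R by simp
  qed
  then show ?thesis using eq by simp
qed

lemma subfield_adjoin:
  assumes R: "is_subfield R" and w: "w \<notin> R" "w * w = s * w + m" "s \<in> R" "m \<in> R"
  shows "is_subfield (adjoin R w)" "R \<subseteq> adjoin R w" "w \<in> adjoin R w"
proof -
  note Rf = subfield_facts[OF R]
  show sub: "R \<subseteq> adjoin R w"
  proof
    fix x assume "x \<in> R"
    then have "x + 0 * w \<in> adjoin R w" by (intro adjoinI Rf)
    then show "x \<in> adjoin R w" by simp
  qed
  show "w \<in> adjoin R w" using adjoinI[of 0 R 1 w] Rf by simp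
  show "is_subfield (adjoin R w)"
    unfolding is_subfield_def
  proof (intro conjI ballI)
    fix x y assume "x \<in> adjoin R w" "y \<in> adjoin R w"
    then obtain a b c d where ab: "a \<in> R" "b \<in> R" "x = a + b * w" and cd: "c \<in> R" "d \<in> R" "y = c + d * w"
      by (auto elim!: adjoinE)
    have xy: "x + y = (a + c) + (b + d) * w" using ab cd by (simp add: algebra_simps)
    show "x + y \<in> adjoin R w" unfolding xy using ab cd by (intro adjoinI Rf(3))
    have "x * y = a * c + (a * d + b * c) * w + b * d * (w * w)" using ab cd by (simp add: algebra_simps)
    also have "\<dots> = (a * c + b * d * m) + (a * d + b * c + b * d * s) * w" unfolding w(2) by (simp add: algebra_simps)
    finally show "x * y \<in> adjoin R w" using w ab cd by (simp add: adjoinI Rf)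
  next
    fix x assume "x \<in> adjoin R w"
    then obtain a b where ab: "a \<in> R" "b \<in> R" "x = a + b * w" by (rule adjoinE)
    have mx: "- x = - a + (- b) * w" using ab by simp
    show "- x \<in> adjoin R w" unfolding mx using ab by (intro adjoinI Rf(5))
    show "inverse x \<in> adjoin R w"
    proof (cases "x = 0")
      case False
      \<comment> \<open>The conjugate of \<open>x\<close>, with \<open>s - w\<close> in place of
        \<open>w\<close>; \<open>N\<close> is the norm.\<close>
      define y where "y = (a + b * s) + (- b) * w"
      define N where "N = a * a + a * b * s - b * b * m"
      have "x * y = a * a + a * b * s + b * b * (s * w) - b * b * (w * w)"
        using ab by (simp add: y_def algebra_simps)
      also have "\<dots> = N" unfolding w(2) N_def by (simp add: algebra_simps)
      finally have xy: "x * y = N" .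
      have "y \<noteq> 0"
      proof
        assume "y = 0"
        then have "(a + b * s) + (- b) * w = 0 + 0 * w" by (simp add: y_def)
        then have "a + b * s = 0 \<and> - b = 0" by (rule adjoin_unique[OF R w(1), rotated 4]) (use ab w Rf in auto)
        then have "b = 0" "a = 0" by auto
        then show False using ab(3) False by simp
      qed
      then have "N \<noteq> 0" using xy False by auto
      then have "inverse x = y / N" using xy False by (simp add: field_simps)
      also have "\<dots> = (a + b * s) / N + (- b / N) * w" by (simp add: y_def field_simps diff_divide_distrib)
      also have "\<dots> \<in> adjoin R w" using ab w by (intro adjoinI Rf) (auto simp: N_def intro!: Rf)
      finally show ?thesis .
    qed (use sub Rf in auto)
  qed (use sub Rf in auto)
qed

text \<open>If w is a square root of some d in \<open>Q\<close> and not in R, then every sum of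
  squares in R(w) has its R-component in \<open>Q\<close>. So -1 is no such sum, R(w) is formally
  real, and maximality of \<open>R\<close> is violated.\<close>

lemma sqrt_in_real_closed:
  fixes R :: "'f::field_char_0 alg_closure set"
  assumes R: "real_closed R" and Q: "ordering_on R Q" and d: "d \<in> Q"
  obtains w where "w \<in> R" "w ^ 2 = d"
proof -
  have sub: "is_subfield R" using R by (simp add: real_closed_def)
  note Rf = subfield_facts[OF sub]
  have QR: "Q \<subseteq> R" and Qadd: "\<And>x y. x \<in> Q \<Longrightarrow> y \<in> Q \<Longrightarrow> x + y \<in> Q"
    and Qmult: "\<And>x y. x \<in> Q \<Longrightarrow> y \<in> Q \<Longrightarrow> x * y \<in> Q"
    and Qtot: "\<And>x. x \<in> R \<Longrightarrow> x \<in> Q \<or> - x \<in> Q" and Qanti: "\<And>x. x \<in> Q \<Longrightarrow> - x \<in> Q \<Longrightarrow> x = 0"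
    using Q unfolding ordering_on_def by blast+
  have sq: "x * x \<in> Q" if "x \<in> R" for x using Qtot[OF that] Qmult[of x x] Qmult[of "- x" "- x"] by auto
  obtain w where w: "w ^ 2 = d" using nth_root_exists[of 2 d] by auto
  have "w \<in> R"
  proof (rule ccontr)
    assume wR: "w \<notin> R"
    have ww: "w * w = 0 * w + d" using w by (simp add: power2_eq_square)
    have dR: "d \<in> R" using d QR by blast
    note ext = subfield_adjoin[OF sub wR ww Rf(1) dR]
    have "formally_real (adjoin R w)"
      unfolding formally_real_def
    proof (intro allI impI notI)
      fix xs assume xs: "set xs \<subseteq> adjoin R w" and sum: "(\<Sum>x\<leftarrow>xs. x ^ 2) = - 1"
      have "\<exists>a\<in>Q. \<exists>b\<in>R. (\<Sum>x\<leftarrow>xs. x ^ 2) = a + b * w" using xs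
      proof (induction xs)
        case Nil
        show ?case using sq[OF Rf(1)] Rf(1) by (intro bexI[of _ 0]) auto
      next
        case (Cons x xs)
        then obtain a b where ab: "a \<in> Q" "b \<in> R" "(\<Sum>x\<leftarrow>xs. x ^ 2) = a + b * w" by auto
        from Cons.prems have "x \<in> adjoin R w" by simp
        then obtain u v where uv: "u \<in> R" "v \<in> R" "x = u + v * w" by (rule adjoinE)
        have "x ^ 2 = u * u + 2 * u * v * w + v * v * (w * w)" using uv by (simp add: power2_eq_square algebra_simps)
        then have "(\<Sum>x\<leftarrow>x # xs. x ^ 2) = (u * u + v * v * d + a) + ((u * v + u * v) + b) * w"
          using ab(3) unfolding ww by (simp add: algebra_simps)
        moreover have "u * u + v * v * d + a \<in> Q" by (intro Qadd Qmult sq uv d ab)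
        moreover have "(u * v + u * v) + b \<in> R" by (intro Rf(3,4) uv ab)
        ultimately show ?case by blast
      qed
      then obtain a b where ab: "a \<in> Q" "b \<in> R" "- 1 = a + b * w" unfolding sum by blast
      then have "a + b * w = - 1 + 0 * w" by simp
      then have "a = - 1 \<and> b = 0"
        by (rule adjoin_unique[OF sub wR, rotated 4]) (use ab(1,2) QR Rf in auto)
      then have "- 1 \<in> Q" using ab by simp
      then have "(1::'f alg_closure) = 0" using sq[OF Rf(2)] Qanti[of 1] by simp
      then show False by simp
    qed
    then have "adjoin R w = R" using R ext by (auto simp: real_closed_def)
    then show False using ext wR by simp
  qed
  then show ?thesis using w by (rule that)
qed

text \<open>By \<open>mult\<close> and \<open>approx\<close> the inclusion induces an isomorphism of
  Q/pQ with Q'/pQ', so spanning sets can be carried over in both directions without growing.\<close>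

lemma fp_dim_transfer:
  assumes Q: "val_ring L Q" and Q': "val_ring L' Q'" and QQ: "Q \<subseteq> Q'"
    and mult: "\<And>y. y \<in> Q \<Longrightarrow> y \<in> multiples p Q' \<Longrightarrow> y \<in> multiples p Q"
    and approx: "\<And>x. x \<in> Q' \<Longrightarrow> \<exists>y\<in>Q. x - y \<in> multiples p Q'"
    and fin: "fp_finite_dim Q (multiples p Q)"
  shows "fp_finite_dim Q' (multiples p Q')" "fp_dim Q' (multiples p Q') = fp_dim Q (multiples p Q)"
proof -
  interpret Q: val_ring L Q by fact
  interpret Q': val_ring L' Q' by fact
  have mm: "multiples p Q \<subseteq> multiples p Q'" using QQ by (auto simp: multiples_def)
  have up: "spans_mod Q' (multiples p Q') B" if B: "spans_mod Q (multiples p Q) B" for B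
    unfolding spans_mod_def
  proof (intro conjI ballI)
    fix x assume "x \<in> Q'"
    then obtain y where y: "y \<in> Q" "x - y \<in> multiples p Q'" using approx by blast
    then obtain c where c: "y - (\<Sum>b\<in>B. of_int (c b) * b) \<in> multiples p Q" using B by (auto simp: spans_mod_def)
    have "(x - y) + (y - (\<Sum>b\<in>B. of_int (c b) * b)) \<in> multiples p Q'"
      by (rule Q'.multiples_add[OF y(2) subsetD[OF mm c]])
    then show "\<exists>c. x - (\<Sum>b\<in>B. of_int (c b) * b) \<in> multiples p Q'" by auto
  qed (use B QQ in \<open>auto simp: spans_mod_def\<close>)
  have down: "\<exists>B. spans_mod Q (multiples p Q) B \<and> card B \<le> card B'" if B': "spans_mod Q' (multiples p Q') B'" for B'
  proof -
    have "\<forall>b\<in>B'. \<exists>y\<in>Q. b - y \<in> multiples p Q'" using approx B' by (auto simp: spans_mod_def)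
    then obtain g where g: "\<And>b. b \<in> B' \<Longrightarrow> g b \<in> Q" "\<And>b. b \<in> B' \<Longrightarrow> b - g b \<in> multiples p Q'" by metis
    have fin: "finite B'" using B' by (simp add: spans_mod_def)
    have gQ: "g ` B' \<subseteq> Q" using g by blast
    have "spans_mod Q (multiples p Q) (g ` B')"
      unfolding spans_mod_def
    proof (intro conjI ballI)
      fix x assume x: "x \<in> Q"
      with QQ have "x \<in> Q'" by blast
      with B' obtain c where c: "x - (\<Sum>b\<in>B'. of_int (c b) * b) \<in> multiples p Q'"
        unfolding spans_mod_def by blast
      \<comment> \<open>\<open>g\<close> may send several generators to one element, whose
        coefficient is then the sum over the fibre.\<close>
      define c' where "c' y = (\<Sum>b | b \<in> B' \<and> g b = y. c b)" for y
      have "(\<Sum>y\<in>g ` B'. of_int (c' y) * y) = (\<Sum>y\<in>g ` B'. \<Sum>b | b \<in> B' \<and> g b = y. of_int (c b) * g b)"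
        by (intro sum.cong refl) (auto simp: c'_def sum_distrib_right)
      also have "\<dots> = (\<Sum>b\<in>B'. of_int (c b) * g b)"
        by (rule sum.image_gen[OF fin, symmetric])
      finally have s: "(\<Sum>y\<in>g ` B'. of_int (c' y) * y) = (\<Sum>b\<in>B'. of_int (c b) * g b)" .
      have "(\<Sum>b\<in>B'. (b - g b) * of_int (c b)) \<in> multiples p Q'"
        by (intro Q'.multiples_sum Q'.multiples_mult g) auto
      then have "x - (\<Sum>b\<in>B'. of_int (c b) * b) + (\<Sum>b\<in>B'. (b - g b) * of_int (c b)) \<in> multiples p Q'"
        by (rule Q'.multiples_add[OF c])
      also have "x - (\<Sum>b\<in>B'. of_int (c b) * b) + (\<Sum>b\<in>B'. (b - g b) * of_int (c b))
          = x - (\<Sum>b\<in>B'. of_int (c b) * g b)"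
        by (simp add: algebra_simps sum_subtractf)
      finally have "x - (\<Sum>y\<in>g ` B'. of_int (c' y) * y) \<in> multiples p Q'" by (simp only: s)
      moreover have "x - (\<Sum>y\<in>g ` B'. of_int (c' y) * y) \<in> Q"
        using gQ by (intro Q.diff_V x Q.sum_V Q.mult_V) auto
      ultimately have "x - (\<Sum>y\<in>g ` B'. of_int (c' y) * y) \<in> multiples p Q" by (rule mult[rotated])
      then show "\<exists>c. x - (\<Sum>b\<in>g ` B'. of_int (c b) * b) \<in> multiples p Q" by (intro exI[of _ c'])
    qed (use fin gQ in auto)
    then show ?thesis using card_image_le[OF fin, of g] by blast
  qed
  obtain B where B: "spans_mod Q (multiples p Q) B" using fin by (auto simp: fp_finite_dim_def)
  show "fp_finite_dim Q' (multiples p Q')" unfolding fp_finite_dim_def using up[OF B] by (rule exI)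
  have least: "fp_dim V I \<le> card B" if "spans_mod V I B" for V I and B :: "'a set"
    unfolding fp_dim_def by (rule Least_le) (use that in blast)
  have ex: "\<exists>B. spans_mod V I B \<and> card B = fp_dim V I" if "spans_mod V I B0" for V I and B0 :: "'a set"
    unfolding fp_dim_def by (rule LeastI[of "\<lambda>d. \<exists>B. spans_mod V I B \<and> card B = d" "card B0"]) (use that in blast)
  show "fp_dim Q' (multiples p Q') = fp_dim Q (multiples p Q)"
  proof (rule antisym)
    show "fp_dim Q' (multiples p Q') \<le> fp_dim Q (multiples p Q)"
      using ex[OF B] up least by metis
    obtain B' where "spans_mod Q' (multiples p Q') B'" "card B' = fp_dim Q' (multiples p Q')"
      using ex[OF up[OF B]] by blast
    then show "fp_dim Q (multiples p Q) \<le> fp_dim Q' (multiples p Q')"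
      using down least by (metis le_trans)
  qed
qed

text \<open>
  \<open>Q'\<close> is the localization of \<open>Q[w]\<close> at the maximal ideal generated by \<open>w\<close> and the maximal ideal
  of \<open>Q\<close>. Up to units of \<open>Q'\<close>, every element of \<open>R(w)\<close> lies in \<open>R\<close>, and \<open>w\<close> is a multiple of \<open>p\<close>, so
  \<open>Q' = Q + p Q'\<close>.
\<close>

lemma artin_schreier_extension:
  fixes R :: "'a::field_char_0 set"
  assumes R: "is_subfield R" and Q: "p_valuation R Q"
    and p: "Factorial_Ring.prime p" "of_nat p \<in> max_ideal Q" and z: "z \<in> Q"
    and w: "w \<notin> R" "w * w = 1 * w + of_nat p * z"
  obtains Q' where "p_valuation (adjoin R w) Q'" "Q' \<inter> R = Q" "p_rank Q' = p_rank Q"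
proof -
  interpret Q: val_ring R Q using R Q by (simp add: val_ring_def p_valuation_def)
  note Rf = subfield_facts[OF R]
  define \<mu> where "\<mu> = of_nat p * z"
  have \<mu>: "\<mu> \<in> max_ideal Q" using p z by (auto simp: \<mu>_def)
  have QR: "x \<in> R" if "x \<in> Q" for x using that Q.V_subset by blast
  have \<mu>Q: "\<mu> \<in> Q" using \<mu> Q.max_ideal_V by blast
  have ww: "w * w = w + \<mu>" using w by (simp add: \<mu>_def)
  note ext = subfield_adjoin[OF R w(1) w(2) Rf(2) QR[OF \<mu>Q, unfolded \<mu>_def]]
  note Ef = subfield_facts[OF ext(1)]
  define B where "B = adjoin Q w"
  \<comment> \<open>The complement of that maximal ideal in \<open>B\<close>: whether c + d w lies
    in the ideal depends on \<open>c\<close> alone.\<close>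
  define M where "M = {c + d * w | c d. c \<in> Q - max_ideal Q \<and> d \<in> Q}"
  define Q' where "Q' = {x. \<exists>s\<in>M. x * s \<in> B}"
  have mult: "(a + b * w) * (c + d * w) = (a * c + b * d * \<mu>) + (a * d + b * c + b * d) * w" for a b c d
  proof -
    have "(a + b * w) * (c + d * w) = a * c + (a * d + b * c) * w + b * d * (w * w)" by (simp add: algebra_simps)
    then show ?thesis unfolding ww by (simp add: algebra_simps)
  qed
  have MB: "M \<subseteq> B" by (auto simp: M_def B_def adjoin_def)
  have QB: "x \<in> B" if "x \<in> Q" for x using adjoinI[OF that Q.zero_V, of w] by (simp add: B_def)
  have one_M: "1 \<in> M" unfolding M_def using Q.one_V Q.zero_V Q.one_max by (intro CollectI exI[of _ 1] exI[of _ 0]) auto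
  have B_add: "x + y \<in> B" if "x \<in> B" "y \<in> B" for x y
  proof -
    from that obtain a b c d where *: "a \<in> Q" "b \<in> Q" "x = a + b * w" "c \<in> Q" "d \<in> Q" "y = c + d * w"
      unfolding B_def by (auto elim!: adjoinE)
    have "(a + c) + (b + d) * w \<in> B" unfolding B_def using * by (intro adjoinI Q.add_V)
    then show ?thesis using * by (simp add: algebra_simps)
  qed
  have B_mult: "x * y \<in> B" if "x \<in> B" "y \<in> B" for x y
  proof -
    from that obtain a b c d where *: "a \<in> Q" "b \<in> Q" "x = a + b * w" "c \<in> Q" "d \<in> Q" "y = c + d * w"
      unfolding B_def by (auto elim!: adjoinE)
    show ?thesis unfolding *(3,6) mult B_def using * \<mu>Q by (intro adjoinI Q.add_V Q.mult_V)
  qed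
  have M_mult: "s * t \<in> M" if "s \<in> M" "t \<in> M" for s t
  proof -
    from that obtain a b c d where *: "a \<in> Q - max_ideal Q" "b \<in> Q" "s = a + b * w"
      "c \<in> Q - max_ideal Q" "d \<in> Q" "t = c + d * w"
      unfolding M_def by blast
    have bd: "b * d * \<mu> \<in> max_ideal Q" by (rule Q.mult_max2[OF Q.mult_V[OF *(2,5)] \<mu>])
    have ac: "a * c \<in> Q - max_ideal Q" by (rule Q.unit_mult[OF *(1,4)])
    then have "a * c + b * d * \<mu> \<notin> max_ideal Q"
      using Q.diff_max[OF _ bd, of "a * c + b * d * \<mu>"] by auto
    moreover have "a * c + b * d * \<mu> \<in> Q" using ac Q.max_ideal_V[OF bd] by (intro Q.add_V) auto
    moreover have "a * d + b * c + b * d \<in> Q" using * by (intro Q.add_V Q.mult_V) auto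
    ultimately show ?thesis unfolding *(3,6) mult M_def by blast
  qed
  have M0: "s \<noteq> 0" if "s \<in> M" for s
  proof
    assume "s = 0"
    from \<open>s \<in> M\<close> obtain c d where *: "c \<in> Q - max_ideal Q" "d \<in> Q" "s = c + d * w" unfolding M_def by blast
    have "c + d * w = 0 + 0 * w" using * \<open>s = 0\<close> by simp
    then have "c = 0 \<and> d = 0" by (rule adjoin_unique[OF R w(1), rotated 4]) (use * QR Rf in auto)
    then show False using * by auto
  qed
  have BQ': "x \<in> Q'" if "x \<in> B" for x unfolding Q'_def using one_M that by (intro CollectI bexI[of _ 1]) auto
  have QQ': "Q \<subseteq> Q'" using QB BQ' by blast
  have M_inv: "inverse s \<in> Q'" if "s \<in> M" for s
    unfolding Q'_def using that M0[OF that] QB[OF Q.one_V] by (intro CollectI bexI[of _ s]) auto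
  have Q'_add: "x + y \<in> Q'" if "x \<in> Q'" "y \<in> Q'" for x y
  proof -
    from that obtain s t where st: "s \<in> M" "x * s \<in> B" "t \<in> M" "y * t \<in> B" unfolding Q'_def by blast
    have "x * s * t + y * t * s \<in> B"
      by (rule B_add[OF B_mult[OF st(2) subsetD[OF MB st(3)]] B_mult[OF st(4) subsetD[OF MB st(1)]]])
    then have "(x + y) * (s * t) \<in> B" by (simp add: algebra_simps)
    then show ?thesis unfolding Q'_def using M_mult[OF st(1,3)] by blast
  qed
  have Q'_mult: "x * y \<in> Q'" if "x \<in> Q'" "y \<in> Q'" for x y
  proof -
    from that obtain s t where st: "s \<in> M" "x * s \<in> B" "t \<in> M" "y * t \<in> B" unfolding Q'_def by blast
    have "(x * s) * (y * t) \<in> B" by (rule B_mult[OF st(2,4)])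
    then have "(x * y) * (s * t) \<in> B" by (simp add: algebra_simps)
    then show ?thesis unfolding Q'_def using M_mult[OF st(1,3)] by blast
  qed
  have BE: "B \<subseteq> adjoin R w" using QR by (auto simp: B_def adjoin_def)
  have Q'E: "x \<in> adjoin R w" if x: "x \<in> Q'" for x
  proof -
    from x obtain s where s: "s \<in> M" "x * s \<in> B" unfolding Q'_def by blast
    have "x = x * s / s" using M0[OF s(1)] by simp
    also have "\<dots> \<in> adjoin R w" using s MB BE by (intro Ef(8)) auto
    finally show ?thesis .
  qed
  have unit: "\<exists>r\<in>R. \<exists>u\<in>M. x = r * u \<or> x = r * inverse u" if x: "x \<in> adjoin R w" for x
  proof -
    from x obtain a b where ab: "a \<in> R" "b \<in> R" "x = a + b * w" by (rule adjoinE)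
    show ?thesis
    proof (cases "a \<noteq> 0 \<and> b / a \<in> Q")
      case True
      then have "1 + b / a * w \<in> M" unfolding M_def using Q.one_V Q.one_max by blast
      moreover have "x = a * (1 + b / a * w)" using ab True by (simp add: field_simps)
      ultimately show ?thesis using ab by blast
    next
      case False
      define c where "c = a / b"
      have c: "c \<in> max_ideal Q"
      proof (cases "a = 0")
        case True
        then show ?thesis by (simp add: c_def)
      next
        case a: False
        then show ?thesis using False Q.V_divide_cases[OF ab(2,1)] by (auto simp: c_def)
      qed
      show ?thesis
      proof (cases "b = 0")
        case True
        then have "x = a * 1" using ab by simp
        then show ?thesis using ab one_M by blast
      next
        case b: False
        \<comment> \<open>The conjugate of w + c is 1 + c - w, since \<open>w\<close> and
          \<open>1 - w\<close> are the roots of X^2 - X - \<mu>. It lies in \<open>M\<close>, and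
          \<open>n\<close> is the norm.\<close>
        define n where "n = c * c + c - \<mu>"
        have cQ: "c \<in> Q" using c Q.max_ideal_V by blast
        have "1 + c \<notin> max_ideal Q" using Q.diff_max[OF _ c, of "1 + c"] by auto
        then have s: "(1 + c) + (- 1) * w \<in> M" (is "?s \<in> M") unfolding M_def using cQ by blast
        have "x = b * (w + c)" using ab b by (simp add: c_def field_simps)
        moreover have "(w + c) * ?s = w + c + c * c - w * w" by (simp add: algebra_simps)
        then have "(w + c) * ?s = n" unfolding ww n_def by (simp add: algebra_simps)
        then have "w + c = n * inverse ?s" using M0[OF s] by (metis divide_inverse nonzero_eq_divide_eq)
        ultimately have "x = (b * n) * inverse ?s" by (simp only: mult.assoc)
        moreover have "b * n \<in> R" unfolding n_def using ab QR[OF cQ] QR[OF \<mu>Q] by (intro Rf)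
        ultimately show ?thesis using s by blast
      qed
    qed
  qed
  have val: "x \<in> Q' \<or> inverse x \<in> Q'" if x: "x \<in> adjoin R w" for x
  proof -
    from unit[OF x] obtain r u where ru: "r \<in> R" "u \<in> M" "x = r * u \<or> x = r * inverse u" by blast
    have uQ': "u \<in> Q'" "inverse u \<in> Q'" using ru MB BQ' M_inv by auto
    have "r \<in> Q' \<or> inverse r \<in> Q'" using Q.V_or_inverse_max[OF ru(1)] Q.max_ideal_V QQ' by blast
    then show ?thesis
    proof
      assume "r \<in> Q'"
      then show ?thesis using ru(3) uQ' Q'_mult by blast
    next
      assume r: "inverse r \<in> Q'"
      have "inverse x = inverse r * inverse u \<or> inverse x = inverse r * u" using ru(3) by auto
      then show ?thesis using r uQ' Q'_mult by metis
    qed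
  qed
  have "valuation_ring_on (adjoin R w) Q'"
    unfolding valuation_ring_on_def is_subring_def
  proof (intro conjI ballI)
    fix x assume "x \<in> Q'"
    then have "(- 1) * x \<in> Q'" using QQ' by (intro Q'_mult) auto
    then show "- x \<in> Q'" by simp
  qed (use Q'E val Q'_add Q'_mult QQ' in auto)
  then interpret Q': val_ring "adjoin R w" Q' using ext(1) by (simp add: val_ring_def)
  have inter: "Q' \<inter> R = Q"
  proof
    show "Q' \<inter> R \<subseteq> Q"
    proof
      fix x assume x: "x \<in> Q' \<inter> R"
      then obtain s where s: "s \<in> M" "x * s \<in> B" unfolding Q'_def by blast
      obtain c d where cd: "c \<in> Q - max_ideal Q" "d \<in> Q" "s = c + d * w" using s(1) unfolding M_def by blast
      obtain a b where ab: "a \<in> Q" "b \<in> Q" "x * s = a + b * w" using s(2) unfolding B_def by (rule adjoinE)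
      have "x * c + x * d * w = a + b * w" using ab cd by (simp add: algebra_simps)
      then have "x * c = a \<and> x * d = b"
        by (rule adjoin_unique[OF R w(1), rotated 4]) (use x cd ab QR Rf(4) in auto)
      moreover have "c \<noteq> 0" "inverse c \<in> Q" using cd(1) unfolding Q.unit_iff by blast+
      ultimately have "x = a * inverse c" by (metis divide_inverse nonzero_eq_divide_eq)
      then show "x \<in> Q" using ab \<open>inverse c \<in> Q\<close> by blast
    qed
  qed (use QQ' QR in auto)
  have pQ': "of_nat p \<in> max_ideal Q'"
    using max_ideal_restrict[OF R inter, of "of_nat p"] p(2) QR Q.max_ideal_V by blast
  have p0: "of_nat p \<noteq> (0::'a)" using p(1) by auto
  \<comment> \<open>From w (1 - w) = - p z with 1 - w invertible in \<open>Q'\<close>.\<close>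
  have wdiv: "w / of_nat p \<in> Q'"
  proof -
    have s: "1 + (- 1) * w \<in> M" unfolding M_def using Q.one_V Q.one_max by blast
    have "w * (1 + (- 1) * w) = - \<mu>" using ww by (simp add: algebra_simps)
    then have "w / of_nat p * (1 + (- 1) * w) = - z" using p0 by (simp add: \<mu>_def field_simps)
    then show ?thesis unfolding Q'_def using s z QB by (intro CollectI bexI[OF _ s]) auto
  qed
  have approx: "\<exists>y\<in>Q. x - y \<in> multiples p Q'" if x: "x \<in> Q'" for x
  proof -
    from x obtain s where s: "s \<in> M" "x * s \<in> B" unfolding Q'_def by blast
    obtain c d where cd: "c \<in> Q - max_ideal Q" "d \<in> Q" "s = c + d * w" using s(1) unfolding M_def by blast
    obtain a b where ab: "a \<in> Q" "b \<in> Q" "x * s = a + b * w" using s(2) unfolding B_def by (rule adjoinE)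
    have c: "c \<noteq> 0" "inverse c \<in> Q" using cd(1) unfolding Q.unit_iff by blast+
    \<comment> \<open>Comparing x (c + d w) with a + b w modulo \<open>w\<close>, a multiple of
      \<open>p\<close>, shows that \<open>x\<close> is congruent to a / c.\<close>
    have "x * c - a = w * (b - d * x)" using ab(3) cd(3) by (simp add: algebra_simps)
    then have "(x * c - a) * inverse c = of_nat p * (w / of_nat p * (b - d * x) * inverse c)"
      using p0 by simp
    then have "x - a * inverse c = of_nat p * (w / of_nat p * (b - d * x) * inverse c)"
      using c(1) by (simp only: left_diff_distrib mult.assoc right_inverse mult_1_right not_False_eq_True)
    moreover have "w / of_nat p * (b - d * x) * inverse c \<in> Q'"
      using wdiv ab cd c x QQ' by (intro Q'.mult_V Q'.diff_V) auto
    ultimately have "x - a * inverse c \<in> multiples p Q'"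
      unfolding multiples_def by (rule image_eqI[where f = "\<lambda>x. of_nat p * x"])
    moreover have "a * inverse c \<in> Q" using ab c by (intro Q.mult_V)
    ultimately show ?thesis by blast
  qed
  have mults: "y \<in> multiples p Q" if y: "y \<in> Q" "y \<in> multiples p Q'" for y
  proof -
    obtain v where v: "v \<in> Q'" "y = of_nat p * v" using y by (auto simp: multiples_def)
    have "v = y / of_nat p" using v p0 by simp
    also have "\<dots> \<in> R" by (rule Rf(8)) (use y QR in auto)
    finally have "v \<in> Q" using v inter by blast
    then show ?thesis using v by (auto simp: multiples_def)
  qed
  have fin: "fp_finite_dim Q (multiples p Q)"
  proof -
    obtain p' where p': "Factorial_Ring.prime p'" "of_nat p' \<in> max_ideal Q" "fp_finite_dim Q (multiples p' Q)"
      using Q by (auto simp: p_valuation_def)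
    then show ?thesis using Q.residue_char_unique[OF p p'(1,2)] by simp
  qed
  note tr = fp_dim_transfer[OF Q.val_ring_axioms Q'.val_ring_axioms QQ' mults approx fin]
  have "p_valuation (adjoin R w) Q'"
    unfolding p_valuation_def using Q'.valuation_ring p(1) pQ' tr(1) by blast
  moreover have "p_rank Q' = p_rank Q"
    using tr(2) Q.residue_char_eqI[OF p] Q'.residue_char_eqI[OF p(1) pQ'] by (simp add: p_rank_def)
  ultimately show ?thesis using inter by (intro that)
qed

text \<open>Takes the place of Hensel's lemma. With v a square root of 1 + 4 p z, the element (1 +
  v) / 2 is a root of X^2 - X - p z, which modulo the maximal ideal splits into the distinct factors
  X and X - 1 even for p = 2. If it were not in \<open>R\<close>, adjoining it would keep the
  p-rank.\<close>

lemma sqrt_in_p_adically_closed: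
  fixes R :: "'f::field_char_0 alg_closure set"
  assumes R: "p_adically_closed R Q"
    and p: "Factorial_Ring.prime p" "of_nat p \<in> max_ideal Q" and z: "z \<in> Q"
  obtains w where "w \<in> R" "w ^ 2 = 1 + 4 * (of_nat p * z)"
proof -
  have sub: "is_subfield R" and pv: "p_valuation R Q" using R by (auto simp: p_adically_closed_def)
  note Rf = subfield_facts[OF sub]
  obtain v where v: "v ^ 2 = 1 + 4 * (of_nat p * z)" using nth_root_exists[of 2 "1 + 4 * (of_nat p * z)"] by auto
  define w where "w = (1 + v) / 2"
  have v2: "v = w + w - 1" by (simp add: w_def)
  have "4 * (w * w) = 4 * (1 * w + of_nat p * z)"
    using v unfolding v2 by (simp add: power2_eq_square algebra_simps)
  then have ww: "w * w = 1 * w + of_nat p * z" by (simp only: mult_cancel_left) simp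
  have "w \<in> R"
  proof (rule ccontr)
    assume wR: "w \<notin> R"
    obtain Q' where Q': "p_valuation (adjoin R w) Q'" "Q' \<inter> R = Q" "p_rank Q' = p_rank Q"
      using artin_schreier_extension[OF sub pv p z wR ww] .
    interpret Q: val_ring R Q using sub pv by (simp add: val_ring_def p_valuation_def)
    have "of_nat p * z \<in> R" using z Q.V_subset by blast
    note ext = subfield_adjoin[OF sub wR ww Rf(2) this]
    from R have "\<And>R' Q'. is_subfield R' \<and> R \<subseteq> R' \<and> p_valuation R' Q' \<and> Q' \<inter> R = Q \<and>
        p_rank Q' = p_rank Q \<Longrightarrow> R' = R"
      unfolding p_adically_closed_def by blast
    then have "adjoin R w = R" using ext Q' by blast
    then show False using ext wR by simp
  qed
  then have "v \<in> R" unfolding v2 by (intro Rf(7) Rf(3) Rf(2))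
  then show ?thesis using v by (rule that)
qed

section \<open>Evaluation of polynomials\<close>

locale coeff_hom =
  fixes h :: "'a::comm_ring_1 \<Rightarrow> 'b::comm_ring_1"
  assumes h_zero [simp]: "h 0 = 0" and h_one [simp]: "h 1 = 1"
    and h_add: "h (a + b) = h a + h b" and h_mult: "h (a * b) = h a * h b"
begin

lemma h_diff: "h (a - b) = h a - h b"
  using h_add[of "a - b" b] by simp

lemma map_poly_pCons' [simp]: "map_poly h (pCons c p) = pCons (h c) (map_poly h p)"
  by (rule map_poly_pCons) simp

lemma map_poly_hom_add: "map_poly h (p + q) = map_poly h p + map_poly h q"
  by (rule poly_eqI) (simp add: coeff_map_poly h_add)

lemma map_poly_hom_diff: "map_poly h (p - q) = map_poly h p - map_poly h q"
  by (rule poly_eqI) (simp add: coeff_map_poly h_diff)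

lemma map_poly_hom_smult: "map_poly h (Polynomial.smult c q) = Polynomial.smult (h c) (map_poly h q)"
  by (rule poly_eqI) (simp add: coeff_map_poly h_mult)

lemma map_poly_hom_mult: "map_poly h (p * q) = map_poly h p * map_poly h q"
  by (induction p) (simp_all add: map_poly_hom_add map_poly_hom_smult)

end

definition mon :: "(nat \<Rightarrow> 'b::comm_ring_1) \<Rightarrow> (nat \<Rightarrow>\<^sub>0 nat) \<Rightarrow> 'b" where
  "mon x m = (\<Prod>j\<in>Poly_Mapping.keys m. x j ^ Poly_Mapping.lookup m j)"

definition dmon :: "nat \<Rightarrow> (nat \<Rightarrow> 'b::comm_ring_1) \<Rightarrow> (nat \<Rightarrow>\<^sub>0 nat) \<Rightarrow> 'b" where
  "dmon i x m = of_nat (Poly_Mapping.lookup m i) *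
      (\<Prod>j\<in>Poly_Mapping.keys m. x j ^ (Poly_Mapping.lookup m j - (if j = i then 1 else 0)))"

lemma mon_superset:
  assumes "finite J" "Poly_Mapping.keys m \<subseteq> J"
  shows "mon x m = (\<Prod>j\<in>J. x j ^ Poly_Mapping.lookup m j)"
  unfolding mon_def by (rule prod.mono_neutral_left) (use assms in \<open>auto simp: in_keys_iff\<close>)

lemma dmon_superset:
  assumes "finite J" "Poly_Mapping.keys m \<subseteq> J"
  shows "dmon i x m = of_nat (Poly_Mapping.lookup m i) *
      (\<Prod>j\<in>J. x j ^ (Poly_Mapping.lookup m j - (if j = i then 1 else 0)))"
  unfolding dmon_def
  by (intro arg_cong2[of _ _ _ _ "(*)"] refl prod.mono_neutral_left) (use assms in \<open>auto simp: in_keys_iff\<close>)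

lemma mon_zero [simp]: "mon x 0 = 1"
  by (simp add: mon_def)

lemma mon_add: "mon x (m + m') = mon x m * mon x m'"
proof -
  let ?J = "Poly_Mapping.keys m \<union> Poly_Mapping.keys m'"
  have "mon x (m + m') = (\<Prod>j\<in>?J. x j ^ Poly_Mapping.lookup (m + m') j)"
    by (rule mon_superset[OF _ Poly_Mapping.keys_add]) simp
  moreover have "mon x m = (\<Prod>j\<in>?J. x j ^ Poly_Mapping.lookup m j)" by (rule mon_superset) auto
  moreover have "mon x m' = (\<Prod>j\<in>?J. x j ^ Poly_Mapping.lookup m' j)" by (rule mon_superset) auto
  ultimately show ?thesis by (simp add: lookup_add power_add prod.distrib)
qed

lemma dmon_add: "dmon i x (m + m') = dmon i x m * mon x m' + mon x m * dmon i x m'"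
proof -
  let ?J = "insert i (Poly_Mapping.keys m \<union> Poly_Mapping.keys m')"
  define R where "R m = (\<Prod>j\<in>?J - {i}. x j ^ Poly_Mapping.lookup m j)" for m
  have mon: "mon x n = x i ^ Poly_Mapping.lookup n i * R n" if "Poly_Mapping.keys n \<subseteq> ?J" for n
  proof -
    have "mon x n = (\<Prod>j\<in>?J. x j ^ Poly_Mapping.lookup n j)" by (rule mon_superset) (use that in auto)
    also have "\<dots> = x i ^ Poly_Mapping.lookup n i * R n" unfolding R_def by (rule prod.remove) auto
    finally show ?thesis .
  qed
  have dmon: "dmon i x n = of_nat (Poly_Mapping.lookup n i) * (x i ^ (Poly_Mapping.lookup n i - 1) * R n)"
    if "Poly_Mapping.keys n \<subseteq> ?J" for n
  proof -
    have "dmon i x n = of_nat (Poly_Mapping.lookup n i) *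
        (\<Prod>j\<in>?J. x j ^ (Poly_Mapping.lookup n j - (if j = i then 1 else 0)))"
      by (rule dmon_superset) (use that in auto)
    also have "(\<Prod>j\<in>?J. x j ^ (Poly_Mapping.lookup n j - (if j = i then 1 else 0))) =
        x i ^ (Poly_Mapping.lookup n i - 1) * (\<Prod>j\<in>?J - {i}. x j ^ (Poly_Mapping.lookup n j - (if j = i then 1 else 0)))"
      by (subst prod.remove[of ?J i]) auto
    also have "(\<Prod>j\<in>?J - {i}. x j ^ (Poly_Mapping.lookup n j - (if j = i then 1 else 0))) = R n"
      unfolding R_def by (rule prod.cong) auto
    finally show ?thesis .
  qed
  have R: "R (m + m') = R m * R m'" by (simp add: R_def lookup_add power_add prod.distrib)
  have keys: "Poly_Mapping.keys m \<subseteq> ?J" "Poly_Mapping.keys m' \<subseteq> ?J" "Poly_Mapping.keys (m + m') \<subseteq> ?J"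
    using Poly_Mapping.keys_add[of m m'] by auto
  define a b where "a = Poly_Mapping.lookup m i" and "b = Poly_Mapping.lookup m' i"
  \<comment> \<open>The case distinction is for exponents 0, where \<open>a - 1\<close> and
    \<open>b - 1\<close> are truncated; the factor \<open>of_nat 0\<close> then removes the
    term.\<close>
  have "of_nat (a + b) * x i ^ (a + b - 1) = of_nat a * x i ^ (a - 1) * x i ^ b + x i ^ a * (of_nat b * x i ^ (b - 1))"
    by (cases a; cases b) (simp_all add: power_add algebra_simps)
  then have "of_nat (a + b) * x i ^ (a + b - 1) * (R m * R m') =
      (of_nat a * x i ^ (a - 1) * x i ^ b + x i ^ a * (of_nat b * x i ^ (b - 1))) * (R m * R m')" by simp
  then show ?thesis
    unfolding mon[OF keys(1)] mon[OF keys(2)] dmon[OF keys(1)] dmon[OF keys(2)] dmon[OF keys(3)] R lookup_add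
      a_def[symmetric] b_def[symmetric]
    by (simp only: algebra_simps)
qed

lemma ev_mon: "ev h p x = (\<Sum>m\<in>Poly_Mapping.keys p. h (Poly_Mapping.lookup p m) * mon x m)"
  by (simp add: ev_def mon_def)

lemma ev_deriv_dmon: "ev_deriv i h p x = (\<Sum>m\<in>Poly_Mapping.keys p. h (Poly_Mapping.lookup p m) * dmon i x m)"
  by (simp add: ev_deriv_def dmon_def mult.assoc)

lemma poly_mapping_decompose: "p = (\<Sum>m\<in>Poly_Mapping.keys p. Poly_Mapping.single m (Poly_Mapping.lookup p m))"
proof (rule poly_mapping_eqI)
  fix k
  show "Poly_Mapping.lookup p k =
      Poly_Mapping.lookup (\<Sum>m\<in>Poly_Mapping.keys p. Poly_Mapping.single m (Poly_Mapping.lookup p m)) k"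
    by (cases "k \<in> Poly_Mapping.keys p")
      (auto simp: lookup_sum lookup_single when_def in_keys_iff)
qed

lemma polys_add: "p \<in> polys J \<Longrightarrow> q \<in> polys J \<Longrightarrow> p + q \<in> polys J"
  using Poly_Mapping.keys_add[of p q] by (force simp: polys_def)

lemma polys_mult: "p \<in> polys J \<Longrightarrow> q \<in> polys J \<Longrightarrow> p * q \<in> polys J"
proof -
  assume p: "p \<in> polys J" and q: "q \<in> polys J"
  show ?thesis
    unfolding polys_def
  proof (intro CollectI ballI)
    fix m assume "m \<in> Poly_Mapping.keys (p * q)"
    then obtain a b where ab: "a \<in> Poly_Mapping.keys p" "b \<in> Poly_Mapping.keys q" "m = a + b"
      using keys_mult[of p q] by blast
    have "Poly_Mapping.keys m \<subseteq> Poly_Mapping.keys a \<union> Poly_Mapping.keys b"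
      unfolding ab(3) by (rule Poly_Mapping.keys_add)
    then show "Poly_Mapping.keys m \<subseteq> J" using ab p q unfolding polys_def by blast
  qed
qed

lemma polys_zero [simp]: "0 \<in> polys J" and polys_one [simp]: "1 \<in> polys J"
  by (auto simp: polys_def)

lemma polys_single: "Poly_Mapping.keys m \<subseteq> J \<Longrightarrow> Poly_Mapping.single m c \<in> polys J"
  by (auto simp: polys_def)

lemma polys_uminus: "(p :: 'a::comm_ring_1 mpol) \<in> polys J \<Longrightarrow> - p \<in> polys J"
  by (simp add: polys_def in_keys_iff)

lemma polys_diff: "(p :: 'a::comm_ring_1 mpol) \<in> polys J \<Longrightarrow> q \<in> polys J \<Longrightarrow> p - q \<in> polys J"
  using polys_add[of p J "- q"] polys_uminus by auto

lemma polys_power: "p \<in> polys J \<Longrightarrow> p ^ n \<in> polys J"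
  by (induction n) (auto intro: polys_mult)

lemma polys_sum: "(\<And>i. i \<in> A \<Longrightarrow> g i \<in> polys J) \<Longrightarrow> sum g A \<in> polys J"
  by (induction A rule: infinite_finite_induct) (auto intro: polys_add)

lemma polys_UNIV [simp]: "polys UNIV = UNIV"
  by (simp add: polys_def)

text \<open>Additive induction over monomials in the variables from \<open>J\<close>. With
  \<open>J = UNIV\<close> it covers all polynomials, so additive identities in \<open>p\<close> need
  only be checked on single terms.\<close>

lemma polys_induct [consumes 1, case_names zero single add]:
  fixes p :: "'a::comm_ring_1 mpol"
  assumes p: "p \<in> polys J"
    and zero: "P 0"
    and single: "\<And>m c. Poly_Mapping.keys m \<subseteq> J \<Longrightarrow> P (Poly_Mapping.single m c)"
    and add: "\<And>p q. P p \<Longrightarrow> P q \<Longrightarrow> P (p + q)"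
  shows "P p"
proof -
  have "P (\<Sum>m\<in>M. Poly_Mapping.single m (Poly_Mapping.lookup p m))" if "M \<subseteq> Poly_Mapping.keys p" for M
    using finite_subset[OF that finite_keys] that
  proof (induction M rule: finite_induct)
    case (insert m M)
    have "Poly_Mapping.keys m \<subseteq> J" using insert.prems p unfolding polys_def by blast
    then show ?case using insert single add by simp
  qed (simp add: zero)
  from this[OF subset_refl] show ?thesis by (simp flip: poly_mapping_decompose)
qed

context coeff_hom
begin

lemma ev_superset:
  assumes "finite M" "Poly_Mapping.keys p \<subseteq> M"
  shows "ev h p x = (\<Sum>m\<in>M. h (Poly_Mapping.lookup p m) * mon x m)"
  unfolding ev_mon by (rule sum.mono_neutral_left) (use assms in \<open>auto simp: in_keys_iff\<close>)

lemma ev_deriv_superset: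
  assumes "finite M" "Poly_Mapping.keys p \<subseteq> M"
  shows "ev_deriv i h p x = (\<Sum>m\<in>M. h (Poly_Mapping.lookup p m) * dmon i x m)"
  unfolding ev_deriv_dmon by (rule sum.mono_neutral_left) (use assms in \<open>auto simp: in_keys_iff\<close>)

lemma ev_zero [simp]: "ev h 0 x = 0" and ev_deriv_zero [simp]: "ev_deriv i h 0 x = 0"
  by (simp_all add: ev_def ev_deriv_def)

lemma ev_add: "ev h (p + q) x = ev h p x + ev h q x"
proof -
  let ?M = "Poly_Mapping.keys p \<union> Poly_Mapping.keys q"
  have "ev h (p + q) x = (\<Sum>m\<in>?M. h (Poly_Mapping.lookup (p + q) m) * mon x m)"
    by (rule ev_superset[OF _ Poly_Mapping.keys_add]) simp
  moreover have "ev h p x = (\<Sum>m\<in>?M. h (Poly_Mapping.lookup p m) * mon x m)" by (rule ev_superset) auto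
  moreover have "ev h q x = (\<Sum>m\<in>?M. h (Poly_Mapping.lookup q m) * mon x m)" by (rule ev_superset) auto
  ultimately show ?thesis by (simp add: lookup_add h_add distrib_right sum.distrib)
qed

lemma ev_deriv_add: "ev_deriv i h (p + q) x = ev_deriv i h p x + ev_deriv i h q x"
proof -
  let ?M = "Poly_Mapping.keys p \<union> Poly_Mapping.keys q"
  have "ev_deriv i h (p + q) x = (\<Sum>m\<in>?M. h (Poly_Mapping.lookup (p + q) m) * dmon i x m)"
    by (rule ev_deriv_superset[OF _ Poly_Mapping.keys_add]) simp
  moreover have "ev_deriv i h p x = (\<Sum>m\<in>?M. h (Poly_Mapping.lookup p m) * dmon i x m)"
    by (rule ev_deriv_superset) auto
  moreover have "ev_deriv i h q x = (\<Sum>m\<in>?M. h (Poly_Mapping.lookup q m) * dmon i x m)"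
    by (rule ev_deriv_superset) auto
  ultimately show ?thesis by (simp add: lookup_add h_add distrib_right sum.distrib)
qed

lemma ev_single [simp]: "ev h (Poly_Mapping.single m c) x = h c * mon x m"
  by (cases "c = 0") (simp_all add: ev_mon)

lemma ev_deriv_single: "ev_deriv i h (Poly_Mapping.single m c) x = h c * dmon i x m"
  by (cases "c = 0") (simp_all add: ev_deriv_dmon)

lemma ev_one [simp]: "ev h 1 x = 1"
  using ev_single[of 0 1 x] by simp

lemma ev_mult: "ev h (p * q) x = ev h p x * ev h q x"
proof -
  have "p \<in> polys UNIV" "q \<in> polys UNIV" by simp_all
  then show ?thesis
  proof (induction p rule: polys_induct)
    case (single m c)
    from single(2) show ?case
      by (induction q rule: polys_induct) (simp_all add: mult_single h_mult mon_add ev_add algebra_simps)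
  qed (simp_all add: ev_add distrib_right)
qed

lemma ev_deriv_mult:
  "ev_deriv i h (p * q) x = ev_deriv i h p x * ev h q x + ev h p x * ev_deriv i h q x"
proof -
  have "p \<in> polys UNIV" "q \<in> polys UNIV" by simp_all
  then show ?thesis
  proof (induction p rule: polys_induct)
    case (single m c)
    from single(2) show ?case
      by (induction q rule: polys_induct)
        (simp_all add: mult_single h_mult dmon_add ev_add ev_deriv_add ev_deriv_single algebra_simps)
  qed (simp_all add: ev_add ev_deriv_add algebra_simps)
qed

lemma ev_diff: "ev h (p - q) x = ev h p x - ev h q x"
  using ev_add[of "p - q" q x] by simp

lemma ev_deriv_diff: "ev_deriv i h (p - q) x = ev_deriv i h p x - ev_deriv i h q x"
  using ev_deriv_add[of i "p - q" q x] by simp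

lemma ev_power: "ev h (p ^ n) x = ev h p x ^ n"
  by (induction n) (simp_all add: ev_mult)

end

lemma map_hom_add:
  assumes "coeff_hom h"
  shows "Poly_Mapping.map h (p + q) = Poly_Mapping.map h p + Poly_Mapping.map h (q :: 'a::comm_ring_1 mpol)"
proof -
  interpret coeff_hom h by fact
  have look: "Poly_Mapping.lookup (Poly_Mapping.map h r) k = h (Poly_Mapping.lookup r k)" for r k
    by (simp add: Poly_Mapping.map.rep_eq when_def)
  show ?thesis by (rule poly_mapping_eqI) (simp add: look lookup_add h_add)
qed

lemma map_hom_mult:
  assumes "coeff_hom h"
  shows "Poly_Mapping.map h (p * q) = Poly_Mapping.map h p * Poly_Mapping.map h (q :: 'a::comm_ring_1 mpol)"
proof -
  interpret coeff_hom h by fact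
  have sing: "Poly_Mapping.map h (Poly_Mapping.single m c) = Poly_Mapping.single m (h c)" for m :: "nat \<Rightarrow>\<^sub>0 nat" and c
    by (rule poly_mapping_eqI) (simp add: Poly_Mapping.map.rep_eq lookup_single when_def)
  have z: "Poly_Mapping.map h (0 :: 'a mpol) = 0"
    by (rule poly_mapping_eqI) (simp add: Poly_Mapping.map.rep_eq)
  have "p \<in> polys UNIV" "q \<in> polys UNIV" by simp_all
  then show ?thesis
  proof (induction p rule: polys_induct)
    case (single m c)
    from single(2) show ?case
      by (induction q rule: polys_induct)
        (simp_all add: z sing mult_single h_mult map_hom_add[OF assms] algebra_simps)
  qed (simp_all add: z map_hom_add[OF assms] distrib_right)
qed

section \<open>Plane polynomials and polynomials in one variable\<close>

definition X0 :: "'a::comm_ring_1 mpol" where "X0 = Poly_Mapping.single (Poly_Mapping.single 0 1) 1"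
definition X1 :: "'a::comm_ring_1 mpol" where "X1 = Poly_Mapping.single (Poly_Mapping.single 1 1) 1"

text \<open>Substitutes \<open>X0\<close> for the variable, so that arithmetic in \<open>t\<close>
  can be done with one-variable polynomials, which have degrees and root multiplicities.\<close>

definition uni :: "'a::comm_ring_1 poly \<Rightarrow> 'a mpol" where
  "uni q = poly (map_poly (Poly_Mapping.single 0) q) X0"

lemma coeff_hom_single: "coeff_hom (Poly_Mapping.single 0 :: 'a::comm_ring_1 \<Rightarrow> 'a mpol)"
  by unfold_locales (simp_all add: single_add mult_single)

interpretation const: coeff_hom "Poly_Mapping.single 0 :: 'a::comm_ring_1 \<Rightarrow> 'a mpol"
  by (rule coeff_hom_single)

lemma uni_zero [simp]: "uni 0 = 0"
  by (simp add: uni_def)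

lemma uni_pCons: "uni (pCons a q) = Poly_Mapping.single 0 a + X0 * uni q"
  by (simp add: uni_def)

lemma uni_one [simp]: "uni 1 = 1"
  unfolding one_pCons uni_pCons by simp

lemma uni_add: "uni (p + q) = uni p + uni q"
  by (simp add: uni_def const.map_poly_hom_add)

lemma uni_mult: "uni (p * q) = uni p * uni q"
  by (simp add: uni_def const.map_poly_hom_mult)

lemma uni_power: "uni (p ^ n) = uni p ^ n"
  by (induction n) (simp_all add: uni_mult)

lemma X0_power: "X0 ^ i = Poly_Mapping.single (Poly_Mapping.single 0 i) 1"
  by (induction i) (simp_all add: X0_def mult_single flip: single_add)

lemma X1_power: "X1 ^ i = Poly_Mapping.single (Poly_Mapping.single 1 i) 1"
  by (induction i) (simp_all add: X1_def mult_single flip: single_add)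

lemma uni_monom: "uni (Polynomial.monom c i) = Poly_Mapping.single (Poly_Mapping.single 0 i) c"
proof -
  have "map_poly (Poly_Mapping.single 0) (Polynomial.monom c i) = Polynomial.monom (Poly_Mapping.single 0 c :: 'a mpol) i"
    by (rule poly_eqI) (simp add: coeff_map_poly)
  then show ?thesis by (simp add: uni_def poly_monom X0_power mult_single)
qed

lemma X0_polys: "0 \<in> J \<Longrightarrow> X0 \<in> polys J" and X1_polys: "1 \<in> J \<Longrightarrow> X1 \<in> polys J"
  by (auto simp: X0_def X1_def intro!: polys_single)

lemma uni_polys: "0 \<in> J \<Longrightarrow> uni q \<in> polys J"
  by (induction q) (auto simp: uni_pCons intro!: polys_add polys_mult polys_single X0_polys)

lemma uni_eq_0:
  assumes "uni q = 0"
  shows "q = 0"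
proof (rule poly_eqI)
  fix i
  have "uni q = (\<Sum>j\<le>Polynomial.degree q. uni (Polynomial.monom (Polynomial.coeff q j) j))"
  proof -
    have s: "uni (sum g A) = (\<Sum>a\<in>A. uni (g a))" for g :: "nat \<Rightarrow> 'a poly" and A
      by (induction A rule: infinite_finite_induct) (simp_all add: uni_add)
    show ?thesis by (subst poly_as_sum_of_monoms[of q, symmetric]) (rule s)
  qed
  then have "Poly_Mapping.lookup (uni q) (Poly_Mapping.single 0 i) =
      (\<Sum>j\<le>Polynomial.degree q. Polynomial.coeff q j when j = i)"
    by (simp add: uni_monom lookup_sum lookup_single inj_eq[OF inj_single])
  also have "\<dots> = Polynomial.coeff q i" by (cases "i \<le> Polynomial.degree q") (auto simp: when_def coeff_eq_0)
  finally show "Polynomial.coeff q i = Polynomial.coeff 0 i" using assms by simp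
qed

lemma (in coeff_hom) ev_uni: "ev h (uni q) x = poly (map_poly h q) (x 0)"
proof (induction q)
  case (pCons a q)
  have "ev h X0 x = x 0" by (simp add: X0_def mon_def)
  then show ?case using pCons by (simp add: uni_pCons ev_add ev_mult)
qed simp

lemma (in coeff_hom) ev_X1: "ev h X1 x = x 1"
  by (simp add: X1_def mon_def)

lemma (in coeff_hom) map_uni: "Poly_Mapping.map h (uni q) = uni (map_poly h q)"
proof (induction q)
  case 0
  show ?case by (simp add: poly_mapping_eq_iff fun_eq_iff Poly_Mapping.map.rep_eq)
next
  case (pCons a q)
  have "Poly_Mapping.map h (Poly_Mapping.single m c) = Poly_Mapping.single m (h c)" for m :: "nat \<Rightarrow>\<^sub>0 nat" and c
    by (rule poly_mapping_eqI) (simp add: Poly_Mapping.map.rep_eq lookup_single when_def)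
  then show ?case using pCons
    by (simp add: uni_pCons map_hom_add[OF coeff_hom_axioms] map_hom_mult[OF coeff_hom_axioms] X0_def)
qed

lemma polys_0_uni:
  assumes "p \<in> polys {0}"
  obtains q where "p = uni q"
proof -
  have "\<exists>q. p = uni q" using assms
  proof (induction p rule: polys_induct)
    case (single m c)
    have "m = Poly_Mapping.single 0 (Poly_Mapping.lookup m 0)"
      by (rule poly_mapping_eqI) (use single in \<open>auto simp: lookup_single when_def in_keys_iff\<close>)
    then show ?case using uni_monom by metis
  next
    case (add p q)
    then show ?case using uni_add by metis
  qed (use uni_zero in metis)
  then show ?thesis using that by blast
qed

section \<open>The curve \<open>u\<^sup>2 D(t) = 1\<close>\<close>

lemma coeff_hom_to_ac: "coeff_hom (to_ac :: 'f::field \<Rightarrow> _)"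
  by unfold_locales simp_all

interpretation ac: coeff_hom "to_ac :: 'f::field \<Rightarrow> _"
  by (rule coeff_hom_to_ac)

lemma coeff_hom_emb: "coeff_hom (emb :: 'f::field \<Rightarrow> _)"
  by unfold_locales
    (simp_all add: emb_def single_add mult_single One_fract_def Zero_fract_def flip: to_ac_add to_ac_mult)

interpretation emb: coeff_hom "emb :: 'f::field \<Rightarrow> _"
  by (rule coeff_hom_emb)

lemma emb_eq_0_iff: "emb (c :: 'f::field) = 0 \<longleftrightarrow> c = 0"
proof
  assume z: "emb c = 0"
  show "c = 0"
  proof (rule ccontr)
    assume "c \<noteq> 0"
    then have "emb c * emb (inverse c) = 1" by (simp flip: emb.h_mult)
    then show False using z by simp
  qed
qed simp

lemma emb_2_neq_0: "(2 :: 'f::field_char_0 univ_dom) \<noteq> 0"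
proof -
  have "emb (1 + 1 :: 'f) = 1 + 1" unfolding emb.h_add by simp
  then show ?thesis using emb_eq_0_iff[of "1 + 1 :: 'f"] by simp
qed

definition generic_t :: "'f::field univ_dom" where
  "generic_t = to_ac (Fract X0 1)"

lemma poly_generic_t: "poly (map_poly emb q) generic_t = to_ac (Fract (uni q) 1)"
proof (induction q)
  case (pCons a q)
  have "poly (map_poly emb (pCons a q)) generic_t = emb a + generic_t * to_ac (Fract (uni q) 1)"
    using pCons.IH by simp
  also have "\<dots> = to_ac (Fract (uni (pCons a q)) 1)"
    by (simp add: uni_pCons generic_t_def emb_def flip: to_ac_add to_ac_mult)
  finally show ?case .
qed (simp add: Zero_fract_def[symmetric])

lemma generic_t_transcendental: "poly (map_poly emb q) generic_t = 0 \<Longrightarrow> q = 0"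
  by (rule uni_eq_0) (simp add: poly_generic_t Zero_fract_def eq_fract)

text \<open>\<open>X0\<close> is \<open>t\<close>, and \<open>X1\<close> is the inverse of
  \<open>w\<close> in w^2 = D(t). Using the inverse as a coordinate removes the points with w = 0
  and keeps the model a plane affine curve.\<close>

definition curve_eq :: "'a::comm_ring_1 poly \<Rightarrow> 'a mpol" where
  "curve_eq D = X1 ^ 2 * uni D - 1"

lemma curve_eq_polys: "curve_eq D \<in> polys {..<2}"
  unfolding curve_eq_def by (intro polys_diff polys_mult polys_power X1_polys uni_polys) simp_all

lemma (in coeff_hom) ev_curve_eq: "ev h (curve_eq D) y = y 1 ^ 2 * poly (map_poly h D) (y 0) - 1"
  by (simp add: curve_eq_def ev_diff ev_mult ev_power ev_X1 ev_uni)

text \<open>Modulo the equation, \<open>uni D\<close> is inverse to \<open>X1\<^sup>2\<close>; clearing denominators leaves degree at most 1 in \<open>X1\<close>.\<close>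

definition reducible_mod :: "'a::comm_ring_1 poly \<Rightarrow> 'a mpol \<Rightarrow> bool" where
  "reducible_mod D p \<longleftrightarrow> (\<exists>k a b r. r \<in> polys {..<2} \<and> uni D ^ k * p = uni a + uni b * X1 + r * curve_eq D)"

lemma reducible_mod_uni_mult:
  assumes "reducible_mod D p"
  shows "reducible_mod D (uni c * p)"
proof -
  obtain k a b r where r: "r \<in> polys {..<2}" and *: "uni D ^ k * p = uni a + uni b * X1 + r * curve_eq D"
    using assms by (auto simp: reducible_mod_def)
  have "uni D ^ k * (uni c * p) = uni c * (uni D ^ k * p)" by (simp add: algebra_simps)
  also have "\<dots> = uni (c * a) + uni (c * b) * X1 + (uni c * r) * curve_eq D"
    unfolding * uni_mult by (simp add: algebra_simps)
  finally have eq: "uni D ^ k * (uni c * p) = uni (c * a) + uni (c * b) * X1 + (uni c * r) * curve_eq D" .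
  have "uni c * r \<in> polys {..<2}" using r by (intro polys_mult uni_polys) auto
  with eq show ?thesis unfolding reducible_mod_def by blast
qed

lemma reducible_mod_X1_power: "reducible_mod D (X1 ^ j)"
proof (induction j rule: induct_nat_012)
  case 0
  show ?case unfolding reducible_mod_def
    by (rule exI[of _ 0], rule exI[of _ 1], rule exI[of _ 0], rule exI[of _ 0]) simp
next
  case 1
  show ?case unfolding reducible_mod_def
    by (rule exI[of _ 0], rule exI[of _ 0], rule exI[of _ 1], rule exI[of _ 0]) simp
next
  case (ge2 j)
  then obtain k a b r where r: "r \<in> polys {..<2}" and *: "uni D ^ k * X1 ^ j = uni a + uni b * X1 + r * curve_eq D"
    by (auto simp: reducible_mod_def)
  have DX: "uni D * X1 ^ 2 = curve_eq D + 1" by (simp add: curve_eq_def mult.commute)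
  have "uni D ^ Suc k * X1 ^ Suc (Suc j) = (uni D * X1 ^ 2) * (uni D ^ k * X1 ^ j)"
    by (simp add: power2_eq_square algebra_simps)
  also have "\<dots> = uni a + uni b * X1 + (r + (uni a + uni b * X1 + r * curve_eq D)) * curve_eq D"
    unfolding * DX by (simp add: algebra_simps)
  finally have eq: "uni D ^ Suc k * X1 ^ Suc (Suc j) =
      uni a + uni b * X1 + (r + (uni a + uni b * X1 + r * curve_eq D)) * curve_eq D" .
  have "r + (uni a + uni b * X1 + r * curve_eq D) \<in> polys {..<2}"
    using r by (intro polys_add polys_mult uni_polys X1_polys curve_eq_polys) auto
  with eq show ?case unfolding reducible_mod_def by blast
qed

lemma reducible_mod_add:
  assumes "reducible_mod D p" "reducible_mod D q"
  shows "reducible_mod D (p + q)"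
proof -
  obtain k a b r where r: "r \<in> polys {..<2}" and *: "uni D ^ k * p = uni a + uni b * X1 + r * curve_eq D"
    using assms(1) by (auto simp: reducible_mod_def)
  obtain l c d s where s: "s \<in> polys {..<2}" and **: "uni D ^ l * q = uni c + uni d * X1 + s * curve_eq D"
    using assms(2) by (auto simp: reducible_mod_def)
  have "uni D ^ (k + l) * (p + q) = uni D ^ l * (uni D ^ k * p) + uni D ^ k * (uni D ^ l * q)"
    by (simp add: power_add algebra_simps)
  also have "\<dots> = uni (D ^ l * a + D ^ k * c) + uni (D ^ l * b + D ^ k * d) * X1 +
      (uni D ^ l * r + uni D ^ k * s) * curve_eq D"
    unfolding * ** by (simp add: uni_add uni_mult uni_power algebra_simps)
  finally have eq: "uni D ^ (k + l) * (p + q) = uni (D ^ l * a + D ^ k * c) + uni (D ^ l * b + D ^ k * d) * X1 +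
      (uni D ^ l * r + uni D ^ k * s) * curve_eq D" .
  have "uni D ^ l * r + uni D ^ k * s \<in> polys {..<2}"
    using r s by (intro polys_add polys_mult polys_power uni_polys) auto
  with eq show ?thesis unfolding reducible_mod_def by blast
qed

lemma reducible_mod_polys:
  assumes "p \<in> polys {..<2}"
  shows "reducible_mod D p"
  using assms
proof (induction p rule: polys_induct)
  case zero
  show ?case using reducible_mod_uni_mult[OF reducible_mod_X1_power, of D 0 0] by simp
next
  case (single m c)
  have "m = Poly_Mapping.single 0 (Poly_Mapping.lookup m 0) + Poly_Mapping.single 1 (Poly_Mapping.lookup m 1)"
  proof (rule poly_mapping_eqI)
    fix k :: nat
    consider "k = 0" | "k = 1" | "k \<ge> 2" by linarith
    then show "Poly_Mapping.lookup m k = Poly_Mapping.lookup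
      (Poly_Mapping.single 0 (Poly_Mapping.lookup m 0) + Poly_Mapping.single 1 (Poly_Mapping.lookup m 1)) k"
    proof cases
      case 3
      then have "k \<notin> Poly_Mapping.keys m" using single by auto
      then show ?thesis using 3 by (simp add: lookup_add lookup_single in_keys_iff)
    qed (simp_all add: lookup_add lookup_single)
  qed
  then have "Poly_Mapping.single m c =
      uni (Polynomial.monom c (Poly_Mapping.lookup m 0)) * X1 ^ Poly_Mapping.lookup m 1"
    by (simp add: uni_monom X1_power mult_single)
  then show ?case using reducible_mod_uni_mult[OF reducible_mod_X1_power] by metis
next
  case (add p q)
  then show ?case by (rule reducible_mod_add)
qed

text \<open>Over a field: \<open>D\<close> is not a square of a rational function, with denominators
  cleared. It excludes D = 0, for which \<open>a\<close> could be arbitrary.\<close>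

definition nonsquare :: "'a::comm_ring_1 poly \<Rightarrow> bool" where
  "nonsquare D \<longleftrightarrow> (\<forall>a b. a ^ 2 * D = b ^ 2 \<longrightarrow> a = 0 \<and> b = 0)"

definition generic_point :: "'f::field poly \<Rightarrow> nat \<Rightarrow> 'f univ_dom" where
  "generic_point D i = (if i = 0 then generic_t else
     (SOME u. u ^ 2 * poly (map_poly emb D) generic_t = 1))"

lemma nonsquare_neq_0: "nonsquare (D :: 'a::field poly) \<Longrightarrow> D \<noteq> 0"
  unfolding nonsquare_def by (metis mult_zero_right one_neq_zero zero_power2)

lemma generic_point_curve:
  assumes D: "nonsquare (D :: 'f::field poly)"
  shows "generic_point D 1 ^ 2 * poly (map_poly emb D) (generic_point D 0) = 1"
proof -
  define d where "d = poly (map_poly emb D) (generic_t :: 'f univ_dom)"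
  have d0: "d \<noteq> 0" using generic_t_transcendental[of D] nonsquare_neq_0[OF D] by (auto simp: d_def)
  obtain u where "u ^ 2 = inverse d" using nth_root_exists[of 2 "inverse d"] by auto
  then have "u ^ 2 * d = 1" using d0 by simp
  then have "(SOME u. u ^ 2 * d = 1) ^ 2 * d = 1" by (rule someI)
  then show ?thesis by (simp add: generic_point_def d_def)
qed

text \<open>A polynomial reduced to a(t) + b(t) u that vanishes at the generic point satisfies a = -
  b u, hence a^2 D = b^2 as u^2 D = 1. So a = b = 0 by \<open>nonsquare\<close>, and only the power
  of \<open>D\<close> introduced by the reduction is left to remove.\<close>

lemma chart_ideal_curve:
  assumes D: "nonsquare (D :: 'f::field poly)"
  shows "chart_ideal 2 (generic_point D) = {r * curve_eq D | r. r \<in> polys {..<2}}"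
proof
  let ?x = "generic_point D"
  have g0: "ev emb (curve_eq D) ?x = 0" using generic_point_curve[OF D] by (simp add: emb.ev_curve_eq)
  show "{r * curve_eq D | r. r \<in> polys {..<2}} \<subseteq> chart_ideal 2 ?x"
    using g0 by (auto simp: chart_ideal_def emb.ev_mult intro!: polys_mult curve_eq_polys)
  show "chart_ideal 2 ?x \<subseteq> {r * curve_eq D | r. r \<in> polys {..<2}}"
  proof
    fix p assume "p \<in> chart_ideal 2 ?x"
    then have p: "p \<in> polys {..<2}" and p0: "ev emb p ?x = 0" by (auto simp: chart_ideal_def)
    obtain k a b r where r: "r \<in> polys {..<2}" and *: "uni D ^ k * p = uni a + uni b * X1 + r * curve_eq D"
      using reducible_mod_polys[OF p] unfolding reducible_mod_def by blast
    define t :: "'f univ_dom" where "t = generic_t"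
    define u where "u = ?x 1"
    have x0: "?x 0 = t" by (simp add: generic_point_def t_def)
    have ud: "u ^ 2 * poly (map_poly emb D) t = 1" using generic_point_curve[OF D] by (simp add: u_def x0)
    have "ev emb (uni D ^ k * p) ?x = poly (map_poly emb a) t + poly (map_poly emb b) t * u"
      unfolding * by (simp add: emb.ev_add emb.ev_mult emb.ev_uni emb.ev_X1 g0 x0 u_def)
    then have "poly (map_poly emb a) t = - (poly (map_poly emb b) t * u)"
      using p0 by (simp add: emb.ev_mult eq_neg_iff_add_eq_0)
    then have "poly (map_poly emb a) t ^ 2 * poly (map_poly emb D) t =
        poly (map_poly emb b) t ^ 2 * (u ^ 2 * poly (map_poly emb D) t)"
      by (simp add: power2_eq_square algebra_simps)
    also have "\<dots> = poly (map_poly emb b) t ^ 2" unfolding ud by simp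
    finally have "poly (map_poly emb (a ^ 2 * D - b ^ 2)) t = 0"
      by (simp add: emb.map_poly_hom_diff emb.map_poly_hom_mult power2_eq_square)
    then have "a ^ 2 * D = b ^ 2" using generic_t_transcendental[of "a ^ 2 * D - b ^ 2"] by (simp add: t_def)
    then have "a = 0" "b = 0" using D by (auto simp: nonsquare_def)
    then have red: "uni D ^ k * p = r * curve_eq D" using * by simp
    \<comment> \<open>\<open>uni D\<close> is invertible modulo the equation, with inverse
      X1^2.\<close>
    have "\<exists>s\<in>polys {..<2}. (X1 ^ 2 * uni D) ^ k = 1 + s * curve_eq D"
    proof (induction k)
      case 0
      show ?case by (rule bexI[of _ 0]) simp_all
    next
      case (Suc k)
      then obtain s where s: "s \<in> polys {..<2}" "(X1 ^ 2 * uni D) ^ k = 1 + s * curve_eq D" by blast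
      have "(X1 ^ 2 * uni D) ^ Suc k = (curve_eq D + 1) * (1 + s * curve_eq D)"
        using s by (simp add: curve_eq_def)
      also have "\<dots> = 1 + (1 + s * curve_eq D + s) * curve_eq D" by (simp add: algebra_simps)
      finally have eq: "(X1 ^ 2 * uni D) ^ Suc k = 1 + (1 + s * curve_eq D + s) * curve_eq D" .
      have "1 + s * curve_eq D + s \<in> polys {..<2}" by (intro polys_add polys_mult curve_eq_polys polys_one s(1))
      with eq show ?case by blast
    qed
    then obtain s where s: "s \<in> polys {..<2}" "(X1 ^ 2 * uni D) ^ k = 1 + s * curve_eq D" by blast
    have "(1 + s * curve_eq D) * p = (X1 ^ 2) ^ k * (uni D ^ k * p)"
      unfolding s(2)[symmetric] power_mult_distrib by (simp only: mult.assoc)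
    also have "\<dots> = (X1 ^ 2) ^ k * r * curve_eq D" unfolding red by (simp only: mult.assoc)
    finally have "p = ((X1 ^ 2) ^ k * r - s * p) * curve_eq D" by (simp add: algebra_simps)
    moreover have "(X1 ^ 2) ^ k * r - s * p \<in> polys {..<2}"
      using r s p by (intro polys_diff polys_mult polys_power X1_polys) auto
    ultimately show "p \<in> {r * curve_eq D | r. r \<in> polys {..<2}}" by blast
  qed
qed

section \<open>Integrality and smoothness of the curve\<close>

lemma chart_ideal_mult:
  assumes "a * b \<in> chart_ideal n x" "a \<in> polys {..<n}" "b \<in> polys {..<n}"
  shows "a \<in> chart_ideal n x \<or> b \<in> chart_ideal n x"
  using assms by (auto simp: chart_ideal_def emb.ev_mult)

text \<open>Both ideals are generated by the curve equation. The right-hand one is the vanishing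
  ideal of a point over the algebraic closure, hence prime, so geometric integrality reduces to
  \<open>nonsquare\<close> over that closure.\<close>

lemma geometric_ideal_curve:
  assumes D: "nonsquare (D :: 'f::field poly)" and D': "nonsquare (map_poly to_ac D)"
  shows "geometric_ideal 2 (generic_point D) = chart_ideal 2 (generic_point (map_poly to_ac D))"
proof -
  have map_g: "Poly_Mapping.map to_ac (curve_eq D) = curve_eq (map_poly to_ac D)"
  proof -
    have 1: "Poly_Mapping.map to_ac (Poly_Mapping.single m c) = Poly_Mapping.single m (to_ac c)"
      for m :: "nat \<Rightarrow>\<^sub>0 nat" and c :: 'f
      by (rule poly_mapping_eqI) (simp add: Poly_Mapping.map.rep_eq lookup_single when_def)
    have "curve_eq D + 1 = X1 * X1 * uni D" by (simp add: curve_eq_def power2_eq_square)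
    then have "Poly_Mapping.map to_ac (curve_eq D) + Poly_Mapping.map to_ac 1 =
        Poly_Mapping.map to_ac X1 * Poly_Mapping.map to_ac X1 * Poly_Mapping.map to_ac (uni D)"
      by (metis map_hom_add[OF coeff_hom_to_ac] map_hom_mult[OF coeff_hom_to_ac])
    moreover have "Poly_Mapping.map to_ac (X1 :: 'f mpol) = X1" by (simp add: X1_def 1)
    moreover have "Poly_Mapping.map to_ac (1 :: 'f mpol) = 1" using 1[of 0 1] by simp
    ultimately have "Poly_Mapping.map to_ac (curve_eq D) + 1 = X1 * X1 * uni (map_poly to_ac D)"
      by (simp add: ac.map_uni)
    then show ?thesis by (simp add: curve_eq_def power2_eq_square algebra_simps)
  qed
  have map_polys: "Poly_Mapping.map to_ac r \<in> polys {..<2}" if "r \<in> polys {..<2}" for r :: "'f mpol"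
    using that by (auto simp: polys_def in_keys_iff Poly_Mapping.map.rep_eq when_def)
  show ?thesis
    unfolding chart_ideal_curve[OF D']
  proof
    show "geometric_ideal 2 (generic_point D) \<subseteq> {r * curve_eq (map_poly to_ac D) | r. r \<in> polys {..<2}}"
    proof
      fix q assume "q \<in> geometric_ideal 2 (generic_point D)"
      then have "\<exists>(n::nat) g p. q = (\<Sum>k<n. g k * Poly_Mapping.map to_ac (p k)) \<and>
          (\<forall>k<n. g k \<in> polys {..<2} \<and> p k \<in> chart_ideal 2 (generic_point D))"
        unfolding geometric_ideal_def mem_Collect_eq .
      then obtain n :: nat and g p where q: "q = (\<Sum>k<n. g k * Poly_Mapping.map to_ac (p k))"
        and "\<forall>k<n. g k \<in> polys {..<2} \<and> p k \<in> chart_ideal 2 (generic_point D)"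
        by (elim exE conjE)
      then have gp: "\<And>k. k < n \<Longrightarrow> g k \<in> polys {..<2}"
        "\<And>k. k < n \<Longrightarrow> p k \<in> chart_ideal 2 (generic_point D)" by simp_all
      have "\<exists>r\<in>polys {..<2}. g k * Poly_Mapping.map to_ac (p k) = r * curve_eq (map_poly to_ac D)" if k: "k < n" for k
      proof -
        from gp(2)[OF k] obtain r where r: "r \<in> polys {..<2}" "p k = r * curve_eq D"
          unfolding chart_ideal_curve[OF D] by blast
        have "g k * Poly_Mapping.map to_ac (p k) = (g k * Poly_Mapping.map to_ac r) * curve_eq (map_poly to_ac D)"
          unfolding r(2) map_hom_mult[OF coeff_hom_to_ac] map_g by (simp only: mult.assoc)
        then show ?thesis using polys_mult[OF gp(1)[OF k] map_polys[OF r(1)]] by blast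
      qed
      then obtain r where r: "\<And>k. k < n \<Longrightarrow> r k \<in> polys {..<2}"
        "\<And>k. k < n \<Longrightarrow> g k * Poly_Mapping.map to_ac (p k) = r k * curve_eq (map_poly to_ac D)" by metis
      have "q = (\<Sum>k<n. r k) * curve_eq (map_poly to_ac D)"
        unfolding q sum_distrib_right by (rule sum.cong) (auto simp: r)
      moreover have "(\<Sum>k<n. r k) \<in> polys {..<2}" by (rule polys_sum) (auto simp: r)
      ultimately show "q \<in> {r * curve_eq (map_poly to_ac D) | r. r \<in> polys {..<2}}" by blast
    qed
  next
    show "{r * curve_eq (map_poly to_ac D) | r. r \<in> polys {..<2}} \<subseteq> geometric_ideal 2 (generic_point D)"
    proof
      fix q assume "q \<in> {r * curve_eq (map_poly to_ac D) | r. r \<in> polys {..<2}}"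
      then obtain r where r: "r \<in> polys {..<2}" "q = r * curve_eq (map_poly to_ac D)" by blast
      have "curve_eq D = 1 * curve_eq D" by simp
      then have "curve_eq D \<in> chart_ideal 2 (generic_point D)"
        unfolding chart_ideal_curve[OF D] using polys_one by blast
      then show "q \<in> geometric_ideal 2 (generic_point D)"
        unfolding geometric_ideal_def using r
        by (intro CollectI exI[of _ "1::nat"] exI[of _ "\<lambda>_. r"] exI[of _ "\<lambda>_. curve_eq D"]) (simp add: map_g)
    qed
  qed
qed

lemma geometrically_integral_curve:
  assumes D: "nonsquare (D :: 'f::field poly)" and D': "nonsquare (map_poly to_ac D)"
  shows "geometrically_integral {(2, generic_point D)}"
  unfolding geometrically_integral_def geometric_ideal_curve[OF assms]
  using chart_ideal_mult[of _ _ 2 "generic_point (map_poly to_ac D)"]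
  by (auto simp: geometric_ideal_curve[OF assms] chart_ideal_def)

text \<open>At a point (t, u) the derivative in u is 2 u D(t), which is nonzero because u (u D(t)) =
  1. So the tangent space is a line everywhere, spanned by (1, - A / B).\<close>

lemma smooth_curve:
  assumes D: "nonsquare (D :: 'f::field_char_0 poly)"
  shows "smooth_variety {(2, generic_point D)}"
proof -
  interpret vs: vector_space "scale_vec :: 'f univ_dom \<Rightarrow> _" by (rule vector_space_scale_vec)
  have two: "{..<2} = {0, 1::nat}" by auto
  have dim1: "chart_dim 2 (generic_point D) = 1"
  proof -
    have "card J \<le> 1" if J: "J \<subseteq> {..<2}" "alg_independent J (generic_point D)" for J
    proof (rule ccontr)
      assume "\<not> card J \<le> 1"
      moreover have "card J \<le> 2" using card_mono[of "{..<2}" J] J(1) by simp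
      ultimately have "J = {..<2}" using J(1) by (intro card_subset_eq) auto
      moreover have "ev emb (curve_eq D) (generic_point D) = 0"
        using generic_point_curve[OF D] by (simp add: emb.ev_curve_eq)
      ultimately have "curve_eq D = 0" using J(2) curve_eq_polys unfolding alg_independent_def by blast
      \<comment> \<open>The equation has value -1 at the origin, so it is a nontrivial relation
        between the two coordinates.\<close>
      then have "ev emb (curve_eq D) (\<lambda>_. 0) = 0" by simp
      then show False by (simp add: emb.ev_curve_eq)
    qed
    moreover have "alg_independent {0} (generic_point D)"
      unfolding alg_independent_def
    proof (intro ballI impI)
      fix p :: "'f mpol" assume p: "p \<in> polys {0}" "ev emb p (generic_point D) = 0"
      obtain q where q: "p = uni q" using polys_0_uni[OF p(1)] .
      have "poly (map_poly emb q) generic_t = 0"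
        using p(2) unfolding q emb.ev_uni by (simp add: generic_point_def)
      then have "q = 0" by (rule generic_t_transcendental)
      then show "p = 0" by (simp add: q)
    qed
    ultimately show ?thesis unfolding chart_dim_def
      by (intro Max_eqI) (auto intro!: exI[of _ "{0}"] finite_subset[of _ "card ` Pow {..<2::nat}"])
  qed
  have "vs.dim (tangent_space 2 (generic_point D) y) = 1" if y: "y \<in> chart_points 2 (generic_point D)" for y
  proof -
    define A where "A = ev_deriv 0 emb (curve_eq D) y"
    define B where "B = ev_deriv 1 emb (curve_eq D) y"
    have "1 * curve_eq D \<in> chart_ideal 2 (generic_point D)" unfolding chart_ideal_curve[OF D] using polys_one by blast
    then have g0: "ev emb (curve_eq D) y = 0" using y by (simp add: chart_points_def)
    then have y1: "y 1 * (y 1 * poly (map_poly emb D) (y 0)) = 1"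
      by (simp add: emb.ev_curve_eq power2_eq_square mult.assoc)
    have "B = 2 * (y 1 * poly (map_poly emb D) (y 0))"
    proof -
      have "ev_deriv 1 emb p y = 0" if "p \<in> polys {0}" for p :: "'f mpol"
        using that
      proof (induction p rule: polys_induct)
        case (single m c)
        then have "Poly_Mapping.lookup m 1 = 0" by (metis in_keys_iff singletonD subsetD zero_neq_one)
        then show ?case by (simp add: emb.ev_deriv_single dmon_def)
      qed (simp_all add: emb.ev_deriv_add)
      then have "ev_deriv 1 emb (uni D) y = 0" "ev_deriv 1 emb 1 y = 0" by (simp_all add: uni_polys)
      moreover have "ev_deriv 1 emb X1 y = 1" by (simp add: X1_def emb.ev_deriv_single dmon_def)
      ultimately show ?thesis
        by (simp add: B_def curve_eq_def power2_eq_square emb.ev_deriv_diff emb.ev_deriv_mult emb.ev_mult emb.ev_X1 emb.ev_uni)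
    qed
    then have B0: "B \<noteq> 0" using y1 emb_2_neq_0 by auto
    have tangent: "tangent_space 2 (generic_point D) y =
        {v. Poly_Mapping.keys v \<subseteq> {..<2} \<and> A * Poly_Mapping.lookup v 0 + B * Poly_Mapping.lookup v 1 = 0}"
    proof -
      have "(\<forall>p\<in>chart_ideal 2 (generic_point D). (\<Sum>i<2. ev_deriv i emb p y * Poly_Mapping.lookup v i) = 0) \<longleftrightarrow>
          A * Poly_Mapping.lookup v 0 + B * Poly_Mapping.lookup v 1 = 0" for v
      proof
        assume *: "\<forall>p\<in>chart_ideal 2 (generic_point D). (\<Sum>i<2. ev_deriv i emb p y * Poly_Mapping.lookup v i) = 0"
        show "A * Poly_Mapping.lookup v 0 + B * Poly_Mapping.lookup v 1 = 0"
          using bspec[OF * \<open>1 * curve_eq D \<in> _\<close>] by (simp add: two A_def B_def)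
      next
        assume *: "A * Poly_Mapping.lookup v 0 + B * Poly_Mapping.lookup v 1 = 0"
        show "\<forall>p\<in>chart_ideal 2 (generic_point D). (\<Sum>i<2. ev_deriv i emb p y * Poly_Mapping.lookup v i) = 0"
        proof
          fix p assume "p \<in> chart_ideal 2 (generic_point D)"
          then obtain r where r: "p = r * curve_eq D" unfolding chart_ideal_curve[OF D] by blast
          have "(\<Sum>i<2. ev_deriv i emb p y * Poly_Mapping.lookup v i) =
              ev emb r y * (A * Poly_Mapping.lookup v 0 + B * Poly_Mapping.lookup v 1)"
            by (simp add: two r emb.ev_deriv_mult g0 A_def B_def algebra_simps)
          then show "(\<Sum>i<2. ev_deriv i emb p y * Poly_Mapping.lookup v i) = 0" using * by simp
        qed
      qed
      then show ?thesis unfolding tangent_space_def by simp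
    qed
    define w :: "nat \<Rightarrow>\<^sub>0 'f univ_dom" where "w = Poly_Mapping.single 0 1 + Poly_Mapping.single 1 (- A / B)"
    have w: "Poly_Mapping.lookup w 0 = 1" "Poly_Mapping.lookup w 1 = - A / B"
      by (simp_all add: w_def lookup_add lookup_single lookup_one)
    have wk: "Poly_Mapping.keys w \<subseteq> {..<2}"
      unfolding w_def by (rule order.trans[OF Poly_Mapping.keys_add]) (auto split: if_splits)
    show ?thesis
    proof (rule vs.dim_unique[of "{w}"])
      show "{w} \<subseteq> tangent_space 2 (generic_point D) y" using w wk B0 by (simp add: tangent)
      show "tangent_space 2 (generic_point D) y \<subseteq> vs.span {w}"
      proof
        fix v assume "v \<in> tangent_space 2 (generic_point D) y"
        then have v: "Poly_Mapping.keys v \<subseteq> {..<2}" "A * Poly_Mapping.lookup v 0 + B * Poly_Mapping.lookup v 1 = 0"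
          by (simp_all add: tangent)
        have "v = scale_vec (Poly_Mapping.lookup v 0) w"
        proof (rule poly_mapping_eqI)
          fix k :: nat
          consider "k = 0" | "k = 1" | "k \<ge> 2" by linarith
          then show "Poly_Mapping.lookup v k = Poly_Mapping.lookup (scale_vec (Poly_Mapping.lookup v 0) w) k"
          proof cases
            case 2
            have "B * Poly_Mapping.lookup v 1 = - (A * Poly_Mapping.lookup v 0)"
              using v(2) by (simp add: eq_neg_iff_add_eq_0 add.commute)
            then have v1: "Poly_Mapping.lookup v 1 = - (A * Poly_Mapping.lookup v 0) / B"
              using B0 by (metis nonzero_mult_div_cancel_left)
            show ?thesis unfolding 2 lookup_scale_vec w(2) v1 by simp
          next
            case 3
            then have "k \<notin> Poly_Mapping.keys v" "k \<notin> Poly_Mapping.keys w" using v(1) wk by auto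
            then show ?thesis by (simp add: lookup_scale_vec in_keys_iff)
          qed (simp add: lookup_scale_vec w)
        qed
        then show "v \<in> vs.span {w}" by (metis vs.span_base vs.span_scale singletonI)
      qed
      have "w \<noteq> 0" using w by auto
      then show "vs.independent {w}" by simp
    qed simp
  qed
  then show ?thesis by (simp add: smooth_variety_def dim1)
qed

text \<open>A function vanishes at \<open>y\<close> iff it is a nonunit of the local ring at
  \<open>y\<close>, and a dominating ring has the same nonunits there. So allied local rings belong
  to points where the same functions vanish, and they coincide.\<close>

lemma integral_affine_variety:
  fixes x :: "nat \<Rightarrow> 'f::field univ_dom"
  shows "integral_variety {(n, x)}"
proof -
  have nz: "ev emb q x \<noteq> 0" if "y \<in> chart_points n x" "q \<in> polys {..<n}" "ev emb q y \<noteq> 0" for y q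
    using that by (auto simp: chart_points_def chart_ideal_def)
  have max: "ev emb q y = 0 \<longleftrightarrow> ev emb q x \<in> max_ideal (local_ring_at n x y)" and
    mem: "ev emb q x \<in> local_ring_at n x y"
    if y: "y \<in> chart_points n x" and q: "q \<in> polys {..<n}" for y q
  proof -
    have "ev emb q x = ev emb q x / ev emb 1 x" "ev emb 1 y \<noteq> 0" by simp_all
    then show mem: "ev emb q x \<in> local_ring_at n x y" unfolding local_ring_at_def using q polys_one by blast
    show "ev emb q y = 0 \<longleftrightarrow> ev emb q x \<in> max_ideal (local_ring_at n x y)"
    proof
      assume q0: "ev emb q y = 0"
      have False if i: "inverse (ev emb q x) \<in> local_ring_at n x y" and qx: "ev emb q x \<noteq> 0"
      proof -
        from i obtain a b where ab: "a \<in> polys {..<n}" "b \<in> polys {..<n}" "ev emb b y \<noteq> 0"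
          "inverse (ev emb q x) = ev emb a x / ev emb b x"
          unfolding local_ring_at_def by blast
        have "ev emb b x \<noteq> 0" using nz[OF y ab(2,3)] .
        then have "ev emb b x = ev emb a x * ev emb q x" using ab(4) qx by (simp add: field_simps)
        then have "b - a * q \<in> chart_ideal n x"
          using ab q by (simp add: chart_ideal_def polys_diff polys_mult emb.ev_diff emb.ev_mult)
        then have "ev emb (b - a * q) y = 0" using y unfolding chart_points_def by blast
        then show False using q0 ab(3) by (simp add: emb.ev_diff emb.ev_mult)
      qed
      then show "ev emb q x \<in> max_ideal (local_ring_at n x y)" using mem by (auto simp: max_ideal_def)
    next
      assume m: "ev emb q x \<in> max_ideal (local_ring_at n x y)"
      show "ev emb q y = 0"
      proof (rule ccontr)
        assume "ev emb q y \<noteq> 0"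
        then have "ev emb 1 x / ev emb q x \<in> local_ring_at n x y"
          unfolding local_ring_at_def using q polys_one by blast
        then show False using m nz[OF y q \<open>ev emb q y \<noteq> 0\<close>] by (simp add: max_ideal_def divide_inverse)
      qed
    qed
  qed
  have "local_ring_at n x y = local_ring_at n x y'"
    if y: "y \<in> chart_points n x" "y' \<in> chart_points n x" and al: "allied (local_ring_at n x y) (local_ring_at n x y')" for y y'
  proof -
    obtain R where R: "dominates R (local_ring_at n x y)" "dominates R (local_ring_at n x y')"
      using al by (auto simp: allied_def)
    have dom: "z \<in> max_ideal R \<longleftrightarrow> z \<in> max_ideal M" if "dominates R M" "z \<in> M" for M z
      using that by (auto simp: dominates_def)
    have "ev emb q y = 0 \<longleftrightarrow> ev emb q y' = 0" if q: "q \<in> polys {..<n}" for q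
      using max[OF y(1) q] max[OF y(2) q] dom[OF R(1) mem[OF y(1) q]] dom[OF R(2) mem[OF y(2) q]] by simp
    then show ?thesis unfolding local_ring_at_def by blast
  qed
  then show ?thesis by (auto simp: integral_variety_def)
qed

lemma nonsquare_of_ac:
  assumes "nonsquare (map_poly to_ac (D :: 'f::field poly))"
  shows "nonsquare D"
  unfolding nonsquare_def
proof (intro allI impI)
  fix a b assume eq: "a ^ 2 * D = b ^ 2"
  have inj: "p = 0" if "map_poly to_ac p = 0" for p :: "'f poly"
    using arg_cong[OF that, of "\<lambda>p. Polynomial.coeff p _"] by (intro poly_eqI) (simp add: coeff_map_poly)
  have "map_poly to_ac a ^ 2 * map_poly to_ac D = map_poly to_ac b ^ 2"
    using arg_cong[OF eq, of "map_poly to_ac"] by (simp add: power2_eq_square ac.map_poly_hom_mult)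
  then have "map_poly to_ac a = 0 \<and> map_poly to_ac b = 0" using assms unfolding nonsquare_def by blast
  then show "a = 0 \<and> b = 0" using inj by blast
qed

text \<open>The local parameter \<open>t\<close> is taken from \<open>F\<close> itself, so only a
  square root has to be found in each closure.\<close>

theorem PSCC_curve:
  fixes D :: "'f::field_char_0 poly"
  assumes F: "PSCC K S \<tau>" and D: "nonsquare (map_poly to_ac D)"
    and local: "\<And>R. R \<in> classical_closures K S \<tau> \<Longrightarrow> \<exists>t u. to_ac t \<in> R \<and> u \<in> R \<and> u ^ 2 * to_ac (poly D t) = 1"
  obtains t u where "u ^ 2 * poly D t = 1"
proof -
  have DF: "nonsquare D" by (rule nonsquare_of_ac[OF D])
  let ?V = "{(2, generic_point D)}"
  have poly_ac: "poly (map_poly to_ac D) (to_ac t) = to_ac (poly D t)" for t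
    by (induction D) simp_all
  have "has_rational_point R ?V" if R: "R \<in> classical_closures K S \<tau>" for R
  proof -
    obtain t u where tu: "to_ac t \<in> R" "u \<in> R" "u ^ 2 * to_ac (poly D t) = 1" using local[OF R] by blast
    define y where "y i = (if i = 0 then to_ac t else u)" for i :: nat
    have "\<forall>p\<in>chart_ideal 2 (generic_point D). ev to_ac p y = 0"
      unfolding chart_ideal_curve[OF DF]
      using tu(3) by (auto simp: ac.ev_mult ac.ev_curve_eq y_def poly_ac)
    moreover have "\<forall>i<2. y i \<in> R" using tu by (simp add: y_def)
    ultimately show ?thesis unfolding has_rational_point_def by blast
  qed
  moreover have "integral_variety ?V" by (rule integral_affine_variety)
  moreover have "geometrically_integral ?V" by (rule geometrically_integral_curve[OF DF D])
  moreover have "smooth_variety ?V" by (rule smooth_curve[OF DF])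
  ultimately have "has_rational_point (range to_ac) ?V" using F unfolding PSCC_def by blast
  then obtain y where y: "\<forall>i<2. y i \<in> range to_ac" "\<forall>p\<in>chart_ideal 2 (generic_point D). ev to_ac p y = 0"
    unfolding has_rational_point_def by auto
  have "1 * curve_eq D \<in> chart_ideal 2 (generic_point D)" unfolding chart_ideal_curve[OF DF] using polys_one by blast
  then have "ev to_ac (1 * curve_eq D) y = 0" using y(2) by blast
  then have e: "y 1 ^ 2 * poly (map_poly to_ac D) (y 0) = 1" by (simp add: ac.ev_curve_eq)
  have "y 0 \<in> range to_ac" "y 1 \<in> range to_ac" using y(1) by simp_all
  then obtain t u where tu: "y 0 = to_ac t" "y 1 = to_ac u" by blast
  have "to_ac (u ^ 2 * poly D t) = 1" using e unfolding tu by (simp add: poly_ac)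
  then have "u ^ 2 * poly D t = 1" by (simp only: to_ac_eq_1_iff)
  then show ?thesis by (rule that)
qed

section \<open>Orderings\<close>

text \<open>Replacing X by -X multiplies the i-th coefficient by (-1)^i, so every nonzero
  coefficient determines \<open>c\<close>. The leading and the lowest one give the two
  claims.\<close>

lemma parity_of_symmetric_poly:
  fixes p :: "'a::field poly"
  assumes sym: "pcompose p [:0, - 1:] = Polynomial.smult c p" and p: "p \<noteq> 0"
  shows "c = (- 1) ^ Polynomial.degree p" "c = (- 1) ^ Polynomial.order 0 p"
proof -
  have c: "c = (- 1) ^ i" if "Polynomial.coeff p i \<noteq> 0" for i
    using arg_cong[OF sym, of "\<lambda>p. Polynomial.coeff p i"] that by (simp add: coeff_pcompose_linear)
  show "c = (- 1) ^ Polynomial.degree p" using c p by simp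
  define k where "k = Polynomial.order 0 p"
  obtain q where q: "p = [:- 0, 1:] ^ k * q" "\<not> [:- 0, 1:] dvd q"
    using order_decomp[OF p] unfolding k_def by blast
  have "poly q 0 \<noteq> 0" using q(2) by (simp only: poly_eq_0_iff_dvd not_False_eq_True)
  moreover have pk: "p = Polynomial.monom 1 k * q" using q(1) by (simp add: monom_altdef)
  have "Polynomial.coeff p k = Polynomial.coeff q 0" unfolding pk by (simp add: coeff_monom_mult)
  ultimately show "c = (- 1) ^ Polynomial.order 0 p" using c[of k] by (simp add: poly_0_coeff_0 k_def)
qed

text \<open>If \<open>D(t) = E(t\<^sup>2)\<close> were a square in \<open>k(t)\<close>, its square root would be even or odd;
  the parity of its degree and that of its order at 0 disagree.\<close>

lemma nonsquare_even_sextic: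
  fixes d0 d1 d2 d3 :: "'a::field_char_0"
  assumes d: "d0 \<noteq> 0" "d3 \<noteq> 0"
  shows "nonsquare [:d0, 0, d1, 0, d2, 0, d3:]"
  unfolding nonsquare_def
proof (intro allI impI)
  fix a b :: "'a poly"
  define D where "D = [:d0, 0, d1, 0, d2, 0, d3:]"
  define r where "r p = pcompose p [:0, - 1 :: 'a:]" for p
  assume "a ^ 2 * [:d0, 0, d1, 0, d2, 0, d3:] = b ^ 2"
  then have eq: "a ^ 2 * D = b ^ 2" by (simp add: D_def)
  have r_mult: "r (p * q) = r p * r q" for p q by (simp add: r_def pcompose_mult)
  have rr: "r (r p) = p" for p by (rule poly_eqI) (simp add: r_def coeff_pcompose_linear flip: mult.assoc power_mult_distrib)
  have rD: "r D = D" by (simp add: r_def D_def pcompose_pCons)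
  have D0: "D \<noteq> 0" using d by (simp add: D_def)
  have degD: "Polynomial.degree D = 6" using d by (simp add: D_def)
  have ordD: "Polynomial.order 0 D = 0" using d by (intro order_0I) (simp add: D_def)
  show "a = 0 \<and> b = 0"
  proof (rule ccontr)
    assume "\<not> ?thesis"
    then have a: "a \<noteq> 0" and b: "b \<noteq> 0" using eq D0 by auto
    have r0: "r p \<noteq> 0" if "p \<noteq> 0" for p using rr[of p] that by (auto simp: r_def)
    \<comment> \<open>The fraction b / a is extended by \<open>r a\<close> to g / m. The denominator
      m is then even, and since g^2 = D m^2 is even too, g is even or odd.\<close>
    define g where "g = b * r a"
    define m where "m = a * r a"
    have g0: "g \<noteq> 0" "m \<noteq> 0" using a b r0 by (auto simp: g_def m_def)
    have eq': "r a ^ 2 * D = r b ^ 2"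
      using arg_cong[OF eq, of r] by (simp add: power2_eq_square r_mult rD)
    have g2: "g ^ 2 = D * m ^ 2"
      unfolding g_def m_def power_mult_distrib eq[symmetric] by (simp add: algebra_simps)
    have "(r g) ^ 2 = D * m ^ 2"
      unfolding g_def m_def r_mult rr power_mult_distrib eq'[symmetric] by (simp add: algebra_simps)
    then have "(r g) ^ 2 = g ^ 2" unfolding g2 .
    then have "r g = g \<or> r g = - g" by (simp only: power2_eq_iff)
    then obtain c where c: "r g = Polynomial.smult c g" by (metis smult_1_left smult_minus_left)
    have rm: "r m = Polynomial.smult 1 m" by (simp add: m_def r_mult rr mult.commute)
    note pg = parity_of_symmetric_poly[OF c[unfolded r_def] g0(1)]
    note pm = parity_of_symmetric_poly[OF rm[unfolded r_def] g0(2)]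
    have "2 * Polynomial.degree g = 6 + 2 * Polynomial.degree m"
      using arg_cong[OF g2, of Polynomial.degree] g0 D0 by (simp add: degree_mult_eq degree_power_eq degD)
    moreover have "2 * Polynomial.order 0 g = 2 * Polynomial.order 0 m"
      using arg_cong[OF g2, of "Polynomial.order 0"] g0 D0 by (simp add: order_mult power2_eq_square ordD)
    ultimately have "Polynomial.degree g = 3 + Polynomial.degree m" "Polynomial.order 0 g = Polynomial.order 0 m" by auto
    then have "c = - 1" "c = 1" using pg pm by (simp_all add: power_add)
    then show False by simp
  qed
qed

section \<open>Signs at an ordering\<close>

locale ordering_cone =
  fixes P :: "'a::field_char_0 set"
  assumes ordering: "ordering_on UNIV P"
begin

lemma add_P: "x \<in> P \<Longrightarrow> y \<in> P \<Longrightarrow> x + y \<in> P" and mult_P: "x \<in> P \<Longrightarrow> y \<in> P \<Longrightarrow> x * y \<in> P"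
  and total_P: "x \<in> P \<or> - x \<in> P" and antisym_P: "x \<in> P \<Longrightarrow> - x \<in> P \<Longrightarrow> x = 0"
  using ordering by (auto simp: ordering_on_def)

lemma square_P: "x ^ 2 \<in> P"
  using total_P[of x] mult_P[of x x] mult_P[of "- x" "- x"] by (auto simp: power2_eq_square)

lemma zero_P: "0 \<in> P" and one_P: "1 \<in> P"
  using square_P[of 0] square_P[of 1] by simp_all

lemma of_nat_P: "of_nat n \<in> P"
  by (induction n) (auto intro: add_P one_P zero_P)

lemma numeral_P: "numeral n \<in> P"
  using of_nat_P[of "numeral n"] by simp

lemma power_P: "x \<in> P \<Longrightarrow> x ^ n \<in> P"
  by (induction n) (auto intro: one_P mult_P)

lemma inverse_P: "x \<in> P \<Longrightarrow> inverse x \<in> P"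
  using mult_P[OF _ square_P[of "inverse x"], of x] by (cases "x = 0") (simp_all add: power2_eq_square flip: mult.assoc)

lemma add_eq_0: "x \<in> P \<Longrightarrow> y \<in> P \<Longrightarrow> x + y = 0 \<Longrightarrow> x = 0"
  using antisym_P[of x] by (simp add: eq_neg_iff_add_eq_0[symmetric] minus_equation_iff add_eq_0_iff2)

lemma numeral_add_neq_0: "x \<in> P \<Longrightarrow> numeral n + x \<noteq> 0"
  using add_eq_0[OF numeral_P, of x n] by auto

lemma inverse_of_nat_le_1:
  assumes "n > 0"
  shows "1 - inverse (of_nat n) \<in> P"
proof -
  have "of_nat (n - 1) * inverse (of_nat n) \<in> P" by (intro mult_P of_nat_P inverse_P)
  moreover have "of_nat (n - 1) * inverse (of_nat n) = (1 - inverse (of_nat n) :: 'a)"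
    using assms by (simp add: of_nat_diff field_simps)
  ultimately show ?thesis by simp
qed

text \<open>The difference is 2 (x - 1)^2 / x. Passing from x to 2 (x + 1/x) thus forces absolute
  value at least 4 at all orderings at once without changing signs.\<close>

lemma add_inverse_ge:
  assumes "x \<in> P" "x \<noteq> 0"
  shows "2 * (x + inverse x) - 4 \<in> P"
proof -
  have "2 * (x + inverse x) - 4 = 2 * ((x - 1) ^ 2 * inverse x)"
    using assms(2) by (simp add: power2_eq_square field_simps)
  also have "\<dots> \<in> P" using assms by (intro mult_P square_P inverse_P numeral_P)
  finally show ?thesis .
qed

lemma minus_P_iff: "x \<noteq> 0 \<Longrightarrow> - x \<in> P \<longleftrightarrow> x \<notin> P"
  using total_P[of x] antisym_P[of x] by auto

lemma mult_square_P_iff: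
  assumes "y \<noteq> 0"
  shows "x * y ^ 2 \<in> P \<longleftrightarrow> x \<in> P"
proof
  assume "x * y ^ 2 \<in> P"
  then have "x * y ^ 2 * inverse y ^ 2 \<in> P" using mult_P square_P by blast
  moreover have "x * y ^ 2 * inverse y ^ 2 = x" using assms by (simp add: field_simps)
  ultimately show "x \<in> P" by simp
qed (intro mult_P square_P)

lemma add_inverse_P_iff:
  assumes "x \<noteq> 0"
  shows "2 * (x + inverse x) \<in> P \<longleftrightarrow> x \<in> P" "2 * (x + inverse x) \<noteq> 0"
proof -
  have pos: "2 * (x + inverse x) \<in> P \<and> 2 * (x + inverse x) \<noteq> 0" if x: "x \<in> P" "x \<noteq> 0" for x
  proof -
    have e: "2 * (x + inverse x) = 4 + (2 * (x + inverse x) - 4)" by simp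
    show ?thesis
      using add_P[OF numeral_P add_inverse_ge[OF x]] numeral_add_neq_0[OF add_inverse_ge[OF x]] by (metis e)
  qed
  have neg: "2 * (- x + inverse (- x)) = - (2 * (x + inverse x))" by (simp add: algebra_simps)
  show nz: "2 * (x + inverse x) \<noteq> 0"
  proof (cases "x \<in> P")
    case True
    then show ?thesis using pos assms by blast
  next
    case False
    then have "- x \<in> P" using total_P by blast
    then have "2 * (- x + inverse (- x)) \<noteq> 0" using pos[of "- x"] assms by (metis neg_equal_0_iff_equal)
    then show ?thesis unfolding neg neg_equal_0_iff_equal .
  qed
  show "2 * (x + inverse x) \<in> P \<longleftrightarrow> x \<in> P"
  proof
    assume *: "2 * (x + inverse x) \<in> P"
    show "x \<in> P"
    proof (rule ccontr)
      assume "x \<notin> P"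
      then have "- x \<in> P" using total_P by blast
      then have "- (2 * (x + inverse x)) \<in> P" using pos[of "- x"] assms neg by (metis neg_equal_0_iff_equal)
      then show False using antisym_P[OF *] nz by blast
    qed
  qed (use pos assms in blast)
qed

end

text \<open>
  The coefficients are chosen so that \<open>a + b t\<^sup>2 = a b t\<^sup>4 - t\<^sup>6 / N - D(t)\<close>: where \<open>D(t)\<close> is positive,
  \<open>a + b t\<^sup>2\<close> is positive if both \<open>a\<close> and \<open>b\<close> are, and negative otherwise. The term \<open>- t\<^sup>6 / N\<close> is
  harmless at orderings, and makes \<open>D(t)\<close> a square for large \<open>t\<close> at \<open>p\<close>-adic primes if \<open>- N\<close> is one there.
\<close>

definition sign_poly :: "'a::field_char_0 \<Rightarrow> 'a \<Rightarrow> nat \<Rightarrow> 'a poly" where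
  "sign_poly a b N = [:- a, 0, - b, 0, a * b, 0, - inverse (of_nat N):]"

lemma poly_sign_poly:
  "poly (sign_poly a b N) t = a * b * t ^ 4 - b * t ^ 2 - a - t ^ 6 * inverse (of_nat N)"
  by (simp add: sign_poly_def power2_eq_square power4_eq_xxxx power_numeral_reduce algebra_simps)

lemma nonsquare_sign_poly:
  fixes a b :: "'f::field_char_0"
  assumes "a \<noteq> 0" "N > 0"
  shows "nonsquare (map_poly to_ac (sign_poly a b N))"
proof -
  have "map_poly to_ac (sign_poly a b N) =
      [:- to_ac a, 0, - to_ac b, 0, to_ac a * to_ac b, 0, - inverse (of_nat N):]"
    by (simp add: sign_poly_def)
  then show ?thesis using nonsquare_even_sextic[of "- to_ac a" "- inverse (of_nat N)"] assms by simp
qed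

context ordering_cone
begin

lemma sign_poly_sign:
  assumes t: "u ^ 2 * poly (sign_poly a b N) t = 1" and N: "N > 0" and nz: "a \<noteq> 0" "b \<noteq> 0"
  shows "a + b * t ^ 2 \<in> P \<longleftrightarrow> a \<in> P \<and> b \<in> P"
proof
  assume "a \<in> P \<and> b \<in> P"
  then show "a + b * t ^ 2 \<in> P" by (intro add_P mult_P square_P) auto
next
  assume c: "a + b * t ^ 2 \<in> P"
  have u0: "u \<noteq> 0" using t by auto
  have D: "poly (sign_poly a b N) t = inverse u ^ 2" using t u0 by (simp add: field_simps)
  \<comment> \<open>If a b <= 0, the identity for a + b t^2 writes its negative as a sum of
    nonnegative terms, one of which is D(t) > 0. If both \<open>a\<close> and \<open>b\<close> are
    negative, the form a + b t^2 is negative without the curve.\<close>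
  have mixed: False if "- (a * b) \<in> P"
  proof -
    have "- (a + b * t ^ 2) = inverse u ^ 2 + (- (a * b) * (t ^ 2) ^ 2 + (t ^ 3) ^ 2 * inverse (of_nat N))"
      using D unfolding poly_sign_poly by (simp add: algebra_simps flip: power_mult)
    then have "inverse u ^ 2 + ((- (a * b) * (t ^ 2) ^ 2 + (t ^ 3) ^ 2 * inverse (of_nat N)) + (a + b * t ^ 2)) = 0"
      by (simp add: algebra_simps)
    moreover have "(- (a * b) * (t ^ 2) ^ 2 + (t ^ 3) ^ 2 * inverse (of_nat N)) + (a + b * t ^ 2) \<in> P"
      by (rule add_P[OF _ c]) (intro add_P mult_P that square_P inverse_P of_nat_P)
    ultimately have "inverse u ^ 2 = 0" using add_eq_0 square_P by blast
    then show False using u0 by simp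
  qed
  show "a \<in> P \<and> b \<in> P"
  proof (rule ccontr)
    assume n: "\<not> ?thesis"
    show False
    proof (cases "a \<in> P")
      case True
      then have "- b \<in> P" using n total_P by blast
      then have "a * (- b) \<in> P" using True by (intro mult_P)
      then show False using mixed by simp
    next
      case False
      then have a: "- a \<in> P" using total_P by blast
      show False
      proof (cases "b \<in> P")
        case True
        then have "(- a) * b \<in> P" using a by (intro mult_P)
        then show False using mixed by simp
      next
        case False
        then have b: "- b \<in> P" using total_P by blast
        have "- a + ((- b) * t ^ 2 + (a + b * t ^ 2)) = 0" by simp
        moreover have "(- b) * t ^ 2 + (a + b * t ^ 2) \<in> P" by (rule add_P[OF mult_P[OF b square_P] c])
        ultimately have "- a = 0" using add_eq_0 a by blast
        then show False using nz by simp
      qed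
    qed
  qed
qed

text \<open>The witnesses are t = 0 for a < 0, where D(0) = - a; t = 1 for a, b > 0; and t = 1/a for
  a > 0 > b. In the last case the positive term - b t^2 must outweigh a b t^4 and - a, which the
  factor a^4 in \<open>b\<close> ensures; as an even power it keeps the sign.\<close>

lemma sign_poly_pos:
  assumes nz: "a0 \<noteq> 0" "b0 \<noteq> 0" and N: "N > 0"
    and a: "a = 2 * (a0 + inverse a0)" and b: "b = 2 * (b0 + inverse b0) * a ^ 4"
  shows "\<exists>t. poly (sign_poly a b N) t \<in> P \<and> poly (sign_poly a b N) t \<noteq> 0"
proof (cases "a0 \<in> P")
  case False
  then have "a \<notin> P" "a \<noteq> 0" using add_inverse_P_iff[OF nz(1)] a by auto
  then have "- a \<in> P" using total_P by blast
  then show ?thesis using \<open>a \<noteq> 0\<close> by (intro exI[of _ 0]) (simp add: poly_sign_poly)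
next
  case a0: True
  define i where "i = (inverse (of_nat N) :: 'a)"
  have i: "1 - i \<in> P" unfolding i_def by (rule inverse_of_nat_le_1[OF N])
  define p where "p = a - 4"
  have p: "p \<in> P" using add_inverse_ge[OF a0 nz(1)] by (simp add: p_def a)
  have ap: "a = 4 + p" by (simp add: p_def)
  have a1: "a - 1 \<in> P" using add_P[OF numeral_P p, of "num.Bit1 num.One"] by (simp add: ap)
  have aP: "a \<in> P" unfolding ap by (intro add_P numeral_P p)
  have anz: "a \<noteq> 0" unfolding ap by (rule numeral_add_neq_0[OF p])
  have apow: "a ^ n - 1 \<in> P" for n
  proof -
    have "a ^ n - 1 = (a - 1) * (\<Sum>i<n. a ^ i)" by (rule power_diff_1_eq)
    moreover have "(\<Sum>i<n. a ^ i) \<in> P" by (induction n) (auto intro: add_P power_P aP zero_P)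
    ultimately show ?thesis using mult_P[OF a1] by simp
  qed
  show ?thesis
  proof (cases "b0 \<in> P")
    case True
    define s where "s = 2 * (b0 + inverse b0) - 4"
    have s: "s \<in> P" unfolding s_def by (rule add_inverse_ge[OF True nz(2)])
    define r where "r = s * a ^ 4 + 4 * (a ^ 4 - 1)"
    have r: "r \<in> P" unfolding r_def by (intro add_P mult_P s power_P aP numeral_P apow)
    have br: "b = 4 + r" unfolding b r_def s_def by (simp add: algebra_simps)
    \<comment> \<open>The value is a b - a - b - 1/N, and 7 = 4 * 4 - 4 - 4 - 1.\<close>
    have "poly (sign_poly a b N) 1 = 7 + (p * r + 3 * p + 3 * r + (1 - i))"
      unfolding poly_sign_poly br ap i_def by (simp add: algebra_simps)
    moreover have "p * r + 3 * p + 3 * r + (1 - i) \<in> P" by (intro add_P mult_P p r i numeral_P)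
    ultimately show ?thesis using numeral_add_neq_0 add_P numeral_P by metis
  next
    case False
    then have b0: "- b0 \<in> P" using total_P by blast
    define s where "s = 2 * (- b0 + inverse (- b0)) - 4"
    have s: "s \<in> P" unfolding s_def by (rule add_inverse_ge[OF b0]) (use nz in simp)
    have bs: "b = - (4 + s) * a ^ 4" unfolding b s_def by (simp add: algebra_simps)
    define y where "y = (4 + s) * (a - 1) - 1"
    define z where "z = 4 * p + 3 * s + s * p"
    have yz: "y = 11 + z" unfolding y_def z_def ap by (simp add: algebra_simps)
    have z: "z \<in> P" unfolding z_def by (intro add_P mult_P numeral_P p s)
    \<comment> \<open>D(1/a) a^6 equals a^7 y - i, that is (a^7 - 1) y + y - i. With y = 11 + z and
      i <= 1 this is 10 plus the nonnegative \<open>w\<close>.\<close>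
    define w where "w = (a ^ 7 - 1) * y + z + (1 - i)"
    have w: "w \<in> P" unfolding w_def yz by (intro add_P mult_P numeral_P z i apow)
    note W = add_P[OF numeral_P w, of "num.Bit0 (num.Bit1 (num.Bit0 num.One))"]
      numeral_add_neq_0[OF w, of "num.Bit0 (num.Bit1 (num.Bit0 num.One))"]
    have eq: "poly (sign_poly a b N) (inverse a) = (10 + w) * (inverse a ^ 3) ^ 2"
    proof -
      define v where "v = inverse a"
      have av: "a * v = 1" using anz by (simp add: v_def)
      have av': "a ^ n * v ^ n = 1" for n using av by (simp flip: power_mult_distrib)
      have "(10 + w) * (v ^ 3) ^ 2 = a * (a ^ 6 * v ^ 6) * y - i * v ^ 6"
        unfolding w_def yz by (simp add: algebra_simps power_numeral_reduce)
      also have "\<dots> = a * y - i * v ^ 6" using av'[of 6] by simp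
      also have "\<dots> = poly (sign_poly a b N) v"
      proof -
        have "a * b * v ^ 4 = - a * (4 + s) * (a ^ 4 * v ^ 4)" unfolding bs by (simp add: algebra_simps)
        then have e1: "a * b * v ^ 4 = - a * (4 + s)" unfolding av' mult_1_right .
        have "b * v ^ 2 = - (4 + s) * a ^ 2 * (a ^ 2 * v ^ 2)"
          unfolding bs by (simp add: algebra_simps power_numeral_reduce)
        then have e2: "b * v ^ 2 = - (4 + s) * a ^ 2" unfolding av' mult_1_right .
        show ?thesis unfolding poly_sign_poly e1 e2 y_def i_def by (simp add: algebra_simps power2_eq_square)
      qed
      finally show ?thesis by (simp add: v_def)
    qed
    have "(10 + w) * (inverse a ^ 3) ^ 2 \<noteq> 0" using W(2) anz by simp
    moreover have "(10 + w) * (inverse a ^ 3) ^ 2 \<in> P" by (rule mult_P[OF W(1) square_P])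
    ultimately show ?thesis unfolding eq[symmetric] by blast
  qed
qed

end

section \<open>Points over the classical closures\<close>

lemma closure_unit_real:
  fixes P :: "'f::field_char_0 set"
  assumes R: "real_closure P R" and d: "d \<in> P" "d \<noteq> 0"
  shows "range to_ac \<subseteq> R \<and> (\<exists>u\<in>R. u ^ 2 * to_ac d = 1)"
proof -
  obtain Q where Q: "real_closed R" "ordering_on R Q" "Q \<inter> range to_ac = to_ac ` P"
    using R by (auto simp: real_closure_def)
  have R': "is_subfield R" "range to_ac \<subseteq> R" using Q by (auto simp: real_closed_def)
  have "to_ac d \<in> Q" using d Q by blast
  then obtain w where w: "w \<in> R" "w ^ 2 = to_ac d" using sqrt_in_real_closed[OF Q(1,2)] by blast
  have "w \<noteq> 0" using w(2) d by auto
  then have "inverse w ^ 2 * to_ac d = 1" unfolding w(2)[symmetric] by (simp flip: power_mult_distrib)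
  moreover have "inverse w \<in> R" using subfield_facts(6)[OF R'(1)] w by blast
  ultimately show ?thesis using R' by blast
qed

lemma sqrt_in_p_adic_closure:
  fixes P :: "'f::field_char_0 set"
  assumes R: "p_adic_closure P R" and p: "Factorial_Ring.prime p" "of_nat p \<in> max_ideal P" and z: "z \<in> P"
  obtains w where "is_subfield R" "range to_ac \<subseteq> R" "w \<in> R" "w ^ 2 = to_ac (1 + 4 * (of_nat p * z))"
proof -
  obtain Q where Q: "p_adically_closed R Q" "Q \<inter> range to_ac = to_ac ` P"
    using R by (auto simp: p_adic_closure_def)
  have R': "is_subfield R" "range to_ac \<subseteq> R" using Q by (auto simp: p_adically_closed_def)
  have mem: "to_ac x \<in> Q \<longleftrightarrow> x \<in> P" for x
  proof -
    have "to_ac x \<in> Q \<longleftrightarrow> to_ac x \<in> to_ac ` P" unfolding Q(2)[symmetric] by simp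
    then show ?thesis by (auto simp: image_iff)
  qed
  have "to_ac (of_nat p) \<in> max_ideal Q"
    using p(2) mem[of "of_nat p"] mem[of "inverse (of_nat p)"] unfolding max_ideal_def by simp
  then have "of_nat p \<in> max_ideal Q" by simp
  then obtain w where "w \<in> R" "w ^ 2 = 1 + 4 * (of_nat p * to_ac z)"
    using sqrt_in_p_adically_closed[OF Q(1) p(1), of "to_ac z"] mem z by blast
  then show ?thesis using that[OF R'] by simp
qed

text \<open>With N = 8 M - 1 and t = 1/s, multiplying D(t) by the square (N s^3)^2 turns the leading
  term into - N = 1 - 8 M and the others into multiples of s^2. For \<open>s\<close> close enough to
  0 the result has the form 1 + 4 p z, a square in the closure.\<close>

lemma sign_poly_p_adic:
  fixes P :: "'f::field_char_0 set"
  assumes R: "p_adic_closure P R" and p: "Factorial_Ring.prime p" "of_nat p \<in> max_ideal P" "p dvd M"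
    and M: "M > 0"
  shows "\<exists>t u. to_ac t \<in> R \<and> u \<in> R \<and> u ^ 2 * to_ac (poly (sign_poly a b (8 * M - 1)) t) = 1"
proof -
  interpret val_ring UNIV P
    using R by (simp add: p_adic_closure_def p_valuation_def val_ring_def is_subfield_UNIV)
  have integral: "\<exists>r\<in>P. r \<noteq> 0 \<and> r * y \<in> P" for y
  proof (cases "y \<in> P")
    case True
    then show ?thesis by (intro bexI[of _ 1]) auto
  next
    case False
    then have "inverse y \<in> P" "y \<noteq> 0" using V_or_inverse_max[of y] max_ideal_V by auto
    then show ?thesis by (intro bexI[of _ "inverse y"]) auto
  qed
  obtain r1 where r1: "r1 \<in> P" "r1 \<noteq> 0" "r1 * (a * b) \<in> P" using integral by blast
  obtain r2 where r2: "r2 \<in> P" "r2 \<noteq> 0" "r2 * a \<in> P" using integral by blast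
  obtain r3 where r3: "r3 \<in> P" "r3 \<noteq> 0" "r3 * b \<in> P" using integral by blast
  define r where "r = r1 * r2 * r3"
  have "r * (a * b) = (r1 * (a * b)) * r2 * r3" "r * a = (r2 * a) * r1 * r3" "r * b = (r3 * b) * r1 * r2"
    by (simp_all add: r_def algebra_simps)
  then have "r * (a * b) \<in> P" "r * a \<in> P" "r * b \<in> P"
    using mult_V[OF mult_V] r1 r2 r3 by metis+
  moreover have "r \<in> P" "r \<noteq> 0" using r1 r2 r3 by (auto simp: r_def)
  ultimately have r: "r \<in> P" "r \<noteq> 0" "r * (a * b) \<in> P" "r * a \<in> P" "r * b \<in> P" by blast+
  have p0: "of_nat p \<noteq> (0::'f)" using p(1) by auto
  obtain M' where M': "M = p * M'" using p(3) by blast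
  define N where "N = 8 * M - 1"
  define n where "n = (of_nat N :: 'f)"
  have "N > 0" using M by (simp add: N_def)
  then have N0: "n \<noteq> 0" by (simp add: n_def)
  have Ndef: "n = 8 * (of_nat p * of_nat M') - 1" using M by (simp add: n_def N_def of_nat_diff M')
  \<comment> \<open>\<open>r\<close> clears the denominators of a b, a and b. In each remaining term
    one factor s = 4 p r supplies both the 4 p and the \<open>r\<close>, which leaves
    \<open>z\<close> integral.\<close>
  define s where "s = 4 * of_nat p * r"
  define z where "z = n ^ 2 * (s * (r * (a * b)) - s ^ 3 * (r * b) - s ^ 5 * (r * a)) - 2 * of_nat M'"
  have numP: "numeral k \<in> P" for k using of_nat_V[of "numeral k"] by simp
  have nP: "n \<in> P" by (simp add: n_def)
  have sP: "s \<in> P" "s \<noteq> 0" using r p0 numP by (auto simp: s_def)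
  have zP: "z \<in> P" unfolding z_def by (intro diff_V mult_V power_V sP r nP numP of_nat_V)
  obtain w where w: "is_subfield R" "range to_ac \<subseteq> R" "w \<in> R" "w ^ 2 = to_ac (1 + 4 * (of_nat p * z))"
    using sqrt_in_p_adic_closure[OF R p(1,2) zP] .
  have "1 + 4 * (of_nat p * z) \<noteq> 0"
  \<comment> \<open>The element is congruent to 1, as \<open>p\<close> is a nonunit, so
    \<open>w\<close> can be inverted.\<close>
  proof
    assume *: "1 + 4 * (of_nat p * z) = 0"
    have "(of_nat p * z) * 4 \<in> max_ideal P" by (intro mult_max p zP numP)
    moreover have "(of_nat p * z) * 4 = - 1" using * by (simp add: eq_neg_iff_add_eq_0 algebra_simps)
    ultimately show False using uminus_max[of "- 1"] by simp
  qed
  then have w0: "w \<noteq> 0" using w(4) by (metis power_zero_numeral to_ac_eq_0_iff)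
  have D: "poly (sign_poly a b N) (inverse s) * (n * s ^ 3) ^ 2 = 1 + 4 * (of_nat p * z)"
  proof -
    define v where "v = inverse s"
    have vs: "v ^ k * s ^ k = 1" for k using sP by (simp add: v_def flip: power_mult_distrib)
    have s6: "(n * s ^ 3) ^ 2 = n ^ 2 * s ^ 6" by (simp add: power_mult_distrib flip: power_mult)
    have "poly (sign_poly a b N) v * (n * s ^ 3) ^ 2 =
        n ^ 2 * (a * b * (v ^ 4 * s ^ 4) * s ^ 2 - b * (v ^ 2 * s ^ 2) * s ^ 4 - a * s ^ 6)
          - (v ^ 6 * s ^ 6) * (inverse n * n) * n"
      unfolding poly_sign_poly s6 n_def[symmetric] by (simp add: algebra_simps power_numeral_reduce)
    also have "\<dots> = n ^ 2 * (a * b * s ^ 2 - b * s ^ 4 - a * s ^ 6) - n"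
      using N0 by (simp add: vs)
    also have "\<dots> = 1 + 4 * (of_nat p * z)"
    proof -
      have "4 * of_nat p * z = n ^ 2 * (a * b * (s * (4 * of_nat p * r)) - b * (s ^ 3 * (4 * of_nat p * r)) - a * (s ^ 5 * (4 * of_nat p * r)))
          - 8 * (of_nat p * of_nat M')"
        unfolding z_def by (simp add: algebra_simps)
      also have "\<dots> = n ^ 2 * (a * b * s ^ 2 - b * s ^ 4 - a * s ^ 6) - (n + 1)"
        unfolding s_def[symmetric] Ndef by (simp add: power_numeral_reduce algebra_simps)
      finally show ?thesis by (simp add: algebra_simps)
    qed
    finally show ?thesis by (simp add: v_def)
  qed
  define u where "u = to_ac (n * s ^ 3) / w"
  have "u ^ 2 * to_ac (poly (sign_poly a b N) (inverse s)) =
      to_ac (poly (sign_poly a b N) (inverse s) * (n * s ^ 3) ^ 2) / w ^ 2"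
    by (simp add: u_def power_divide)
  also have "\<dots> = 1" unfolding D w(4)[symmetric] using w0 by simp
  finally have "u ^ 2 * to_ac (poly (sign_poly a b N) (inverse s)) = 1" .
  moreover have "u \<in> R" unfolding u_def by (rule subfield_facts(8)[OF w(1) subsetD[OF w(2) rangeI] w(3)])
  ultimately show ?thesis using w(2) unfolding N_def by blast
qed

text \<open>A valuation ring contains -1 and so cannot lie above an ordering. Between orderings both
  indices are 1, and the relative type (1, 1) is below every (e, f).\<close>

lemma primes_above_ordering:
  fixes K :: "'f::field_char_0 set"
  assumes K: "is_subfield K" and q: "ordering_on K q" and ef: "e > 0" "f > 0"
  shows "primes_above K q (e, f) = {P. ordering_on UNIV P \<and> P \<inter> K = q}"
proof -
  have "ordering_on UNIV P" if "classical_prime UNIV P" "P \<inter> K = q" for P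
  proof (rule ccontr)
    assume "\<not> ?thesis"
    then have "p_valuation UNIV P" using that by (simp add: classical_prime_def)
    then interpret val_ring UNIV P by (simp add: p_valuation_def val_ring_def is_subfield_UNIV)
    have "1 \<in> q" "- 1 \<in> q" using that(2) one_V uminus_V[OF one_V] K by (auto simp: is_subfield_def)
    then have "(1::'f) = 0" using q by (auto simp: ordering_on_def)
    then show False by simp
  qed
  moreover have "type_le (relative_type K q UNIV P) (e, f)" if "ordering_on UNIV P" for P
    using that q ef by (simp add: relative_type_def ram_index_def res_degree_def type_le_def)
  ultimately show ?thesis by (auto simp: primes_above_def classical_prime_def)
qed

theorem SAP_ordering:
  fixes K :: "'f::field_char_0 set"
  assumes K: "is_subfield K" and S: "finite S" "\<forall>q\<in>S. local_prime K q"
    and ef: "e > 0" "f > 0" and F: "PSCC K S (e, f)" and q: "ordering_on K q"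
  shows "SAP (primes_above K q (e, f))"
proof (rule SAP_I)
  note A = primes_above_ordering[OF K q ef]
  show "prime_on UNIV P" if "P \<in> primes_above K q (e, f)" for P
    using that by (simp add: A prime_on_def)
  have eq: "{\<xi>. {x. \<xi> x} \<in> primes_above K q (e, f)} = {\<xi>.
      (\<forall>x. \<forall>y. \<xi> x \<and> \<xi> y \<longrightarrow> \<xi> (x + y) \<and> \<xi> (x * y)) \<and> (\<forall>x. \<xi> x \<or> \<xi> (- x)) \<and>
      (\<forall>x. \<xi> x \<and> \<xi> (- x) \<longrightarrow> x = 0) \<and> (\<forall>x. (\<xi> x \<and> x \<in> K) \<longleftrightarrow> x \<in> q)}"
    unfolding A by (auto simp: ordering_on_def set_eq_iff)
  show "closedin patch_topology {\<xi>. {x. \<xi> x} \<in> primes_above K q (e, f)}"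
    unfolding eq by (intro closed_conj closed_all) (rule closed_patch_clopen, intro patch_clopen_intros)+
  have cone: "ordering_cone P" if "P \<in> primes_above K q (e, f)" for P
    using that by (simp add: A ordering_cone_def)
  show "\<exists>b. \<forall>P\<in>primes_above K q (e, f). a \<notin> P \<longleftrightarrow> b \<in> P" for a
  proof (cases "a = 0")
    case True
    \<comment> \<open>Every cone contains 0, so the complement is empty and is cut out by
      -1.\<close>
    have "a \<notin> P \<longleftrightarrow> - 1 \<in> P" if "P \<in> primes_above K q (e, f)" for P
      using True ordering_cone.minus_P_iff[OF cone[OF that], of 1] ordering_cone.one_P[OF cone[OF that]]
        ordering_cone.zero_P[OF cone[OF that]] by simp
    then show ?thesis by blast
  next
    case False
    then show ?thesis using ordering_cone.minus_P_iff[OF cone, of _ a] by blast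
  qed
  fix a0 b0 :: 'f
  show "\<exists>c. \<forall>P\<in>primes_above K q (e, f). c \<in> P \<longleftrightarrow> a0 \<in> P \<and> b0 \<in> P"
  proof (cases "a0 = 0 \<or> b0 = 0 \<or> primes_above K q (e, f) = {}")
    case True
    have "0 \<in> P" if "P \<in> primes_above K q (e, f)" for P using ordering_cone.zero_P[OF cone[OF that]] .
    then show ?thesis using True by (elim disjE) (blast, blast, simp)
  next
    case False
    then obtain P0 where P0: "P0 \<in> primes_above K q (e, f)" and nz: "a0 \<noteq> 0" "b0 \<noteq> 0" by blast
    \<comment> \<open>At every ordering, \<open>a, b\<close> have the signs of \<open>a0, b0\<close>, and \<open>\<bar>a\<bar> \<ge> 4\<close>, \<open>\<bar>b\<bar> \<ge> 4 a\<^sup>4\<close>.\<close>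
    define a where "a = 2 * (a0 + inverse a0)"
    define b where "b = 2 * (b0 + inverse b0) * a ^ 4"
    \<comment> \<open>The ordering \<open>P0\<close> is what excludes x + 1/x = 0, that is x^2 =
      -1.\<close>
    have ab: "a \<noteq> 0" "b \<noteq> 0"
      using ordering_cone.add_inverse_P_iff(2)[OF cone[OF P0]] nz by (auto simp: a_def b_def)
    have sign: "a \<in> P \<longleftrightarrow> a0 \<in> P" "b \<in> P \<longleftrightarrow> b0 \<in> P" if "ordering_cone P" for P
    proof -
      interpret ordering_cone P by fact
      show "a \<in> P \<longleftrightarrow> a0 \<in> P" unfolding a_def by (rule add_inverse_P_iff(1)[OF nz(1)])
      have "b = 2 * (b0 + inverse b0) * (a ^ 2) ^ 2" by (simp add: b_def flip: power_mult)
      then show "b \<in> P \<longleftrightarrow> b0 \<in> P"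
        using mult_square_P_iff[of "a ^ 2"] ab add_inverse_P_iff(1)[OF nz(2)] by simp
    qed
    define M where "M = (\<Prod>q | q \<in> S \<and> p_valuation K q. residue_char q)"
    have res: "Factorial_Ring.prime (residue_char q)" if "p_valuation K q" for q
      using p_valuation_structure[OF K that] by metis
    have M0: "M > 0" unfolding M_def by (intro prod_pos) (auto dest!: res prime_gt_0_nat)
    \<comment> \<open>\<open>1 - 8 M\<close> is a square at the \<open>p\<close>-adic primes above \<open>S\<close>, as \<open>p\<close> divides \<open>M\<close>.\<close>
    define D where "D = sign_poly a b (8 * M - 1)"
    have N0: "8 * M - 1 > 0" using M0 by simp
    have "\<exists>t u. to_ac t \<in> R \<and> u \<in> R \<and> u ^ 2 * to_ac (poly D t) = 1" if R: "R \<in> classical_closures K S (e, f)" for R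
    proof -
      obtain q' P where q': "q' \<in> S" "P \<in> primes_above K q' (e, f)" and cl: "p_adic_closure P R \<or> real_closure P R"
        using R unfolding classical_closures_def by blast
      from cl show ?thesis
      proof
        assume rc: "real_closure P R"
        then interpret ordering_cone P by (simp add: real_closure_def ordering_cone_def)
        obtain t where "poly D t \<in> P" "poly D t \<noteq> 0"
          using sign_poly_pos[OF nz N0 a_def b_def] unfolding D_def by blast
        then show ?thesis using closure_unit_real[OF rc] by blast
      next
        assume pc: "p_adic_closure P R"
        then have pv: "p_valuation UNIV P" by (simp add: p_adic_closure_def)
        have PK: "P \<inter> K = q'" using q' by (simp add: primes_above_def)
        interpret val_ring UNIV P using pv by (simp add: p_valuation_def val_ring_def is_subfield_UNIV)
        obtain p where p: "Factorial_Ring.prime p" "of_nat p \<in> max_ideal P" using pv by (auto simp: p_valuation_def)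
        have K1: "1 \<in> K" "- 1 \<in> K" using K by (auto simp: is_subfield_def)
        \<comment> \<open>\<open>q'\<close> contains -1, so of the two kinds of local primes it is a
          p-valuation, and its residue characteristic \<open>p\<close> is a factor of
          \<open>M\<close>.\<close>
        have "\<not> ordering_on K q'"
        proof
          assume o: "ordering_on K q'"
          have "1 \<in> q'" "- 1 \<in> q'" using PK K1 one_V uminus_V[OF one_V] by auto
          then have "(1::'f) = 0" using o unfolding ordering_on_def by blast
          then show False by simp
        qed
        then have pq: "p_valuation K q'" using S q' by (auto simp: local_prime_def archimedean_ordering_on_def)
        then interpret q: val_ring K q' using K by (simp add: p_valuation_def val_ring_def)
        have "of_nat p \<in> max_ideal q'" using max_ideal_restrict[OF K PK, of "of_nat p"] p(2) q.V_subset by blast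
        then have "residue_char q' = p" using q.residue_char_eqI p(1) by blast
        moreover have "residue_char q' dvd M" unfolding M_def using S q' pq by (intro dvd_prodI) auto
        ultimately show ?thesis using sign_poly_p_adic[OF pc p _ M0] unfolding D_def by blast
      qed
    qed
    then obtain t u where tu: "u ^ 2 * poly D t = 1"
      using PSCC_curve[OF F nonsquare_sign_poly[OF ab(1) N0]] unfolding D_def by blast
    have "a + b * t ^ 2 \<in> P \<longleftrightarrow> a0 \<in> P \<and> b0 \<in> P" if "P \<in> primes_above K q (e, f)" for P
      using ordering_cone.sign_poly_sign[OF cone[OF that] tu[unfolded D_def] N0 ab] sign[OF cone[OF that]] by simp
    then show ?thesis by blast
  qed
qed

theorem theorem1p3:
  fixes K :: "'f::field_char_0 set" and S :: "'f set set" and e f :: nat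
  assumes "is_subfield K"
    and "finite S" and "\<forall>q\<in>S. local_prime K q"
    and "e > 0" and "f > 0"
    and "PSCC K S (e, f)"
  shows "\<forall>q\<in>S. SAP (primes_above K q (e, f))"
proof
  fix q assume "q \<in> S"
  then have "p_valuation K q \<or> ordering_on K q"
    using assms(3) by (auto simp: local_prime_def archimedean_ordering_on_def)
  then show "SAP (primes_above K q (e, f))"
    using SAP_p_adic[OF assms(1) _ assms(4,5)] SAP_ordering[OF assms] by blast
qed

end
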